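(* Let $n\ge1$, $s\in(0,n]$ and let $\Omega\subset\mathbb{R}^{n+1}$ satisfy $\Omega\in\mathrm{AR}(s)$; if $s=n$, assume in addition that $\Omega$ satisfies the pointwise John condition. If $f\in L^p(\sigma_s)$ with $p\in(1,\infty)$, there exist $u:\Omega\to\mathbb{R}$ and $c_0\in(0,\tfrac14]$ such that, for any $c\in(0,c_0]$: (i) $u\in C^\infty(\Omega)$; (ii) $\|\mathcal N(u)\|_{L^p(\sigma_s)}+\|\mathcal N(\delta_\Omega\nabla u)\|_{L^p(\sigma_s)}\lesssim\|f\|_{L^p(\sigma_s)}$; (iii) $\|\mathcal C_{s,c}(\nabla u)\|_{L^p(\sigma_s)}\lesssim\|f\|_{L^p(\sigma_s)}$; (iv) for $\sigma_s$-almost every $\xi\in\partial\Omega$, the function $x\mapsto\frac1{|B(x,\delta_\Omega(x)/2)|}\int_{B(x,\delta_\Omega(x)/2)}u(y)\,dy$ converges to $f(\xi)$ at $\xi$ non-tangentially if $s<n$, and quasi-non-tangentially if $s=n$. The constant $c_0$ depends only on the dimension, the Ahlfors regularity constants and the corkscrew condition.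
   Context: A closed set $E\subset\mathbb{R}^{n+1}$ is $s$-Ahlfors regular if there is $C_0>0$ with $C_0^{-1}r^s\le\mathcal H^s(E\cap B(x,r))\le C_0r^s$ for all $x\in E$, $0<r<\operatorname{diam}E$. An open set $\Omega$ satisfies the corkscrew condition if there is $c_*\in(0,1/2)$ such that for every $\xi\in\partial\Omega$ and $0<r<\operatorname{diam}\Omega$ there is $x\in\Omega\cap B(\xi,r)$ with $B(x,c_*r)\subset\Omega\cap B(\xi,r)$. For $s\in(0,n]$, $\Omega\in\mathrm{AR}(s)$ means: if $s=n$, $\Omega\subset\mathbb R^{n+1}$ is open, satisfies the corkscrew condition, and $\partial\Omega$ is $n$-Ahlfors regular; if $s<n$, $\Omega=\mathbb{R}^{n+1}\setminus E$ for some $s$-Ahlfors regular set $E$. Put $\sigma_s=\mathcal H^s|_{\partial\Omega}$, $\delta_\Omega(x)=\operatorname{dist}(x,\Omega^c)$. A $\theta$-good curve ($\theta\in(0,1]$) connecting $\xi\in\partial\Omega$ and $x\in\Omega$ is a connected rectifiable curve $\gamma:[0,\ell]\to\overline\Omega$ parametrized by arclength with $\gamma(0)=\xi$, $\gamma(\ell)=x$, $\gamma\setminus\{\xi\}\subset\Omega$ and $\delta_\Omega(\gamma(t))>\theta t$ for $t\in(0,\ell]$. Pointwise John condition: there is $\theta\in(0,1)$ such that for $\sigma_n$-a.e. $\xi\in\partial\Omega$ there exist $r_\xi>0$ and $x_\xi\in\Omega\cap B(\xi,2r_\xi)$ with $\delta_\Omega(x_\xi)\ge\theta r_\xi$, and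 a $\theta$-good curve $\gamma_\xi\subset B(\xi,2r_\xi)$ (lying in $\Omega$ except for its endpoint $\xi$) connecting $\xi$ and $x_\xi$ with length $\ell(\gamma_\xi)\le\theta^{-1}r_\xi$. Cone: $\gamma_\alpha(\xi)=\{x\in\Omega:|x-\xi|<(1+\alpha)\operatorname{dist}(x,\partial\Omega)\}$, with a fixed aperture $\alpha>0$ (different apertures give comparable $L^p$ norms). Non-tangential maximal function: $\mathcal N(w)(\xi)=\sup_{x\in\gamma_\alpha(\xi)}|w(x)|$. For $c\in(0,1/2]$, $\mathcal C_{s,c}(F)(\xi)=\sup_{r>0}\frac1{r^s}\int_{B(\xi,r)\cap\Omega}\big(\sup_{y\in B(x,c\delta_\Omega(x))}|F(y)|\big)\,\delta_\Omega(x)^{s-n}\,dx$. $F:\Omega\to\mathbb R$ converges non-tangentially to $f$ at $\xi$ if there is $\alpha>0$ such that $F(x_k)\to f(\xi)$ for every sequence $x_k\in\gamma_\alpha(\xi)$ with $x_k\to\xi$. It converges quasi-non-tangentially to $f$ at $\xi$ if there exist $r_\xi>0$, a corkscrew point $x_\xi\in\Omega\cap B(\xi,2r_\xi)$ (i.e. $\delta_\Omega(x_\xi)\ge\theta r_\xi$) and a $\theta$-good curve $\gamma_\xi\subset B(\xi,2r_\xi)$ connecting $\xi$ and $x_\xi$ such that $F(x_k)\to f(\xi)$ for every sequence $x_k\in\gamma_\xi$ with $x_k\to\xi$. $A\lesssim B$ means $A\le CB$ with a constant $C>0$ independent of $f$. *)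

theory Defs
  imports "HOL-Analysis.Analysis"
begin

section \<open>Hausdorff measure\<close>

text \<open>
  \<open>hausdorff_pre d s A\<close> is the size-\<open>d\<close> approximation of the \<open>s\<close>-dimensional Hausdorff
  measure, with the normalisation \<open>\<Sum>i. (diam (C i))\<^sup>s\<close> (no dimensional factor). Only \<open>s > 0\<close>
  is intended, since \<open>0 powr 0 = 0\<close>. The library's \<open>diameter\<close> is \<open>0\<close> on
  unbounded sets, hence the explicit boundedness requirement.
\<close>

definition hausdorff_pre :: "real \<Rightarrow> real \<Rightarrow> 'a::metric_space set \<Rightarrow> ennreal" where
  "hausdorff_pre d s A =
     (INF C \<in> {C :: nat \<Rightarrow> 'a set. A \<subseteq> (\<Union>i. C i) \<and> (\<forall>i. bounded (C i) \<and> diameter (C i) \<le> d)}.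
        \<Sum>i. ennreal (diameter (C i) powr s))"

definition hausdorff_outer :: "real \<Rightarrow> 'a::metric_space set \<Rightarrow> ennreal" where
  "hausdorff_outer s A = (SUP d \<in> {0<..}. hausdorff_pre d s A)"

definition hausdorff_measure :: "real \<Rightarrow> 'a::metric_space measure" where
  "hausdorff_measure s = measure_of UNIV (sets borel) (hausdorff_outer s)"

text \<open>
  \<open>measure_of\<close> silently yields the zero measure if the set function is not a measure, so we check
  that \<open>hausdorff_measure s\<close> really extends the outer measure (see \<open>emeasure_hausdorff_measure\<close>).
\<close>

lemma hausdorff_pre_mono: "A \<subseteq> B \<Longrightarrow> hausdorff_pre d s A \<le> hausdorff_pre d s B"
  unfolding hausdorff_pre_def by (rule INF_superset_mono) auto

lemma hausdorff_pre_antimono: "d \<le> d' \<Longrightarrow> hausdorff_pre d' s A \<le> hausdorff_pre d s A"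
  unfolding hausdorff_pre_def by (rule INF_superset_mono) (auto intro: order_trans)

lemma hausdorff_pre_empty: "0 \<le> d \<Longrightarrow> hausdorff_pre d s {} = 0"
proof -
  assume "0 \<le> d"
  then have "hausdorff_pre d s {} \<le> (\<Sum>i::nat. ennreal (diameter ({}::'a set) powr s))"
    unfolding hausdorff_pre_def by (intro INF_lower2[of "\<lambda>_. {}"]) auto
  then show ?thesis by simp
qed

lemma hausdorff_pre_le_outer: "0 < d \<Longrightarrow> hausdorff_pre d s A \<le> hausdorff_outer s A"
  unfolding hausdorff_outer_def by (rule SUP_upper) auto

lemma hausdorff_outer_mono: "A \<subseteq> B \<Longrightarrow> hausdorff_outer s A \<le> hausdorff_outer s B"
  unfolding hausdorff_outer_def by (intro SUP_mono) (auto intro: hausdorff_pre_mono)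

lemma hausdorff_outer_empty: "hausdorff_outer s {} = 0"
  unfolding hausdorff_outer_def by (simp add: hausdorff_pre_empty)

lemma hausdorff_pre_subadditive:
  fixes A :: "nat \<Rightarrow> 'a::metric_space set"
  shows "hausdorff_pre d s (\<Union>i. A i) \<le> (\<Sum>i. hausdorff_pre d s (A i))"
proof (rule ennreal_le_epsilon)
  fix e :: real assume "0 < e" and fin: "(\<Sum>n. hausdorff_pre d s (A n)) < top"
  have lt: "hausdorff_pre d s (A n) < hausdorff_pre d s (A n) + ennreal (e * (1/2)^Suc n)" for n
    using fin \<open>0 < e\<close> by (auto simp add: less_top dest!: ennreal_suminf_lessD)
  have "\<exists>B::nat \<Rightarrow> 'a set. A n \<subseteq> (\<Union>i. B i) \<and> (\<forall>i. bounded (B i) \<and> diameter (B i) \<le> d) \<and>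
      (\<Sum>i. ennreal (diameter (B i) powr s)) \<le> hausdorff_pre d s (A n) + ennreal (e * (1/2)^Suc n)" for n
    using lt[of n] unfolding hausdorff_pre_def[of d s "A n"] INF_less_iff
    by (auto intro: less_imp_le)
  then obtain B :: "nat \<Rightarrow> nat \<Rightarrow> 'a set" where
      B: "\<And>n. A n \<subseteq> (\<Union>i. B n i)" "\<And>n i. bounded (B n i)" "\<And>n i. diameter (B n i) \<le> d"
    and Ble: "\<And>n. (\<Sum>i. ennreal (diameter (B n i) powr s))
                  \<le> hausdorff_pre d s (A n) + ennreal (e * (1/2)^Suc n)"
    by metis
  define C where "C k = (case prod_decode k of (n, i) \<Rightarrow> B n i)" for k
  have "(\<Union>i. A i) \<subseteq> (\<Union>k. C k)"
  proof
    fix x assume "x \<in> (\<Union>i. A i)"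
    then obtain n i where "x \<in> B n i" using B(1) by blast
    then have "x \<in> C (prod_encode (n, i))" by (simp add: C_def)
    then show "x \<in> (\<Union>k. C k)" by blast
  qed
  then have "hausdorff_pre d s (\<Union>i. A i) \<le> (\<Sum>k. ennreal (diameter (C k) powr s))"
    unfolding hausdorff_pre_def
    by (intro INF_lower) (auto simp: C_def B split: prod.split)
  also have "\<dots> = (\<Sum>k. (\<lambda>(n, i). ennreal (diameter (B n i) powr s)) (prod_decode k))"
    by (intro suminf_cong) (simp add: C_def split: prod.split)
  also have "\<dots> = (\<Sum>n. \<Sum>i. ennreal (diameter (B n i) powr s))"
    by (rule suminf_ennreal_2dimen) simp
  also have "\<dots> \<le> (\<Sum>n. hausdorff_pre d s (A n) + ennreal (e * (1/2) ^ Suc n))"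
    by (intro suminf_le allI Ble) auto
  also have "\<dots> = (\<Sum>n. hausdorff_pre d s (A n)) + (\<Sum>n. ennreal e * ennreal ((1/2) ^ Suc n))"
    using \<open>0 < e\<close> by (subst suminf_add[symmetric])
      (auto simp del: ennreal_suminf_cmult simp add: ennreal_mult[symmetric])
  also have "\<dots> = (\<Sum>n. hausdorff_pre d s (A n)) + ennreal e"
    unfolding ennreal_suminf_cmult
    by (subst suminf_ennreal_eq[OF zero_le_power power_half_series]) auto
  finally show "hausdorff_pre d s (\<Union>i. A i) \<le> (\<Sum>n. hausdorff_pre d s (A n)) + ennreal e" .
qed

lemma hausdorff_outer_subadditive:
  "hausdorff_outer s (\<Union>i::nat. A i) \<le> (\<Sum>i. hausdorff_outer s (A i))"
  unfolding hausdorff_outer_def[of s "\<Union>i. A i"]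
proof (rule SUP_least)
  fix d :: real assume "d \<in> {0<..}"
  then show "hausdorff_pre d s (\<Union>i. A i) \<le> (\<Sum>i. hausdorff_outer s (A i))"
    by (intro order_trans[OF hausdorff_pre_subadditive] suminf_le) (auto intro: hausdorff_pre_le_outer)
qed

lemma hausdorff_outer_measure_space: "outer_measure_space UNIV (hausdorff_outer s)"
  unfolding outer_measure_space_def positive_def increasing_def countably_subadditive_def
  by (auto simp: hausdorff_outer_empty hausdorff_outer_mono hausdorff_outer_subadditive)

lemma hausdorff_outer_Un: "hausdorff_outer s (A \<union> B) \<le> hausdorff_outer s A + hausdorff_outer s B"
proof -
  let ?F = "\<lambda>i::nat. if i = 0 then A else if i = 1 then B else {}"
  have "(\<Union>i. ?F i) = A \<union> B" by (auto split: if_splits)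
  moreover have "(\<Sum>i. hausdorff_outer s (?F i)) = (\<Sum>i\<in>{0,1}. hausdorff_outer s (?F i))"
    by (rule suminf_finite) (auto simp: hausdorff_outer_empty)
  ultimately show ?thesis using hausdorff_outer_subadditive[of s ?F] by simp
qed

lemma hausdorff_pre_separated:
  fixes A B :: "'a::metric_space set"
  assumes "\<And>x y. x \<in> A \<Longrightarrow> y \<in> B \<Longrightarrow> d < dist x y" "0 < d"
  shows "hausdorff_pre d s A + hausdorff_pre d s B \<le> hausdorff_pre d s (A \<union> B)"
  unfolding hausdorff_pre_def[of d s "A \<union> B"]
proof (rule INF_greatest, clarify)
  fix C :: "nat \<Rightarrow> 'a set"
  assume C: "A \<union> B \<subseteq> (\<Union>i. C i)" "\<forall>i. bounded (C i) \<and> diameter (C i) \<le> d"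
  define CA where "CA i = (if C i \<inter> A = {} then {} else C i)" for i
  define CB where "CB i = (if C i \<inter> B = {} then {} else C i)" for i
  have disj: "CA i = {} \<or> CB i = {}" for i
  proof (rule ccontr)
    assume "\<not> ?thesis"
    then obtain x y where "x \<in> C i" "x \<in> A" "y \<in> C i" "y \<in> B"
      by (auto simp: CA_def CB_def split: if_splits)
    then have "d < dist x y" "dist x y \<le> diameter (C i)" "diameter (C i) \<le> d"
      using assms(1) diameter_bounded_bound C(2) by blast+
    then show False by simp
  qed
  then have le: "ennreal (diameter (CA i) powr s) + ennreal (diameter (CB i) powr s)
      \<le> ennreal (diameter (C i) powr s)" for i
  proof -
    consider "CA i = {}" "CB i = C i \<or> CB i = {}" | "CB i = {}" "CA i = C i \<or> CA i = {}"
      using disj[of i] by (auto simp: CA_def CB_def)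
    then show ?thesis by cases auto
  qed
  have "hausdorff_pre d s A \<le> (\<Sum>i. ennreal (diameter (CA i) powr s))"
    unfolding hausdorff_pre_def using C \<open>0 < d\<close>
    by (intro INF_lower CollectI conjI subsetI) (fastforce simp: CA_def)+
  moreover have "hausdorff_pre d s B \<le> (\<Sum>i. ennreal (diameter (CB i) powr s))"
    unfolding hausdorff_pre_def using C \<open>0 < d\<close>
    by (intro INF_lower CollectI conjI subsetI) (fastforce simp: CB_def)+
  ultimately have "hausdorff_pre d s A + hausdorff_pre d s B \<le>
      (\<Sum>i. ennreal (diameter (CA i) powr s)) + (\<Sum>i. ennreal (diameter (CB i) powr s))"
    by (rule add_mono)
  also have "\<dots> = (\<Sum>i. ennreal (diameter (CA i) powr s) + ennreal (diameter (CB i) powr s))"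
    by (rule suminf_add) auto
  also have "\<dots> \<le> (\<Sum>i. ennreal (diameter (C i) powr s))"
    by (intro suminf_le le) auto
  finally show "hausdorff_pre d s A + hausdorff_pre d s B \<le> (\<Sum>i. ennreal (diameter (C i) powr s))" .
qed

lemma hausdorff_outer_separated:
  fixes A B :: "'a::metric_space set"
  assumes "\<And>x y. x \<in> A \<Longrightarrow> y \<in> B \<Longrightarrow> d < dist x y" "0 < d"
  shows "hausdorff_outer s A + hausdorff_outer s B \<le> hausdorff_outer s (A \<union> B)"
proof -
  have 1: "hausdorff_pre a s A + hausdorff_pre b s B \<le> hausdorff_outer s (A \<union> B)"
    if "0 < a" "0 < b" for a b
  proof -
    let ?e = "min d (min a b)"
    have "hausdorff_pre a s A + hausdorff_pre b s B \<le> hausdorff_pre ?e s A + hausdorff_pre ?e s B"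
      by (intro add_mono hausdorff_pre_antimono) auto
    also have "\<dots> \<le> hausdorff_pre ?e s (A \<union> B)"
      by (rule hausdorff_pre_separated) (use assms that in \<open>force+\<close>)
    also have "\<dots> \<le> hausdorff_outer s (A \<union> B)"
      by (rule hausdorff_pre_le_outer) (use assms that in auto)
    finally show ?thesis .
  qed
  have "hausdorff_outer s A + hausdorff_pre b s B \<le> hausdorff_outer s (A \<union> B)" if "0 < b" for b
    unfolding hausdorff_outer_def[of s A]
    by (subst ennreal_SUP_add_left[symmetric]) (auto intro!: SUP_least 1 that)
  then show ?thesis
    unfolding hausdorff_outer_def[of s B]
    by (subst ennreal_SUP_add_right) (auto intro!: SUP_least)
qed

lemma ennreal_suminf_tail_tendsto_0:
  fixes f :: "nat \<Rightarrow> ennreal"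
  assumes "(\<Sum>i. f i) < top"
  shows "(\<lambda>n. \<Sum>i. f (i + n)) \<longlonglongrightarrow> 0"
proof -
  define g where "g i = enn2real (f i)" for i
  have "f i < top" for i using ennreal_suminf_lessD[OF assms] .
  then have f: "f i = ennreal (g i)" for i by (simp add: g_def)
  have g0: "0 \<le> g i" for i by (simp add: g_def)
  have sg: "summable g"
    using assms by (intro summable_suminf_not_top g0) (auto simp: f)
  have "(\<lambda>n. suminf g - (\<Sum>i<n. g i)) \<longlonglongrightarrow> suminf g - suminf g"
    by (intro tendsto_diff tendsto_const summable_LIMSEQ sg)
  then have "(\<lambda>n. \<Sum>i. g (i + n)) \<longlonglongrightarrow> 0"
    by (simp add: suminf_minus_initial_segment[OF sg])
  then have "(\<lambda>n. ennreal (\<Sum>i. g (i + n))) \<longlonglongrightarrow> ennreal 0"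
    by (rule tendsto_ennrealI)
  moreover have "ennreal (\<Sum>i. g (i + n)) = (\<Sum>i. f (i + n))" for n
    unfolding f using sg by (intro suminf_ennreal2[symmetric] g0) (simp add: summable_iff_shift)
  ultimately show ?thesis by simp
qed

lemma closed_in_lambda_system_hausdorff_outer:
  fixes F :: "'a::metric_space set"
  assumes "closed F"
  shows "F \<in> lambda_system UNIV UNIV (hausdorff_outer s)"
proof (cases "F = {}")
  case True
  then show ?thesis by (simp add: lambda_system_def hausdorff_outer_empty)
next
  case False
  let ?H = "hausdorff_outer s"
  have "?H (F \<inter> T) + ?H ((UNIV - F) \<inter> T) = ?H T" for T
  proof (rule antisym)
    have "?H T \<le> ?H ((F \<inter> T) \<union> ((UNIV - F) \<inter> T))" by (rule hausdorff_outer_mono) auto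
    then show "?H T \<le> ?H (F \<inter> T) + ?H ((UNIV - F) \<inter> T)"
      using hausdorff_outer_Un order_trans by blast
  next
    show "?H (F \<inter> T) + ?H ((UNIV - F) \<inter> T) \<le> ?H T"
    proof (cases "?H T = top")
      case True then show ?thesis by simp
    next
      case finT: False
      define E where "E n = {x \<in> T. 1 / real (Suc n) \<le> infdist x F}" for n
      define R where "R n = E (Suc n) - E n" for n
      have ET: "E n \<subseteq> T" and RT: "R n \<subseteq> T" for n by (auto simp: E_def R_def)
      have Emono: "E n \<subseteq> E (Suc n)" for n
      proof -
        have "1 / real (Suc (Suc n)) \<le> 1 / real (Suc n)" by (simp add: field_simps)
        then show ?thesis unfolding E_def by (auto simp del: of_nat_Suc)
      qed
      have sepE: "?H (F \<inter> T) + ?H (E n) \<le> ?H T" for n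
      proof -
        have "?H (F \<inter> T) + ?H (E n) \<le> ?H ((F \<inter> T) \<union> E n)"
        proof (rule hausdorff_outer_separated[where d = "1 / (2 * real (Suc n))"])
          fix x y assume "x \<in> F \<inter> T" "y \<in> E n"
          then have "1 / real (Suc n) \<le> dist y x"
            using infdist_le[of x F y] by (auto simp: E_def)
          moreover have "1 / (2 * real (Suc n)) < 1 / real (Suc n)" by (simp add: field_simps)
          ultimately show "1 / (2 * real (Suc n)) < dist x y" by (simp add: dist_commute)
        qed simp
        also have "\<dots> \<le> ?H T" by (rule hausdorff_outer_mono) (use ET in auto)
        finally show ?thesis .
      qed
      have sepR: "?H U + ?H (R (Suc (Suc m))) \<le> ?H (U \<union> R (Suc (Suc m)))"
        if U: "U \<subseteq> E (Suc m)" for U m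
      proof -
        define d where "d = (1 / real (Suc (Suc m)) - 1 / real (Suc (Suc (Suc m)))) / 2"
        have "1 / real (Suc (Suc (Suc m))) < 1 / real (Suc (Suc m))"
          by (intro divide_strict_left_mono) auto
        then have "0 < d" by (simp add: d_def)
        show ?thesis
        proof (rule hausdorff_outer_separated[OF _ \<open>0 < d\<close>])
          fix x y assume "x \<in> U" "y \<in> R (Suc (Suc m))"
          then have "1 / real (Suc (Suc m)) \<le> infdist x F"
            and "infdist y F < 1 / real (Suc (Suc (Suc m)))"
            using U by (auto simp: E_def R_def simp del: of_nat_Suc)
          moreover have "infdist x F \<le> infdist y F + dist x y" by (rule infdist_triangle)
          ultimately have "2 * d < dist x y" by (simp add: d_def del: of_nat_Suc)
          then show "d < dist x y" using \<open>0 < d\<close> by simp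
        qed
      qed
      have Eincr: "E m \<subseteq> E n" if "m \<le> n" for m n
        using lift_Suc_mono_le[of E m n] Emono that by auto
      have bd: "(\<Sum>k<N. ?H (R (2 * k + j))) \<le> ?H (\<Union>k<N. R (2 * k + j))" if "j \<le> 1" for j N
      proof (induction N)
        case 0 then show ?case by simp
      next
        case (Suc N)
        show ?case
        proof (cases N)
          case 0
          have "{..<Suc 0} = {0::nat}" by auto
          then show ?thesis using 0 by simp
        next
          case (Suc M)
          have sub: "(\<Union>k<N. R (2 * k + j)) \<subseteq> E (Suc (2 * M + j))"
          proof
            fix x assume "x \<in> (\<Union>k<N. R (2 * k + j))"
            then obtain k where "k < N" "x \<in> E (Suc (2 * k + j))" by (auto simp: R_def)
            moreover have "Suc (2 * k + j) \<le> Suc (2 * M + j)" using \<open>k < N\<close> Suc by simp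
            ultimately show "x \<in> E (Suc (2 * M + j))" using Eincr by blast
          qed
          have idx: "Suc (Suc (2 * M + j)) = 2 * N + j" using Suc by simp
          have "(\<Sum>k<Suc N. ?H (R (2 * k + j))) \<le> ?H (\<Union>k<N. R (2 * k + j)) + ?H (R (2 * N + j))"
            using Suc.IH by (simp add: add_right_mono)
          also have "\<dots> \<le> ?H ((\<Union>k<N. R (2 * k + j)) \<union> R (2 * N + j))"
            using sepR[OF sub] unfolding idx .
          also have "(\<Union>k<N. R (2 * k + j)) \<union> R (2 * N + j) = (\<Union>k<Suc N. R (2 * k + j))"
            by (auto simp: less_Suc_eq)
          finally show ?thesis .
        qed
      qed
      have bd': "(\<Sum>k<N. ?H (R (2 * k + j))) \<le> ?H T" if "j \<le> 1" for j N
        by (rule order_trans[OF bd[OF that] hausdorff_outer_mono]) (use RT in auto)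
      have bd2: "(\<Sum>i<n. ?H (R i)) \<le> ?H T + ?H T" for n
      proof -
        have "(\<Sum>i<n. ?H (R i)) \<le> (\<Sum>i<2*n. ?H (R i))" by (rule sum_mono2) auto
        also have "\<dots> = (\<Sum>k<n. ?H (R (2 * k + 0))) + (\<Sum>k<n. ?H (R (2 * k + 1)))"
          by (induction n) (auto simp: ac_simps)
        also have "\<dots> \<le> ?H T + ?H T" by (intro add_mono bd') auto
        finally show ?thesis .
      qed
      have "(\<Sum>i. ?H (R i)) \<le> ?H T + ?H T"
        by (rule suminf_le_const) (use bd2 in \<open>auto intro: summableI\<close>)
      then have sumfin: "(\<Sum>i. ?H (R i)) < top"
        by (rule le_less_trans) (use finT in \<open>simp add: less_top\<close>)
      have cover: "(UNIV - F) \<inter> T \<subseteq> E n \<union> (\<Union>i. R (i + n))" for n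
      proof
        fix x assume x: "x \<in> (UNIV - F) \<inter> T"
        then have "infdist x F > 0"
          using in_closed_iff_infdist_zero[OF assms False, of x] infdist_nonneg[of x F] by force
        then obtain m where "inverse (real (Suc m)) < infdist x F"
          using reals_Archimedean by blast
        then have m: "x \<in> E m" using x by (auto simp: E_def inverse_eq_divide simp del: of_nat_Suc)
        show "x \<in> E n \<union> (\<Union>i. R (i + n))"
        proof (rule ccontr)
          assume nin: "x \<notin> E n \<union> (\<Union>i. R (i + n))"
          have "x \<notin> E (i + n)" for i
            by (induction i) (use nin in \<open>auto simp: R_def\<close>)
          moreover have "x \<in> E (m + n)" using m Eincr[of m "m + n"] by auto
          ultimately show False by blast
        qed
      qed
      have tail: "?H (F \<inter> T) + ?H ((UNIV - F) \<inter> T) \<le> ?H T + (\<Sum>i. ?H (R (i + n)))" for n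
      proof -
        have "?H ((UNIV - F) \<inter> T) \<le> ?H (E n) + ?H (\<Union>i. R (i + n))"
          by (rule order_trans[OF hausdorff_outer_mono[OF cover[of n]] hausdorff_outer_Un])
        also have "\<dots> \<le> ?H (E n) + (\<Sum>i. ?H (R (i + n)))"
          by (intro add_left_mono hausdorff_outer_subadditive)
        finally have "?H (F \<inter> T) + ?H ((UNIV - F) \<inter> T) \<le> (?H (F \<inter> T) + ?H (E n)) + (\<Sum>i. ?H (R (i + n)))"
          by (metis add.assoc add_left_mono)
        also have "\<dots> \<le> ?H T + (\<Sum>i. ?H (R (i + n)))" by (intro add_right_mono sepE)
        finally show ?thesis .
      qed
      have "(\<lambda>n. \<Sum>i. ?H (R (i + n))) \<longlonglongrightarrow> 0"
        by (rule ennreal_suminf_tail_tendsto_0[OF sumfin])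
      then have "(\<lambda>n. ?H T + (\<Sum>i. ?H (R (i + n)))) \<longlonglongrightarrow> ?H T + 0"
        by (intro tendsto_add tendsto_const)
      then show ?thesis
        using tail by (intro LIMSEQ_le_const[of _ "?H T"]) auto
    qed
  qed
  then show ?thesis by (simp add: lambda_system_def)
qed

lemma measure_space_hausdorff_outer: "measure_space UNIV (sets borel) (hausdorff_outer s)"
proof -
  interpret sigma_algebra UNIV "UNIV :: 'a set set" using sigma_algebra_Pow[of UNIV] by simp
  let ?L = "lambda_system UNIV UNIV (hausdorff_outer s) :: 'a set set"
  have ms: "measure_space UNIV ?L (hausdorff_outer s)"
    by (rule caratheodory_lemma[OF hausdorff_outer_measure_space])
  then interpret L: sigma_algebra UNIV ?L by (simp add: measure_space_def)
  have "sets (borel :: 'a measure) \<subseteq> ?L"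
    unfolding borel_eq_closed
    by (simp, rule L.sigma_sets_subset) (auto intro: closed_in_lambda_system_hausdorff_outer)
  moreover have "sigma_algebra UNIV (sets (borel :: 'a measure))"
    using sets.sigma_algebra_axioms[of borel] by simp
  ultimately show ?thesis using ms measure_down by blast
qed

lemma sets_hausdorff_measure [simp, measurable_cong]: "sets (hausdorff_measure s) = sets borel"
  unfolding hausdorff_measure_def using sets.sets_measure_of_eq[of borel] by simp

lemma space_hausdorff_measure [simp]: "space (hausdorff_measure s) = UNIV"
  unfolding hausdorff_measure_def by (simp add: space_measure_of_conv)

lemma emeasure_hausdorff_measure:
  "A \<in> sets borel \<Longrightarrow> emeasure (hausdorff_measure s) A = hausdorff_outer s A"
  using measure_space_hausdorff_outer[of s] unfolding hausdorff_measure_def measure_space_def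
  by (subst emeasure_measure_of_sigma) auto


section \<open>Ahlfors regular sets, corkscrew and pointwise John conditions\<close>

text \<open>
  The diameter as an extended number: unlike the library's \<open>diameter\<close>, it is \<open>\<infinity>\<close> on unbounded
  sets. All balls \<open>B(x,r)\<close> are open.
\<close>

definition ediam :: "'a::metric_space set \<Rightarrow> ennreal" where
  "ediam E = (SUP x\<in>E. SUP y\<in>E. ennreal (dist x y))"

definition ahlfors_regular :: "real \<Rightarrow> real \<Rightarrow> 'a::euclidean_space set \<Rightarrow> bool" where
  "ahlfors_regular s C0 E \<longleftrightarrow> closed E \<and> C0 > 0 \<and>
     (\<forall>x\<in>E. \<forall>r>0. ennreal r < ediam E \<longrightarrow>
        ennreal (r powr s / C0) \<le> emeasure (hausdorff_measure s) (E \<inter> ball x r) \<and>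
        emeasure (hausdorff_measure s) (E \<inter> ball x r) \<le> ennreal (C0 * r powr s))"

definition corkscrew :: "real \<Rightarrow> 'a::euclidean_space set \<Rightarrow> bool" where
  "corkscrew c \<Omega> \<longleftrightarrow> 0 < c \<and> c < 1/2 \<and>
     (\<forall>\<xi>\<in>frontier \<Omega>. \<forall>r>0. ennreal r < ediam \<Omega> \<longrightarrow>
        (\<exists>x \<in> \<Omega> \<inter> ball \<xi> r. ball x (c * r) \<subseteq> \<Omega> \<inter> ball \<xi> r))"

text \<open>
  \<open>\<Omega> \<in> AR(s)\<close> with Ahlfors regularity constant \<open>C0\<close> and corkscrew constant \<open>c\<close>; the ambient
  space has dimension \<open>n + 1\<close>. The corkscrew constant plays no role when \<open>s < n\<close>.
\<close>

definition AR_domain :: "nat \<Rightarrow> real \<Rightarrow> real \<Rightarrow> real \<Rightarrow> 'a::euclidean_space set \<Rightarrow> bool" where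
  "AR_domain n s C0 c \<Omega> \<longleftrightarrow>
     (if s = real n then open \<Omega> \<and> corkscrew c \<Omega> \<and> ahlfors_regular s C0 (frontier \<Omega>)
      else s < real n \<and> (\<exists>E. ahlfors_regular s C0 E \<and> \<Omega> = - E))"

definition surface_measure :: "real \<Rightarrow> 'a::euclidean_space set \<Rightarrow> 'a measure" where
  "surface_measure s \<Omega> = restrict_space (hausdorff_measure s) (frontier \<Omega>)"

definition bdist :: "'a::euclidean_space set \<Rightarrow> 'a \<Rightarrow> real" where
  "bdist \<Omega> x = infdist x (- \<Omega>)"

definition curve_length :: "(real \<Rightarrow> 'a::metric_space) \<Rightarrow> real \<Rightarrow> real \<Rightarrow> ennreal" where
  "curve_length \<gamma> a b =
     (SUP (t, N) \<in> {(t :: nat \<Rightarrow> real, N). mono t \<and> range t \<subseteq> {a..b}}.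
        \<Sum>i<N. ennreal (dist (\<gamma> (t i)) (\<gamma> (t (Suc i)))))"

text \<open>
  A \<open>\<theta>\<close>-good curve \<open>\<gamma> : [0,l] \<rightarrow> closure \<Omega>\<close> connecting \<open>\<xi>\<close> and \<open>x\<close>. Parametrisation by
  arclength makes \<open>\<gamma>\<close> rectifiable of length \<open>l\<close>; connectedness comes from continuity.
\<close>

definition good_curve ::
  "real \<Rightarrow> 'a::euclidean_space set \<Rightarrow> 'a \<Rightarrow> 'a \<Rightarrow> real \<Rightarrow> (real \<Rightarrow> 'a) \<Rightarrow> bool" where
  "good_curve \<theta> \<Omega> \<xi> x l \<gamma> \<longleftrightarrow> 0 \<le> l \<and> continuous_on {0..l} \<gamma> \<and>
     (\<forall>a b. 0 \<le> a \<and> a \<le> b \<and> b \<le> l \<longrightarrow> curve_length \<gamma> a b = ennreal (b - a)) \<and>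
     \<gamma> ` {0..l} \<subseteq> closure \<Omega> \<and> \<gamma> 0 = \<xi> \<and> \<gamma> l = x \<and> \<gamma> ` {0..l} - {\<xi>} \<subseteq> \<Omega> \<and>
     (\<forall>t\<in>{0<..l}. \<theta> * t < bdist \<Omega> (\<gamma> t))"

definition pointwise_john :: "real \<Rightarrow> real \<Rightarrow> 'a::euclidean_space set \<Rightarrow> bool" where
  "pointwise_john s \<theta> \<Omega> \<longleftrightarrow> 0 < \<theta> \<and> \<theta> < 1 \<and>
     (AE \<xi> in surface_measure s \<Omega>. \<exists>r>0. \<exists>x \<in> \<Omega> \<inter> ball \<xi> (2 * r). \<theta> * r \<le> bdist \<Omega> x \<and>
        (\<exists>l \<gamma>. good_curve \<theta> \<Omega> \<xi> x l \<gamma> \<and> \<gamma> ` {0..l} \<subseteq> ball \<xi> (2 * r) \<and> l \<le> r / \<theta>))"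


section \<open>Maximal functions and norms\<close>

definition cone :: "real \<Rightarrow> 'a::euclidean_space set \<Rightarrow> 'a \<Rightarrow> 'a set" where
  "cone \<alpha> \<Omega> \<xi> = {x \<in> \<Omega>. norm (x - \<xi>) < (1 + \<alpha>) * infdist x (frontier \<Omega>)}"

definition nt_max ::
  "real \<Rightarrow> 'a::euclidean_space set \<Rightarrow> ('a \<Rightarrow> 'b::real_normed_vector) \<Rightarrow> 'a \<Rightarrow> ennreal" where
  "nt_max \<alpha> \<Omega> w \<xi> = (SUP x \<in> cone \<alpha> \<Omega> \<xi>. ennreal (norm (w x)))"

definition carleson ::
  "nat \<Rightarrow> real \<Rightarrow> real \<Rightarrow> 'a::euclidean_space set \<Rightarrow> ('a \<Rightarrow> 'b::real_normed_vector) \<Rightarrow> 'a \<Rightarrow> ennreal" where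
  "carleson n s c \<Omega> F \<xi> =
     (SUP r \<in> {0<..}. ennreal (1 / r powr s) *
        (\<integral>\<^sup>+ x \<in> ball \<xi> r \<inter> \<Omega>.
           (SUP y \<in> ball x (c * bdist \<Omega> x). ennreal (norm (F y))) * ennreal (bdist \<Omega> x powr (s - real n))
         \<partial>lborel))"

definition ennreal_powr :: "ennreal \<Rightarrow> real \<Rightarrow> ennreal" where
  "ennreal_powr x p = (if x = \<infinity> then \<infinity> else ennreal (enn2real x powr p))"

text \<open>The \<open>L\<^sup>p\<close> norm of an extended nonnegative function, intended for \<open>p > 0\<close>.\<close>

definition Lp_enorm :: "real \<Rightarrow> 'a measure \<Rightarrow> ('a \<Rightarrow> ennreal) \<Rightarrow> ennreal" where
  "Lp_enorm p M g = ennreal_powr (\<integral>\<^sup>+ x. ennreal_powr (g x) p \<partial>M) (1 / p)"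

abbreviation Lp_norm :: "real \<Rightarrow> 'a measure \<Rightarrow> ('a \<Rightarrow> real) \<Rightarrow> ennreal" where
  "Lp_norm p M f \<equiv> Lp_enorm p M (\<lambda>x. ennreal \<bar>f x\<bar>)"

definition Lp_space :: "real \<Rightarrow> 'a measure \<Rightarrow> ('a \<Rightarrow> real) set" where
  "Lp_space p M = {f \<in> borel_measurable M. Lp_norm p M f < \<infinity>}"


section \<open>Smooth functions and boundary convergence\<close>

definition gradient :: "('a::euclidean_space \<Rightarrow> real) \<Rightarrow> 'a \<Rightarrow> 'a" where
  "gradient u x = (\<Sum>b\<in>Basis. frechet_derivative u (at x) b *\<^sub>R b)"

lemma GDERIV_gradient:
  assumes "u differentiable at x"
  shows "GDERIV u x :> gradient u x"
proof -
  let ?D = "frechet_derivative u (at x)"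
  have D: "(u has_derivative ?D) (at x)" using assms frechet_derivative_works by blast
  interpret bounded_linear ?D using D by (rule has_derivative_bounded_linear)
  have "?D h = h \<bullet> gradient u x" for h
  proof -
    have "?D h = ?D (\<Sum>b\<in>Basis. (h \<bullet> b) *\<^sub>R b)" by (simp add: euclidean_representation)
    also have "\<dots> = (\<Sum>b\<in>Basis. (h \<bullet> b) * ?D b)" by (simp add: sum scaleR)
    finally show ?thesis by (simp add: gradient_def inner_sum_right ac_simps)
  qed
  then have "?D = (\<lambda>h. h \<bullet> gradient u x)" by blast
  then show ?thesis using D by (simp add: gderiv_def)
qed

fun Ck_on :: "nat \<Rightarrow> 'a::euclidean_space set \<Rightarrow> ('a \<Rightarrow> real) \<Rightarrow> bool" where
  "Ck_on 0 \<Omega> u \<longleftrightarrow> continuous_on \<Omega> u"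
| "Ck_on (Suc k) \<Omega> u \<longleftrightarrow> (\<forall>x\<in>\<Omega>. u differentiable at x) \<and>
     (\<forall>b\<in>Basis. Ck_on k \<Omega> (\<lambda>x. frechet_derivative u (at x) b))"

definition smooth_on :: "'a::euclidean_space set \<Rightarrow> ('a \<Rightarrow> real) \<Rightarrow> bool" where
  "smooth_on \<Omega> u \<longleftrightarrow> (\<forall>k. Ck_on k \<Omega> u)"

definition nt_converges ::
  "'a::euclidean_space set \<Rightarrow> ('a \<Rightarrow> real) \<Rightarrow> ('a \<Rightarrow> real) \<Rightarrow> 'a \<Rightarrow> bool" where
  "nt_converges \<Omega> F f \<xi> \<longleftrightarrow> (\<exists>\<alpha>>0. \<forall>X :: nat \<Rightarrow> 'a.
     (\<forall>k. X k \<in> cone \<alpha> \<Omega> \<xi>) \<longrightarrow> X \<longlonglongrightarrow> \<xi> \<longrightarrow> (\<lambda>k. F (X k)) \<longlonglongrightarrow> f \<xi>)"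

text \<open>
  The sequences run in the curve minus its endpoint \<open>\<xi>\<close>, because \<open>F\<close> is only meaningful on \<open>\<Omega>\<close>.
\<close>

definition quasi_nt_converges ::
  "real \<Rightarrow> 'a::euclidean_space set \<Rightarrow> ('a \<Rightarrow> real) \<Rightarrow> ('a \<Rightarrow> real) \<Rightarrow> 'a \<Rightarrow> bool" where
  "quasi_nt_converges \<theta> \<Omega> F f \<xi> \<longleftrightarrow>
     (\<exists>r>0. \<exists>x \<in> \<Omega> \<inter> ball \<xi> (2 * r). \<theta> * r \<le> bdist \<Omega> x \<and>
        (\<exists>l \<gamma>. good_curve \<theta> \<Omega> \<xi> x l \<gamma> \<and> \<gamma> ` {0..l} \<subseteq> ball \<xi> (2 * r) \<and>
           (\<forall>X :: nat \<Rightarrow> 'a. (\<forall>k. X k \<in> \<gamma> ` {0..l} - {\<xi>}) \<longrightarrow> X \<longlonglongrightarrow> \<xi> \<longrightarrow>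
              (\<lambda>k. F (X k)) \<longlonglongrightarrow> f \<xi>)))"

definition whitney_average :: "'a::euclidean_space set \<Rightarrow> ('a \<Rightarrow> real) \<Rightarrow> 'a \<Rightarrow> real" where
  "whitney_average \<Omega> u x =
     (LINT y : ball x (bdist \<Omega> x / 2) | lborel. u y) / measure lborel (ball x (bdist \<Omega> x / 2))"

end

theory Submission
  imports Defs
begin

text \<open>
  Write \<open>E\<close> for the boundary of \<open>\<Omega>\<close>, \<open>\<sigma>\<close> for the surface measure and \<open>\<delta>\<close> for the distance to
  \<open>E\<close>. The extension is a series of thin boundary layers. Choose smooth Lipschitz functions \<open>G j\<close> of
  bounded support, defined on the whole space, with \<open>G 0 = 0\<close> and
  \<open>\<integral>\<bar>f - G j\<bar>\<^sup>p d\<sigma> \<le> 4 powr (-p j) \<integral>\<bar>f\<bar>\<^sup>p d\<sigma>\<close>, put \<open>g j = G (j+1) - G j\<close>, and let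
  \<open>u = (\<Sum>j. u j)\<close> with \<open>u j = \<phi> j * g j\<close>, where \<open>\<phi> j\<close> is a smooth cutoff equal to \<open>1\<close> near \<open>E\<close> and
  vanishing where \<open>\<delta> \<ge> \<epsilon> j\<close>.

  What makes this work is that the bounds on \<open>u\<close> may not depend on the width \<open>\<epsilon> j\<close>, whereas
  \<open>\<epsilon> j\<close> may depend on \<open>g j\<close> in any way. The cutoff contributes a gradient of size
  \<open>\<bar>g j\<bar> / \<epsilon> j\<close> on a layer of width \<open>\<epsilon> j\<close>, hence a total variation of size \<open>\<bar>g j\<bar>\<close> in the direction
  transversal to \<open>E\<close>; and once \<open>\<epsilon> j\<close> times the Lipschitz constant of \<open>g j\<close> is small, the function
  \<open>g j\<close> is nearly constant at scale \<open>\<epsilon> j\<close>, so that its own gradient contributes almost nothing. Thus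
  in a cone with vertex \<open>\<eta> \<in> E\<close> one has \<open>\<bar>u j\<bar> \<le> h j \<eta>\<close> and \<open>\<bar>\<nabla>u j\<bar> \<le> (4 / \<epsilon> j) h j \<eta>\<close>, where \<open>h j\<close> is
  \<open>\<bar>g j\<bar>\<close> plus a tiny multiple of the indicator of a ball (\<open>boundary_layer_extension\<close>). The norms of
  the \<open>h j\<close> decay geometrically, so \<open>H = (\<Sum>j. h j)\<close> satisfies \<open>\<parallel>H\<parallel>\<^sub>p \<lesssim> \<parallel>f\<parallel>\<^sub>p\<close>, and everything is
  controlled by \<open>H\<close>, see \<open>layer_series\<close>:

  \<^item> the non-tangential maximal functions of \<open>u\<close> and \<open>\<delta>\<nabla>u\<close> are at most \<open>4 H\<close> pointwise;
  \<^item> the integral of \<open>\<delta>\<^sup>-\<^sup>n\<close> times the Whitney ball supremum of \<open>\<bar>\<nabla>u\<bar>\<close> over a cone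
    at \<open>\<eta>\<close> is at most a constant times \<open>H \<eta>\<close>, because the integral of \<open>\<delta>\<^sup>-\<^sup>n\<close> over the part of the cone with \<open>\<delta> \<le> \<epsilon>\<close> is at most a constant times \<open>\<epsilon>\<close>
    (\<open>area_kernel_le\<close>). By Fubini and the lower regularity of \<open>\<sigma>\<close> the Carleson functional is bounded by
    the Hardy-Littlewood maximal function of this area integral (\<open>carleson_average_le_maxfun\<close>), which is
    bounded on \<open>L\<^sup>p\<close> by Vitali's covering lemma (\<open>strong_type_maxfun\<close>);
  \<^item> at a point with \<open>H \<xi> < \<infinity>\<close> the tail of the series is uniformly small in the cone, and the partial
    sums are continuous up to \<open>E\<close> with trace \<open>G J\<close>, which converges to \<open>f\<close> almost everywhere. So \<open>u\<close>
    converges to \<open>f\<close> in cones of any prescribed aperture, and its Whitney averages do too.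

  A \<open>\<theta>\<close>-good curve ending at \<open>\<xi>\<close> runs in a cone of aperture about \<open>1 / \<theta>\<close> (\<open>good_curve_in_cone\<close>), so for
  \<open>s = n\<close> quasi-non-tangential convergence follows from convergence in cones, with the curves supplied by
  the pointwise John condition. One may take \<open>c0 = 1/4\<close>.
\<close>

section \<open>Calculus of smooth functions\<close>

lemma Ck_on_Suc_imp: "Ck_on (Suc k) S u \<Longrightarrow> Ck_on k S u"
proof (induction k arbitrary: u)
  case 0
  then show ?case
    by (auto intro!: continuous_at_imp_continuous_on differentiable_imp_continuous_within)
next
  case (Suc k)
  then show ?case by simp
qed

lemma Ck_on_subset: "Ck_on k S u \<Longrightarrow> T \<subseteq> S \<Longrightarrow> Ck_on k T u"
  by (induction k arbitrary: u) (auto intro: continuous_on_subset)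

lemma frechet_derivative_eq_on_open:
  assumes "open U" "x \<in> U" "\<And>y. y \<in> U \<Longrightarrow> u y = v y"
  shows "frechet_derivative u (at x) = frechet_derivative v (at x)"
proof -
  have "(u has_derivative D) (at x) \<longleftrightarrow> (v has_derivative D) (at x)" for D
    using assms has_derivative_transform_within_open[of u D x UNIV U v]
      has_derivative_transform_within_open[of v D x UNIV U u] by auto
  then show ?thesis by (simp add: frechet_derivative_def)
qed

text \<open>
  Differentiability is tested pointwise, so smoothness is a local property. This is what makes a locally
  finite series of smooth functions smooth.
\<close>

lemma Ck_on_locally:
  assumes "\<And>x. x \<in> S \<Longrightarrow> \<exists>U v. open U \<and> x \<in> U \<and> Ck_on k U v \<and> (\<forall>y\<in>U. u y = v y)"
  shows "Ck_on k S u"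
  using assms
proof (induction k arbitrary: u)
  case 0
  show ?case
  proof (rule continuous_at_imp_continuous_on[THEN iffD2[OF Ck_on.simps(1)]], rule ballI)
    fix x assume "x \<in> S"
    with 0 obtain U v where U: "open U" "x \<in> U" "continuous_on U v" "\<forall>y\<in>U. u y = v y"
      by (metis Ck_on.simps(1))
    then have "isCont v x" by (simp add: continuous_on_eq_continuous_at)
    moreover have "\<forall>\<^sub>F y in nhds x. u y = v y"
      using U by (intro eventually_nhds[THEN iffD2]) blast
    ultimately show "isCont u x" by (simp add: isCont_cong)
  qed
next
  case (Suc k)
  have "u differentiable at x" if "x \<in> S" for x
  proof -
    obtain U v where U: "open U" "x \<in> U" "Ck_on (Suc k) U v" "\<forall>y\<in>U. u y = v y"
      using Suc.prems \<open>x \<in> S\<close> by metis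
    then obtain D where "(v has_derivative D) (at x)" by (auto simp: differentiable_def)
    then have "(u has_derivative D) (at x)"
      by (rule has_derivative_transform_within_open[OF _ U(1,2)]) (use U in auto)
    then show ?thesis by (auto simp: differentiable_def)
  qed
  moreover have "Ck_on k S (\<lambda>x. frechet_derivative u (at x) b)" if b: "b \<in> Basis" for b
  proof (rule Suc.IH)
    fix x assume "x \<in> S"
    then obtain U v where U: "open U" "x \<in> U" "Ck_on (Suc k) U v" "\<forall>y\<in>U. u y = v y"
      using Suc.prems by metis
    then show "\<exists>U v. open U \<and> x \<in> U \<and> Ck_on k U v \<and> (\<forall>y\<in>U. frechet_derivative u (at y) b = v y)"
      using b by (intro exI[of _ U] exI[of _ "\<lambda>x. frechet_derivative v (at x) b"])
        (auto simp: frechet_derivative_eq_on_open[of U _ u v])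
  qed
  ultimately show ?case by simp
qed

lemma Ck_on_imp_continuous: "Ck_on k S u \<Longrightarrow> continuous_on S u"
proof (induction k)
  case (Suc k)
  then show ?case using Ck_on_Suc_imp by blast
qed simp

lemma Ck_on_cong_open:
  assumes "open S" "Ck_on k S v" "\<And>x. x \<in> S \<Longrightarrow> u x = v x"
  shows "Ck_on k S u"
  by (rule Ck_on_locally) (use assms in blast)

lemma Ck_on_SucI:
  assumes "open S" "\<And>x. x \<in> S \<Longrightarrow> (u has_derivative D x) (at x)"
    and "\<And>b. b \<in> Basis \<Longrightarrow> Ck_on k S (\<lambda>x. D x b)"
  shows "Ck_on (Suc k) S u"
proof -
  have "frechet_derivative u (at x) = D x" if "x \<in> S" for x
    using frechet_derivative_at[OF assms(2)[OF that]] by simp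
  then show ?thesis
    using assms by (auto simp: differentiable_def intro: Ck_on_cong_open[OF assms(1) assms(3)])
qed

lemma Ck_on_const: "Ck_on k S (\<lambda>x. c)"
proof (induction k arbitrary: c)
  case (Suc k)
  then show ?case by (auto simp: frechet_derivative_const[abs_def])
qed auto

lemma Ck_on_has_derivative:
  assumes "Ck_on (Suc k) S u" "x \<in> S"
  shows "(u has_derivative frechet_derivative u (at x)) (at x)"
  using assms frechet_derivative_works[of u "at x"] by auto

lemma Ck_on_add:
  assumes "open S"
  shows "Ck_on k S u \<Longrightarrow> Ck_on k S v \<Longrightarrow> Ck_on k S (\<lambda>x. u x + v x)"
proof (induction k arbitrary: u v)
  case (Suc k)
  show ?case
    by (rule Ck_on_SucI[OF \<open>open S\<close>, where D = "\<lambda>x b. frechet_derivative u (at x) b + frechet_derivative v (at x) b"])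
       (use Suc in \<open>auto intro!: has_derivative_add Ck_on_has_derivative[OF Suc.prems(1)]
           Ck_on_has_derivative[OF Suc.prems(2)]\<close>)
qed (auto intro: continuous_intros)

text \<open>
  The product rule expresses the partial derivatives of a product through products of functions which are
  one degree less smooth, which closes the induction.
\<close>

lemma Ck_on_mult:
  assumes "open S"
  shows "Ck_on k S u \<Longrightarrow> Ck_on k S v \<Longrightarrow> Ck_on k S (\<lambda>x. u x * v x)"
proof (induction k arbitrary: u v)
  case (Suc k)
  note D = Ck_on_has_derivative[OF Suc.prems(1)] Ck_on_has_derivative[OF Suc.prems(2)]
  show ?case
  proof (rule Ck_on_SucI[OF \<open>open S\<close>])
    show "((\<lambda>x. u x * v x) has_derivative
      (\<lambda>b. u x * frechet_derivative v (at x) b + frechet_derivative u (at x) b * v x)) (at x)"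
      if "x \<in> S" for x
      using has_derivative_mult[OF D(1)[OF that] D(2)[OF that]] .
    show "Ck_on k S (\<lambda>x. u x * frechet_derivative v (at x) b + frechet_derivative u (at x) b * v x)"
      if "b \<in> Basis" for b
      using Suc.prems that
      by (intro Ck_on_add[OF \<open>open S\<close>] Suc.IH Ck_on_Suc_imp[OF Suc.prems(1)]
          Ck_on_Suc_imp[OF Suc.prems(2)]) auto
  qed
qed (auto intro: continuous_intros)

lemma smooth_on_const: "smooth_on S (\<lambda>x. c)"
  by (simp add: smooth_on_def Ck_on_const)

lemma smooth_on_add: "open S \<Longrightarrow> smooth_on S u \<Longrightarrow> smooth_on S v \<Longrightarrow> smooth_on S (\<lambda>x. u x + v x)"
  by (simp add: smooth_on_def Ck_on_add)

lemma smooth_on_mult: "open S \<Longrightarrow> smooth_on S u \<Longrightarrow> smooth_on S v \<Longrightarrow> smooth_on S (\<lambda>x. u x * v x)"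
  by (simp add: smooth_on_def Ck_on_mult)

lemma smooth_on_sum:
  assumes "open S" "\<And>i. i \<in> I \<Longrightarrow> smooth_on S (u i)"
  shows "smooth_on S (\<lambda>x. \<Sum>i\<in>I. u i x)"
  using assms(2)
  by (induction I rule: infinite_finite_induct)
     (auto intro!: smooth_on_const smooth_on_add[OF assms(1)])

lemma smooth_on_imp_continuous: "smooth_on S u \<Longrightarrow> continuous_on S u"
  unfolding smooth_on_def by (metis Ck_on.simps(1))

lemma smooth_on_imp_differentiable: "smooth_on S u \<Longrightarrow> x \<in> S \<Longrightarrow> u differentiable at x"
  unfolding smooth_on_def by (metis Ck_on.simps(2))

lemma smooth_on_subset: "smooth_on S u \<Longrightarrow> T \<subseteq> S \<Longrightarrow> smooth_on T u"
  unfolding smooth_on_def by (blast intro: Ck_on_subset)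

lemma smooth_on_locally:
  assumes "\<And>x. x \<in> S \<Longrightarrow> \<exists>U v. open U \<and> x \<in> U \<and> smooth_on U v \<and> (\<forall>y\<in>U. u y = v y)"
  shows "smooth_on S u"
  unfolding smooth_on_def using assms by (intro allI Ck_on_locally) (metis smooth_on_def)

text \<open>
  The functions \<open>exp (-1/t) / t^m\<close>, extended by zero. Their derivatives are linear combinations of
  members of the same family, so that smoothness can be proved for all \<open>m\<close> simultaneously by induction.
\<close>

definition flat_exp :: "nat \<Rightarrow> real \<Rightarrow> real" where
  "flat_exp m t = (if t \<le> 0 then 0 else exp (- 1 / t) / t ^ m)"

text \<open>
  Substituting \<open>1/t\<close> for the variable, this is the decay of \<open>x ^ m / exp x\<close> at infinity.
\<close>

lemma flat_exp_tendsto_0: "(flat_exp m \<longlongrightarrow> 0) (at 0)"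
proof -
  have "((\<lambda>t. inverse t ^ m / exp (inverse t)) \<longlongrightarrow> (0::real)) (at_right 0)"
    by (rule filterlim_compose[OF tendsto_power_div_exp_0 filterlim_inverse_at_top_right])
  then have "(flat_exp m \<longlongrightarrow> 0) (at_right 0)"
  proof (rule Lim_transform_eventually)
    show "\<forall>\<^sub>F t in at_right 0. inverse t ^ m / exp (inverse t) = flat_exp m t"
      unfolding eventually_at_right_field
      by (auto intro!: exI[of _ 1] simp: flat_exp_def exp_minus field_simps)
  qed
  moreover have "(flat_exp m \<longlongrightarrow> 0) (at_left 0)"
    by (rule Lim_transform_eventually[OF tendsto_const])
       (auto simp: eventually_at_left_field flat_exp_def intro!: exI[of _ "-1"])
  ultimately show ?thesis by (simp add: filterlim_split_at_real)
qed

text \<open>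
  At the origin the difference quotient of \<open>flat_exp m\<close> is \<open>flat_exp (m + 1)\<close>, which tends to zero;
  elsewhere this is a direct computation.
\<close>

lemma flat_exp_deriv:
  "(flat_exp m has_field_derivative flat_exp (m + 2) t - real m * flat_exp (m + 1) t) (at t)"
proof -
  consider "t < 0" | "t = 0" | "t > 0" by linarith
  then show ?thesis
  proof cases
    case 1
    have "((\<lambda>_. 0) has_field_derivative 0) (at t)" by simp
    then have "(flat_exp m has_field_derivative 0) (at t)"
      by (rule has_field_derivative_transform_within_open[of _ _ _ "{..<0}"])
         (use 1 in \<open>auto simp: flat_exp_def\<close>)
    then show ?thesis using 1 by (simp add: flat_exp_def)
  next
    case 2
    have "((\<lambda>h. flat_exp (m + 1) h) \<longlongrightarrow> 0) (at 0)" by (rule flat_exp_tendsto_0)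
    then have "((\<lambda>h. (flat_exp m (0 + h) - flat_exp m 0) / h) \<longlongrightarrow> 0) (at 0)"
      by (rule Lim_transform_eventually)
         (auto simp: eventually_at_filter flat_exp_def)
    then show ?thesis using 2 by (simp add: DERIV_def flat_exp_def)
  next
    case 3
    have "((\<lambda>t. exp (- 1 / t) / t ^ m) has_field_derivative
        flat_exp (m + 2) t - real m * flat_exp (m + 1) t) (at t)"
    proof -
      have "((\<lambda>t. t ^ m) has_field_derivative real m * t ^ (m - 1)) (at t)"
        using DERIV_pow[of m t] by simp
      moreover have "((\<lambda>t. exp (- 1 / t)) has_field_derivative exp (- 1 / t) / t\<^sup>2) (at t)"
        using 3 by (auto intro!: derivative_eq_intros simp: power2_eq_square)
      ultimately have "((\<lambda>t. exp (- 1 / t) / t ^ m) has_field_derivative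
          (exp (- 1 / t) / t\<^sup>2 * t ^ m - exp (- 1 / t) * (real m * t ^ (m - 1))) / (t ^ m * t ^ m)) (at t)"
        using 3 by (intro DERIV_divide) auto
      moreover have "(exp (- 1 / t) / t\<^sup>2 * t ^ m - exp (- 1 / t) * (real m * t ^ (m - 1))) / (t ^ m * t ^ m)
          = flat_exp (m + 2) t - real m * flat_exp (m + 1) t" (is "?l = _")
      proof -
        have pm: "real m * t ^ (m - 1) = real m * t ^ m / t"
          using 3 by (cases m) auto
        have *: "(e / t\<^sup>2 * P - e * (real m * P / t)) / (P * P) = e / (P * t\<^sup>2) - real m * (e / (P * t))"
          if "P \<noteq> 0" for e P :: real
          using that 3 by (simp add: diff_divide_distrib mult_ac)
        have "?l = exp (- 1 / t) / (t ^ m * t\<^sup>2) - real m * (exp (- 1 / t) / (t ^ m * t))"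
          unfolding pm by (rule *) (use 3 in simp)
        then show ?thesis
          using 3 by (simp add: flat_exp_def power_add power2_eq_square mult_ac)
      qed
      ultimately show ?thesis by (simp only:)
    qed
    then show ?thesis
      by (rule has_field_derivative_transform_within_open[of _ _ _ "{0<..}"])
         (use 3 in \<open>auto simp: flat_exp_def\<close>)
  qed
qed

lemma Ck_on_inner: "Ck_on k S (\<lambda>x. x \<bullet> b)"
proof (rule Ck_on_subset[of k UNIV], cases k)
  case (Suc j)
  show "Ck_on k UNIV (\<lambda>x. x \<bullet> b)"
    unfolding Suc by (rule Ck_on_SucI[where D = "\<lambda>x h. h \<bullet> b"])
      (auto intro!: derivative_eq_intros Ck_on_const)
qed (auto intro: continuous_intros)

lemma flat_exp_isCont: "isCont (flat_exp m) x"
  using flat_exp_deriv DERIV_isCont by blast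

lemma Ck_on_flat_exp: "Ck_on k UNIV (\<lambda>x::'a::euclidean_space. flat_exp m (r - x \<bullet> x))"
proof (induction k arbitrary: m)
  case 0
  have "continuous_on UNIV (flat_exp m)"
    by (auto intro!: continuous_at_imp_continuous_on flat_exp_isCont)
  then show ?case
    by (auto intro!: continuous_on_compose2[of UNIV "flat_exp m"] continuous_intros)
next
  case (Suc k)
  let ?d = "\<lambda>x::'a. flat_exp (m + 2) (r - x \<bullet> x) + (- real m) * flat_exp (m + 1) (r - x \<bullet> x)"
  show ?case
  proof (rule Ck_on_SucI[where D = "\<lambda>x b. ?d x * (- 2 * (x \<bullet> b))"])
    fix x :: 'a
    have "((\<lambda>x. r - x \<bullet> x) has_derivative (\<lambda>b. - 2 * (x \<bullet> b))) (at x)"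
      by (auto intro!: derivative_eq_intros simp: inner_commute)
    from has_derivative_compose[OF this flat_exp_deriv[of m "r - x \<bullet> x", unfolded has_field_derivative_def]]
    show "((\<lambda>x. flat_exp m (r - x \<bullet> x)) has_derivative (\<lambda>b. ?d x * (- 2 * (x \<bullet> b)))) (at x)"
      by (simp add: algebra_simps)
  next
    fix b :: 'a
    show "Ck_on k UNIV (\<lambda>x. ?d x * (- 2 * (x \<bullet> b)))"
      by (intro Ck_on_mult Ck_on_add Ck_on_const Ck_on_inner Suc) auto
  qed simp
qed

section \<open>Mollification\<close>

text \<open>
  Differentiation under the integral sign puts the derivative on the kernel, so each partial derivative
  is again a convolution of the same kind.
\<close>

lemma Ck_on_convolution:
  fixes w v :: "'a::euclidean_space \<Rightarrow> real"
  assumes v: "continuous_on (cbox a b) v"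
  shows "Ck_on k UNIV w \<Longrightarrow> Ck_on k UNIV (\<lambda>x. integral (cbox a b) (\<lambda>y. w (x - y) * v y))"
proof (induction k arbitrary: w)
  case 0
  then have w: "continuous_on UNIV w" by simp
  have "continuous_on (UNIV \<times> cbox a b) (\<lambda>(x, y). w (x - y) * v y)"
    unfolding split_beta
    by (intro continuous_intros continuous_on_compose2[OF w] continuous_on_compose2[OF v]) auto
  then show ?case
    using integral_continuous_on_param[of UNIV a b "\<lambda>x y. w (x - y) * v y"] by simp
next
  case (Suc k)
  define D where "D z = frechet_derivative w (at z)" for z
  have wD: "(w has_derivative D z) (at z)" for z
    unfolding D_def using Suc.prems by (rule Ck_on_has_derivative) simp
  have DC: "Ck_on k UNIV (\<lambda>z. D z i)" if "i \<in> Basis" for i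
    using Suc.prems that by (simp add: D_def)
  have Dc: "continuous_on UNIV (\<lambda>z. D z i)" if "i \<in> Basis" for i
    by (rule Ck_on_imp_continuous[OF DC[OF that]])
  have w: "continuous_on UNIV w"
    by (intro continuous_at_imp_continuous_on ballI has_derivative_continuous[OF wD])
  define B where "B z = Blinfun (D z)" for z
  have B [simp]: "blinfun_apply (B z) = D z" for z
    unfolding B_def by (rule bounded_linear_Blinfun_apply) (rule has_derivative_bounded_linear[OF wD])
  have Bc: "continuous_on UNIV B"
    by (rule continuous_on_blinfun_componentwise) (simp add: Dc)
  define fx where "fx x y = v y *\<^sub>R B (x - y)" for x y
  have cfx: "continuous_on (UNIV \<times> cbox a b) (\<lambda>(x, y). fx x y)"
    unfolding split_beta fx_def
    by (intro continuous_intros continuous_on_compose2[OF Bc] continuous_on_compose2[OF v]) auto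
  have cfx1: "continuous_on (cbox a b) (fx x)" for x
    unfolding fx_def
    by (intro continuous_intros continuous_on_compose2[OF Bc] v) auto
  have D1: "((\<lambda>x. w (x - y) * v y) has_derivative blinfun_apply (fx x y)) (at x)" for x y
  proof -
    have "((\<lambda>x. w (x - y)) has_derivative D (x - y)) (at x)"
    proof -
      have "((\<lambda>x. x - y) has_derivative (\<lambda>h. h)) (at x)"
        by (auto intro!: derivative_eq_intros)
      from has_derivative_compose[OF this wD] show ?thesis .
    qed
    then show ?thesis
      by (auto intro!: derivative_eq_intros simp: fx_def blinfun.scaleR_left)
  qed
  have der: "((\<lambda>x. integral (cbox a b) (\<lambda>y. w (x - y) * v y)) has_derivative
      (\<lambda>h. integral (cbox a b) (\<lambda>y. fx x y h))) (at x)" for x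
  proof -
    have "((\<lambda>x. integral (cbox a b) (\<lambda>y. w (x - y) * v y)) has_derivative
       blinfun_apply (integral (cbox a b) (fx x))) (at x within UNIV)"
    proof (rule leibniz_rule[OF _ _ cfx])
      show "(\<lambda>y. w (x - y) * v y) integrable_on cbox a b" for x
        by (intro integrable_continuous continuous_intros v continuous_on_compose2[OF w]) auto
    qed (use D1 in auto)
    moreover have "blinfun_apply (integral (cbox a b) (fx x)) = (\<lambda>h. integral (cbox a b) (\<lambda>y. fx x y h))"
      by (intro ext blinfun_apply_integral integrable_continuous cfx1)
    ultimately show ?thesis by simp
  qed
  show ?case
  proof (rule Ck_on_SucI[OF open_UNIV der])
    fix i :: 'a assume i: "i \<in> Basis"
    show "Ck_on k UNIV (\<lambda>x. integral (cbox a b) (\<lambda>y. fx x y i))"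
      using Suc.IH[OF DC[OF i]] by (simp add: fx_def blinfun.scaleR_left mult.commute)
  qed
qed

definition bump :: "real \<Rightarrow> 'a::euclidean_space \<Rightarrow> real" where
  "bump t x = flat_exp 0 (t\<^sup>2 - x \<bullet> x)"

lemma bump_nonneg: "0 \<le> bump t x"
  by (simp add: bump_def flat_exp_def)

lemma bump_pos: "norm x < t \<Longrightarrow> 0 < bump t x"
  by (simp add: bump_def flat_exp_def dot_square_norm not_le power_strict_mono)

lemma bump_eq_0: "0 < t \<Longrightarrow> t \<le> norm x \<Longrightarrow> bump t x = 0"
  by (auto simp: bump_def flat_exp_def dot_square_norm power_mono)

lemma Ck_on_bump: "Ck_on k UNIV (bump t)"
  unfolding bump_def[abs_def] by (rule Ck_on_flat_exp)

lemma continuous_on_bump: "continuous_on S (bump t)"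
  using Ck_on_bump[of 0 t] by (auto intro: continuous_on_subset)

text \<open>
  Since the bump is even, this is the convolution with the normalised bump of radius \<open>t\<close>. Written as an
  average of translates of \<open>v\<close>, it visibly preserves bounds and Lipschitz constants.
\<close>

definition mollify :: "real \<Rightarrow> ('a::euclidean_space \<Rightarrow> real) \<Rightarrow> 'a \<Rightarrow> real" where
  "mollify t v x = (LINT z|lborel. bump t z * v (x + z)) / (LINT z|lborel. bump t (z::'a))"

lemma integrable_compact_support:
  fixes g :: "'a::euclidean_space \<Rightarrow> real"
  assumes "continuous_on UNIV g" "compact K" "\<And>x. x \<notin> K \<Longrightarrow> g x = 0"
  shows "integrable lborel g"
proof -
  have "integrable lborel (\<lambda>x. indicat_real K x *\<^sub>R g x)"
    by (rule borel_integrable_compact[OF assms(2) continuous_on_subset[OF assms(1)]]) simp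
  moreover have "(\<lambda>x. indicat_real K x *\<^sub>R g x) = g"
    using assms(3) by (auto simp: fun_eq_iff indicator_def)
  ultimately show ?thesis by simp
qed

lemma integrable_bump_mult:
  fixes v :: "'a::euclidean_space \<Rightarrow> real"
  assumes "0 < t" "continuous_on UNIV v"
  shows "integrable lborel (\<lambda>z. bump t z * v (x + z))"
proof (rule integrable_compact_support[of _ "cball 0 t"])
  show "continuous_on UNIV (\<lambda>z. bump t z * v (x + z))"
    by (intro continuous_intros continuous_on_bump continuous_on_compose2[OF assms(2)]) auto
qed (use assms(1) in \<open>auto simp: bump_eq_0\<close>)

lemma integrable_bump: "0 < t \<Longrightarrow> integrable lborel (bump t :: 'a::euclidean_space \<Rightarrow> real)"
  using integrable_bump_mult[of t "\<lambda>_. 1"] by simp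

lemma integral_bump_pos:
  assumes "0 < t"
  shows "0 < (LINT z|lborel. bump t (z::'a::euclidean_space))"
proof -
  have "(LINT z|lborel. bump t (z::'a)) \<noteq> 0"
  proof
    assume "(LINT z|lborel. bump t (z::'a)) = 0"
    then have "AE z in lborel. bump t (z::'a) = 0"
      using integral_nonneg_eq_0_iff_AE[OF integrable_bump[OF assms, where 'a='a]] by (simp add: bump_nonneg)
    then have "AE z in lborel. z \<notin> ball (0::'a) t"
    proof (rule eventually_mono)
      show "z \<notin> ball 0 t" if "bump t z = 0" for z :: 'a
        using that bump_pos[of z t] by auto
    qed
    then have "ball (0::'a) t \<in> null_sets lborel" by (simp add: AE_iff_null_sets)
    then show False
      using content_ball_pos[OF assms, of "0::'a"] by (simp add: measure_def null_sets_def)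
  qed
  moreover have "0 \<le> (LINT z|lborel. bump t (z::'a))" by (simp add: bump_nonneg)
  ultimately show ?thesis by linarith
qed

text \<open>
  Comparing the averages at two different points also gives Lipschitz estimates: the values of \<open>v\<close> at
  corresponding points of the two balls are compared.
\<close>

lemma mollify_mono_on:
  fixes v :: "'a::euclidean_space \<Rightarrow> real"
  assumes t: "0 < t" and v: "continuous_on UNIV v" "continuous_on UNIV v'"
    and le: "\<And>z. norm z < t \<Longrightarrow> v (x + z) \<le> v' (x' + z)"
  shows "mollify t v x \<le> mollify t v' x'"
  unfolding mollify_def
proof (rule divide_right_mono)
  show "(LINT z|lborel. bump t z * v (x + z)) \<le> (LINT z|lborel. bump t z * v' (x' + z))"
  proof (rule integral_mono[OF integrable_bump_mult[OF t v(1)] integrable_bump_mult[OF t v(2)]])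
    show "bump t z * v (x + z) \<le> bump t z * v' (x' + z)" for z
      using le[of z] bump_eq_0[OF t, of z] by (cases "norm z < t") (auto intro: mult_left_mono bump_nonneg)
  qed
qed (use integral_bump_pos[OF t, where 'a='a] in simp)

lemma mollify_add_const:
  fixes v :: "'a::euclidean_space \<Rightarrow> real"
  assumes t: "0 < t" and v: "continuous_on UNIV v"
  shows "mollify t (\<lambda>x. v x + c) x = mollify t v x + c"
proof -
  have "(LINT z|lborel. bump t z * (v (x + z) + c))
      = (LINT z|lborel. bump t z * v (x + z)) + (LINT z|lborel. bump t (z::'a)) * c"
    using integrable_bump_mult[OF t v, of x] integrable_bump[OF t, where 'a='a]
    by (simp add: distrib_left)
  then show ?thesis
    using integral_bump_pos[OF t, where 'a='a] by (simp add: mollify_def add_divide_distrib)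
qed

lemma mollify_const: "0 < t \<Longrightarrow> mollify t (\<lambda>_. c) x = c"
  using mollify_add_const[of t "\<lambda>_. 0" c x] by (simp add: mollify_def)

lemma mollify_bounds:
  fixes v :: "'a::euclidean_space \<Rightarrow> real"
  assumes t: "0 < t" and v: "continuous_on UNIV v"
  shows "(\<And>y. dist x y < t \<Longrightarrow> v y \<le> B) \<Longrightarrow> mollify t v x \<le> B"
    and "(\<And>y. dist x y < t \<Longrightarrow> A \<le> v y) \<Longrightarrow> A \<le> mollify t v x"
  using mollify_mono_on[OF t v continuous_on_const, of x B x]
    mollify_mono_on[OF t continuous_on_const v, of A x x]
  by (auto simp: mollify_const[OF t] dist_norm)

lemma mollify_eq_const:
  fixes v :: "'a::euclidean_space \<Rightarrow> real"
  assumes "0 < t" "continuous_on UNIV v" "\<And>y. dist x y < t \<Longrightarrow> v y = a"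
  shows "mollify t v x = a"
  using assms by (intro antisym mollify_bounds) auto

lemma mollify_lipschitz:
  fixes v :: "'a::euclidean_space \<Rightarrow> real"
  assumes t: "0 < t" and v: "\<And>x y. \<bar>v x - v y\<bar> \<le> L * dist x y"
  shows "\<bar>mollify t v x - mollify t v y\<bar> \<le> L * dist x y"
proof -
  have "L-lipschitz_on UNIV v" if "0 \<le> L" using v that by (auto simp: lipschitz_on_def dist_real_def)
  moreover have "0 \<le> L" using v[of "SOME b. b \<in> Basis" 0] abs_ge_zero[of "v (SOME b. b \<in> Basis) - v 0"]
    by (smt (verit) norm_Basis norm_some_Basis dist_0_norm dist_commute mult_cancel_left1)
  ultimately have c: "continuous_on UNIV v" using lipschitz_on_continuous_on by blast
  have "mollify t v x \<le> mollify t v y + L * dist x y" for x y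
  proof -
    have "mollify t v x \<le> mollify t (\<lambda>z. v z + L * dist x y) y"
    proof (rule mollify_mono_on[OF t c])
      show "v (x + z) \<le> v (y + z) + L * dist x y" for z
        using v[of "x + z" "y + z"] by (simp add: dist_norm)
    qed (intro continuous_intros c)
    then show ?thesis by (simp add: mollify_add_const[OF t c])
  qed
  from this[of x y] this[of y x] show ?thesis by (simp add: dist_commute)
qed

text \<open>
  Near a given point only the values of \<open>v\<close> on a fixed box matter, and a translation of the variable
  turns the average into a convolution over this box.
\<close>

lemma smooth_on_mollify:
  fixes v :: "'a::euclidean_space \<Rightarrow> real"
  assumes t: "0 < t" and v: "continuous_on UNIV v"
  shows "smooth_on UNIV (mollify t v)"
proof (rule smooth_on_locally)
  fix x0 :: 'a
  define I where "I = (LINT z|lborel. bump t (z::'a))"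
  obtain a b where ab: "ball x0 (1 + t) \<subseteq> cbox a b"
    using bounded_subset_cbox_symmetric[OF bounded_ball] by metis
  let ?w = "\<lambda>x. integral (cbox a b) (\<lambda>y. bump t (x - y) * v y)"
  have "mollify t v x = (1 / I) * ?w x" if x: "x \<in> ball x0 1" for x
  proof -
    have "(LINT z|lborel. bump t z * v (x + z)) = (LINT y|lborel. bump t (x - y) * v y)"
    proof -
      have "(LINT y|distr lborel borel ((+) x). bump t (x - y) * v y) = (LINT z|lborel. bump t (- z) * v (x + z))"
        by (subst integral_distr) (auto intro!: borel_measurable_continuous_onI continuous_intros
            continuous_on_compose2[OF v] continuous_on_compose2[OF continuous_on_bump[of UNIV]])
      then show ?thesis by (simp add: lborel_distr_plus bump_def)
    qed
    also have "\<dots> = (LINT y:cbox a b|lborel. bump t (x - y) * v y)"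
      unfolding set_lebesgue_integral_def
    proof (rule Bochner_Integration.integral_cong[OF refl])
      fix y
      show "bump t (x - y) * v y = indicat_real (cbox a b) y *\<^sub>R (bump t (x - y) * v y)"
      proof (cases "y \<in> cbox a b")
        case False
        then have "1 + t \<le> dist x0 y" using ab by (auto simp: subset_iff not_less[symmetric])
        then have "t \<le> norm (x - y)"
          using x dist_triangle[of x0 y x] by (simp add: dist_norm)
        then show ?thesis by (simp add: bump_eq_0[OF t])
      qed simp
    qed
    also have "\<dots> = ?w x"
    proof (rule set_borel_integral_eq_integral)
      show "set_integrable lborel (cbox a b) (\<lambda>y. bump t (x - y) * v y)"
        unfolding set_integrable_def
        by (intro borel_integrable_compact continuous_intros continuous_on_subset[OF v]
            continuous_on_compose2[OF continuous_on_bump[of UNIV]]) auto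
    qed
    finally show ?thesis by (simp add: mollify_def I_def)
  qed
  moreover have "smooth_on (ball x0 1) (\<lambda>x. (1 / I) * ?w x)"
  proof (rule smooth_on_mult[OF open_ball smooth_on_const])
    have "smooth_on UNIV ?w"
      unfolding smooth_on_def
      by (intro allI Ck_on_convolution continuous_on_subset[OF v] Ck_on_bump) auto
    then show "smooth_on (ball x0 1) ?w" by (rule smooth_on_subset) simp
  qed
  ultimately show "\<exists>U w. open U \<and> x0 \<in> U \<and> smooth_on U w \<and> (\<forall>y\<in>U. mollify t v y = w y)"
    by (intro exI[of _ "ball x0 1"] exI[of _ "\<lambda>x. (1 / I) * ?w x"]) auto
qed

section \<open>The Hardy-Littlewood maximal function of an upper regular measure\<close>

lemma ennreal_powr_ennreal: "0 \<le> a \<Longrightarrow> ennreal_powr (ennreal a) p = ennreal (a powr p)"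
  by (simp add: ennreal_powr_def)

lemma ennreal_powr_top [simp]: "ennreal_powr top p = top"
  by (simp add: ennreal_powr_def infinity_ennreal_def)

lemma ennreal_powr_0 [simp]: "ennreal_powr 0 p = 0"
  by (simp add: ennreal_powr_def)

lemma ennreal_powr_mono: "0 \<le> p \<Longrightarrow> x \<le> y \<Longrightarrow> ennreal_powr x p \<le> ennreal_powr y p"
  by (cases x; cases y) (auto simp: ennreal_powr_ennreal powr_mono2 ennreal_leI top_unique)

lemma ennreal_powr_cmult:
  "0 < a \<Longrightarrow> ennreal_powr (ennreal a * x) p = ennreal (a powr p) * ennreal_powr x p"
  by (cases x) (auto simp: ennreal_powr_ennreal ennreal_mult[symmetric] powr_mult ennreal_mult_top)

lemma ennreal_powr_powr: "p * q = 1 \<Longrightarrow> ennreal_powr (ennreal_powr x p) q = x"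
  by (cases x) (auto simp: ennreal_powr_ennreal powr_powr)

lemma borel_measurable_ennreal_powr [measurable (raw)]:
  assumes [measurable]: "g \<in> borel_measurable M"
  shows "(\<lambda>x. ennreal_powr (g x) p) \<in> borel_measurable M"
  unfolding ennreal_powr_def by measurable

text \<open>
  The layer cake formula for a single number. It turns estimates of level sets into estimates of
  \<open>L\<^sup>p\<close> norms by Fubini.
\<close>

lemma nn_integral_layer:
  fixes x :: ennreal
  assumes "0 < q"
  shows "(\<integral>\<^sup>+t. ennreal (q * t powr (q - 1)) * indicator {t. 0 < t \<and> ennreal t < x} t \<partial>lborel) = ennreal_powr x q"
    (is "?I x = _")
proof -
  have fin: "?I (ennreal b) = ennreal (b powr q)" if "0 \<le> b" for b
  proof -
    have "((\<lambda>t. q * t powr (q - 1)) has_integral q * (b powr (q - 1 + 1) / (q - 1 + 1))) {0..b}"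
      by (intro has_integral_mult_right has_integral_powr_from_0) (use assms that in auto)
    then have h: "((\<lambda>t. q * t powr (q - 1)) has_integral b powr q) {0..b}"
      using assms by simp
    have "(\<integral>\<^sup>+t. ennreal (q * t powr (q - 1)) * indicator {0..b} t \<partial>lborel) = ennreal (b powr q)"
      by (rule nn_integral_has_integral_lebesgue'[OF _ h]) (use assms in auto)
    moreover have "?I (ennreal b) = (\<integral>\<^sup>+t. ennreal (q * t powr (q - 1)) * indicator {0..b} t \<partial>lborel)"
    proof (rule nn_integral_cong_AE)
      have "AE t in lborel. t \<noteq> 0 \<and> t \<noteq> b"
        using AE_lborel_singleton[of 0] AE_lborel_singleton[of b] by eventually_elim auto
      then show "AE t in lborel. ennreal (q * t powr (q - 1)) * indicator {t. 0 < t \<and> ennreal t < ennreal b} t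
          = ennreal (q * t powr (q - 1)) * indicator {0..b} t"
        by eventually_elim (auto simp: indicator_def ennreal_less_iff)
    qed
    ultimately show ?thesis by simp
  qed
  show ?thesis
  proof (cases x)
    case (real b)
    then show ?thesis using fin by (simp add: ennreal_powr_ennreal)
  next
    case top
    have "ennreal b \<le> ?I top" if "0 \<le> b" for b
    proof -
      have "ennreal b = ?I (ennreal (b powr (1 / q)))"
        using fin[of "b powr (1 / q)"] that assms by (simp add: powr_powr)
      also have "\<dots> \<le> ?I top"
        by (intro nn_integral_mono mult_left_mono) (auto simp: indicator_def)
      finally show ?thesis .
    qed
    then have bound: "ennreal b \<le> ?I top" if "0 \<le> b" for b using that by blast
    have "?I top = top"
    proof (cases "?I top")
      case (real c)
      then show ?thesis using bound[of "c + 1"] by (simp add: ennreal_le_iff)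
    qed
    then show ?thesis using top by simp
  qed
qed

text \<open>
  The centred maximal function, normalised by \<open>r powr s\<close> instead of the measure of the ball, as in
  the Carleson functional. With this normalisation it is lower semicontinuous.
\<close>

definition maxfun :: "'a::metric_space measure \<Rightarrow> real \<Rightarrow> ('a \<Rightarrow> ennreal) \<Rightarrow> 'a \<Rightarrow> ennreal" where
  "maxfun \<sigma> s h x = (SUP r\<in>{0<..}. ennreal (1 / r powr s) * (\<integral>\<^sup>+y\<in>ball x r. h y \<partial>\<sigma>))"

lemma sets_borel_ball [measurable]: "ball x r \<in> sets borel"
  by simp

locale upper_regular_measure =
  fixes \<sigma> :: "'a::euclidean_space measure" and s C1 :: real
  assumes s_pos: "0 < s" and C1_pos: "0 < C1"
    and measurable_id [measurable]: "(\<lambda>x. x) \<in> borel_measurable \<sigma>"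
    and emeasure_ball_le: "x \<in> space \<sigma> \<Longrightarrow> 0 < r \<Longrightarrow>
      emeasure \<sigma> (ball x r \<inter> space \<sigma>) \<le> ennreal (C1 * r powr s)"
begin

lemma borel_measurable_of_borel:
  "f \<in> measurable borel N \<Longrightarrow> f \<in> measurable \<sigma> N"
  using measurable_compose[OF measurable_id] by simp

lemma sets_of_borel: "A \<in> sets borel \<Longrightarrow> A \<inter> space \<sigma> \<in> sets \<sigma>"
  using measurable_sets[OF measurable_id, of A] by (simp add: Int_commute vimage_def)

lemma emeasure_bounded:
  assumes "bounded A" "A \<in> sets borel"
  shows "emeasure \<sigma> (A \<inter> space \<sigma>) < \<infinity>"
proof (cases "A \<inter> space \<sigma> = {}")
  case False
  then obtain x where x: "x \<in> A" "x \<in> space \<sigma>" by blast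
  obtain R where R: "0 < R" "A \<subseteq> ball x R" using bounded_subset_ballD[OF assms(1)] by blast
  have "emeasure \<sigma> (A \<inter> space \<sigma>) \<le> emeasure \<sigma> (ball x R \<inter> space \<sigma>)"
    using R by (intro emeasure_mono sets_of_borel) auto
  also have "\<dots> \<le> ennreal (C1 * R powr s)" by (rule emeasure_ball_le[OF x(2) R(1)])
  finally show ?thesis using le_less_trans by fastforce
qed simp

sublocale sigma_finite_measure \<sigma>
proof
  let ?A = "(\<lambda>n. ball 0 (real n) \<inter> space \<sigma>) ` UNIV"
  have "emeasure \<sigma> (ball 0 (real n) \<inter> space \<sigma>) \<noteq> \<infinity>" for n
    using emeasure_bounded[of "ball 0 (real n)"] by simp
  moreover have "?A \<subseteq> sets \<sigma>"
    by (intro image_subsetI sets_of_borel) simp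
  moreover have "\<Union> ?A = space \<sigma>"
  proof (intro equalityI subsetI)
    fix x assume "x \<in> space \<sigma>"
    moreover obtain n where "norm x < real n" using reals_Archimedean2 by blast
    ultimately have "x \<in> ball 0 (real n) \<inter> space \<sigma>" by simp
    then show "x \<in> \<Union> ?A" by blast
  qed blast
  ultimately show "\<exists>A. countable A \<and> A \<subseteq> sets \<sigma> \<and> \<Union> A = space \<sigma> \<and> (\<forall>a\<in>A. emeasure \<sigma> a \<noteq> \<infinity>)"
    by (intro exI[of _ ?A] conjI ballI countable_image) blast+
qed

lemma ball_average_le_maxfun:
  "0 < r \<Longrightarrow> (\<integral>\<^sup>+y\<in>ball x r. h y \<partial>\<sigma>) \<le> ennreal (r powr s) * maxfun \<sigma> s h x"
proof -
  assume r: "0 < r"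
  have "(\<integral>\<^sup>+y\<in>ball x r. h y \<partial>\<sigma>) = ennreal (r powr s) * (ennreal (1 / r powr s) * (\<integral>\<^sup>+y\<in>ball x r. h y \<partial>\<sigma>))"
    using r by (simp add: mult.assoc[symmetric] ennreal_mult[symmetric])
  also have "\<dots> \<le> ennreal (r powr s) * maxfun \<sigma> s h x"
    unfolding maxfun_def using r by (intro mult_left_mono SUP_upper) auto
  finally show ?thesis .
qed

text \<open>
  If the average over the open ball of radius \<open>r\<close> exceeds \<open>t\<close>, then so does, by monotone convergence,
  the integral over a slightly smaller concentric ball divided by \<open>r powr s\<close>; and the smaller ball
  is contained in all balls of radius \<open>r\<close> with nearby centres.
\<close>

lemma open_maxfun_greater:
  assumes [measurable]: "h \<in> borel_measurable \<sigma>"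
  shows "open {x. t < maxfun \<sigma> s h x}"
  unfolding open_dist
proof (intro ballI)
  fix x assume "x \<in> {x. t < maxfun \<sigma> s h x}"
  then obtain r where r: "0 < r" "t < ennreal (1 / r powr s) * (\<integral>\<^sup>+y\<in>ball x r. h y \<partial>\<sigma>)"
    by (auto simp: maxfun_def less_SUP_iff)
  define \<rho> where "\<rho> n = r - r / (real n + 2)" for n
  have \<rho>: "\<rho> n < r" for n using r by (simp add: \<rho>_def)
  have inc: "incseq \<rho>"
    unfolding \<rho>_def using r by (auto intro!: incseq_SucI divide_left_mono)
  have ind: "h y * indicator (ball x r) y = (SUP n. h y * indicator (ball x (\<rho> n)) y)" for y
  proof (rule antisym)
    show "h y * indicator (ball x r) y \<le> (SUP n. h y * indicator (ball x (\<rho> n)) y)"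
    proof (cases "y \<in> ball x r")
      case True
      then have "0 < (r - dist x y) / r" using r by simp
      then obtain n where "inverse (real (Suc n)) < (r - dist x y) / r"
        using reals_Archimedean by blast
      moreover have "1 / (real n + 2) \<le> inverse (real (Suc n))" by (simp add: field_simps)
      ultimately have "1 / (real n + 2) < (r - dist x y) / r" by simp
      then have "r / (real n + 2) < r - dist x y"
        using r by (simp add: field_simps)
      then have "y \<in> ball x (\<rho> n)" by (simp add: \<rho>_def)
      then show ?thesis using True by (intro SUP_upper2[of n]) auto
    qed simp
    show "(SUP n. h y * indicator (ball x (\<rho> n)) y) \<le> h y * indicator (ball x r) y"
    proof (intro SUP_least mult_left_mono)
      show "(indicator (ball x (\<rho> n)) y :: ennreal) \<le> indicator (ball x r) y" for n
        using \<rho>[of n] by (auto simp: indicator_def)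
    qed simp
  qed
  have "(\<integral>\<^sup>+y\<in>ball x r. h y \<partial>\<sigma>) = (SUP n. \<integral>\<^sup>+y\<in>ball x (\<rho> n). h y \<partial>\<sigma>)"
    unfolding ind using inc
    by (intro nn_integral_monotone_convergence_SUP)
       (auto simp: incseq_def le_fun_def indicator_def dest: order.strict_trans2)
  then have "t < (SUP n. ennreal (1 / r powr s) * (\<integral>\<^sup>+y\<in>ball x (\<rho> n). h y \<partial>\<sigma>))"
    using r by (simp add: SUP_mult_left_ennreal)
  then obtain n where n: "t < ennreal (1 / r powr s) * (\<integral>\<^sup>+y\<in>ball x (\<rho> n). h y \<partial>\<sigma>)"
    by (auto simp: less_SUP_iff)
  have "t < maxfun \<sigma> s h z" if "dist z x < r - \<rho> n" for z
  proof -
    have "dist z y < r" if "dist x y < \<rho> n" for y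
      using dist_triangle[of z y x] that \<open>dist z x < r - \<rho> n\<close> by simp
    then have "(\<integral>\<^sup>+y\<in>ball x (\<rho> n). h y \<partial>\<sigma>) \<le> (\<integral>\<^sup>+y\<in>ball z r. h y \<partial>\<sigma>)"
      by (intro nn_integral_mono mult_left_mono) (auto simp: indicator_def)
    then have "ennreal (1 / r powr s) * (\<integral>\<^sup>+y\<in>ball x (\<rho> n). h y \<partial>\<sigma>)
        \<le> ennreal (1 / r powr s) * (\<integral>\<^sup>+y\<in>ball z r. h y \<partial>\<sigma>)"
      by (intro mult_left_mono) auto
    also have "\<dots> \<le> maxfun \<sigma> s h z"
      unfolding maxfun_def using r by (intro SUP_upper) auto
    finally show ?thesis using n by (rule less_le_trans[rotated])
  qed
  then show "\<exists>e>0. \<forall>y. dist y x < e \<longrightarrow> y \<in> {x. t < maxfun \<sigma> s h x}"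
    using \<rho>[of n] by (intro exI[of _ "r - \<rho> n"]) auto
qed

lemma borel_measurable_maxfun [measurable]:
  assumes "h \<in> borel_measurable \<sigma>"
  shows "maxfun \<sigma> s h \<in> borel_measurable \<sigma>"
proof (rule borel_measurable_of_borel, rule borel_measurableI_greater)
  show "{x \<in> space borel. y < maxfun \<sigma> s h x} \<in> sets borel" for y
    using open_maxfun_greater[OF assms] by simp
qed

text \<open>
  Each point of the level set is the centre of a ball whose radius \<open>r\<close> is controlled by the integral of
  \<open>h\<close> over it, through \<open>t * r powr s\<close>. By Vitali's lemma countably many of these balls are disjoint while
  their fivefold enlargements still cover the level set, and upper regularity bounds the measure of those.
\<close>

lemma weak_type_maxfun:
  assumes h [measurable]: "h \<in> borel_measurable \<sigma>" and t: "0 < t"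
  shows "ennreal t * emeasure \<sigma> {x \<in> space \<sigma>. ennreal t < maxfun \<sigma> s h x}
    \<le> ennreal (C1 * 5 powr s) * (\<integral>\<^sup>+y. h y \<partial>\<sigma>)"
proof (cases "(\<integral>\<^sup>+y. h y \<partial>\<sigma>) = \<infinity>")
  case True
  then show ?thesis using C1_pos by (simp add: ennreal_mult_top)
next
  case False
  define I where "I = enn2real (\<integral>\<^sup>+y. h y \<partial>\<sigma>)"
  have I: "(\<integral>\<^sup>+y. h y \<partial>\<sigma>) = ennreal I" using False by (simp add: I_def less_top)
  define S where "S = {x \<in> space \<sigma>. ennreal t < maxfun \<sigma> s h x}"
  have "\<exists>r>0. ennreal (t * r powr s) \<le> (\<integral>\<^sup>+y\<in>ball x r. h y \<partial>\<sigma>)" if "x \<in> S" for x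
  proof -
    obtain r where r: "0 < r" "ennreal t < ennreal (1 / r powr s) * (\<integral>\<^sup>+y\<in>ball x r. h y \<partial>\<sigma>)"
      using \<open>x \<in> S\<close> by (auto simp: S_def maxfun_def less_SUP_iff)
    have "ennreal (t * r powr s) = ennreal (r powr s) * ennreal t"
      using t by (simp add: ennreal_mult[symmetric] mult.commute)
    also have "\<dots> \<le> ennreal (r powr s) * (ennreal (1 / r powr s) * (\<integral>\<^sup>+y\<in>ball x r. h y \<partial>\<sigma>))"
      using r by (intro mult_left_mono less_imp_le) auto
    also have "\<dots> = (\<integral>\<^sup>+y\<in>ball x r. h y \<partial>\<sigma>)"
      using r(1) by (simp add: mult.assoc[symmetric] ennreal_mult[symmetric])
    finally show ?thesis using r(1) by blast
  qed
  then obtain r where r: "\<And>x. x \<in> S \<Longrightarrow> 0 < r x"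
    and le: "\<And>x. x \<in> S \<Longrightarrow> ennreal (t * r x powr s) \<le> (\<integral>\<^sup>+y\<in>ball x (r x). h y \<partial>\<sigma>)"
    by metis
  \<comment> \<open>Vitali's lemma needs bounded radii; the finite integral of \<open>h\<close> bounds them.\<close>
  have bdd: "r x \<le> (I / t) powr (1 / s)" if "x \<in> S" for x
  proof -
    have "ennreal (t * r x powr s) \<le> ennreal I"
      unfolding I[symmetric] by (rule order_trans[OF le[OF that]])
        (auto intro!: nn_integral_mono simp: indicator_def)
    then have "r x powr s \<le> I / t" using t by (simp add: I_def field_simps)
    then have "(r x powr s) powr (1 / s) \<le> (I / t) powr (1 / s)"
      using s_pos by (intro powr_mono2) auto
    then show ?thesis using s_pos r[OF that] by (simp add: powr_powr)
  qed
  obtain C where C: "countable C" "C \<subseteq> S" "pairwise (\<lambda>i j. disjnt (ball i (r i)) (ball j (r j))) C"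
    and cov: "S \<subseteq> (\<Union>i\<in>C. ball i (5 * r i))"
    by (rule Vitali_covering_lemma_balls[where S = S and K = S and a = "\<lambda>x. x" and r = r and B = "(I / t) powr (1 / s)"])
       (use r bdd in auto)
  have CS: "i \<in> space \<sigma>" if "i \<in> C" for i using that C(2) by (auto simp: S_def)
  have "emeasure \<sigma> S \<le> (\<integral>\<^sup>+x. (\<integral>\<^sup>+i. indicator (ball i (5 * r i)) x \<partial>count_space C) \<partial>\<sigma>)"
  proof -
    have "S \<in> sets \<sigma>" unfolding S_def by measurable
    then have "emeasure \<sigma> S = (\<integral>\<^sup>+x. indicator S x \<partial>\<sigma>)" by simp
    also have "\<dots> \<le> (\<integral>\<^sup>+x. (\<integral>\<^sup>+i. indicator (ball i (5 * r i)) x \<partial>count_space C) \<partial>\<sigma>)"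
    proof (rule nn_integral_mono)
      fix x
      show "(indicator S x :: ennreal) \<le> (\<integral>\<^sup>+i. indicator (ball i (5 * r i)) x \<partial>count_space C)"
      proof (cases "x \<in> S")
        case True
        then obtain i where i: "i \<in> C" "x \<in> ball i (5 * r i)" using cov by blast
        have "(1::ennreal) = (\<integral>\<^sup>+j. indicator {i} j \<partial>count_space C)"
          using i by (simp add: one_ennreal_def)
        also have "\<dots> \<le> (\<integral>\<^sup>+i. indicator (ball i (5 * r i)) x \<partial>count_space C)"
          using i by (intro nn_integral_mono) (auto simp: indicator_def)
        finally show ?thesis using True by simp
      qed simp
    qed
    finally show ?thesis .
  qed
  also have "\<dots> = (\<integral>\<^sup>+i. (\<integral>\<^sup>+x. indicator (ball i (5 * r i)) x \<partial>\<sigma>) \<partial>count_space C)"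
    by (rule nn_integral_count_space_nn_integral[OF C(1)]) measurable
  also have "\<dots> \<le> (\<integral>\<^sup>+i. ennreal (C1 * 5 powr s) * ennreal (r i powr s) \<partial>count_space C)"
  proof (rule nn_integral_mono)
    fix i assume "i \<in> space (count_space C)"
    then have i: "i \<in> C" by simp
    have "(\<integral>\<^sup>+x. indicator (ball i (5 * r i)) x \<partial>\<sigma>) = (\<integral>\<^sup>+x. indicator (ball i (5 * r i) \<inter> space \<sigma>) x \<partial>\<sigma>)"
      by (intro nn_integral_cong) (auto simp: indicator_def)
    also have "\<dots> \<le> ennreal (C1 * (5 * r i) powr s)"
      using emeasure_ball_le[OF CS[OF i], of "5 * r i"] r[of i] i C(2) sets_of_borel
      by (subst nn_integral_indicator) auto
    also have "\<dots> = ennreal (C1 * 5 powr s) * ennreal (r i powr s)"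
      using r[of i] i C(2) C1_pos by (auto simp: powr_mult ennreal_mult[symmetric] mult.assoc)
    finally show "(\<integral>\<^sup>+x. indicator (ball i (5 * r i)) x \<partial>\<sigma>) \<le> ennreal (C1 * 5 powr s) * ennreal (r i powr s)" .
  qed
  finally have "ennreal t * emeasure \<sigma> S \<le>
      ennreal t * (\<integral>\<^sup>+i. ennreal (C1 * 5 powr s) * ennreal (r i powr s) \<partial>count_space C)"
    by (rule mult_left_mono) simp
  also have "\<dots> = ennreal (C1 * 5 powr s) * (\<integral>\<^sup>+i. ennreal (t * r i powr s) \<partial>count_space C)"
    using t by (simp add: nn_integral_cmult[symmetric] ennreal_mult mult_ac)
  also have "\<dots> \<le> ennreal (C1 * 5 powr s) * (\<integral>\<^sup>+i. (\<integral>\<^sup>+y. h y * indicator (ball i (r i)) y \<partial>\<sigma>) \<partial>count_space C)"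
    using le C(2) by (intro mult_left_mono nn_integral_mono) auto
  also have "\<dots> = ennreal (C1 * 5 powr s) * (\<integral>\<^sup>+y. (\<integral>\<^sup>+i. h y * indicator (ball i (r i)) y \<partial>count_space C) \<partial>\<sigma>)"
    by (subst nn_integral_count_space_nn_integral[OF C(1)]) auto
  also have "\<dots> \<le> ennreal (C1 * 5 powr s) * (\<integral>\<^sup>+y. h y \<partial>\<sigma>)"
  proof (intro mult_left_mono nn_integral_mono)
    fix y
    show "(\<integral>\<^sup>+i. h y * indicator (ball i (r i)) y \<partial>count_space C) \<le> h y"
    proof (cases "\<exists>j\<in>C. y \<in> ball j (r j)")
      case True
      then obtain j where j: "j \<in> C" "y \<in> ball j (r j)" by blast
      have "(\<integral>\<^sup>+i. h y * indicator (ball i (r i)) y \<partial>count_space C) = (\<integral>\<^sup>+i. h y * indicator {j} i \<partial>count_space C)"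
      proof (rule nn_integral_cong)
        fix i assume "i \<in> space (count_space C)"
        then have "i \<in> C" by simp
        have "i = j" if "y \<in> ball i (r i)"
        proof (rule ccontr)
          assume "i \<noteq> j"
          then have "disjnt (ball i (r i)) (ball j (r j))"
            by (rule pairwiseD[OF C(3) \<open>i \<in> C\<close> j(1)])
          then show False using that j(2) unfolding disjnt_iff by blast
        qed
        then have "indicator (ball i (r i)) y = (indicator {j} i :: ennreal)"
          using j(2) by (cases "i = j") (fastforce simp: indicator_def)+
        then show "h y * indicator (ball i (r i)) y = h y * indicator {j} i" by simp
      qed
      also have "\<dots> = h y" using j(1) by (subst nn_integral_cmult_indicator) auto
      finally show ?thesis by simp
    next
      case False
      then have "(\<integral>\<^sup>+i. h y * indicator (ball i (r i)) y \<partial>count_space C) = (\<integral>\<^sup>+i. 0 \<partial>count_space C)"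
        by (intro nn_integral_cong) (auto simp: indicator_def)
      then show ?thesis by simp
    qed
  qed simp
  finally show ?thesis by (simp add: S_def)
qed

text \<open>
  The part of \<open>h\<close> below \<open>t / (2 * C1)\<close> contributes at most \<open>t / 2\<close> to the maximal function, so
  the weak type estimate need only be applied to the rest. This refinement is what can be integrated in \<open>t\<close>.
\<close>

lemma emeasure_maxfun_greater_le:
  assumes h [measurable]: "h \<in> borel_measurable \<sigma>" and t: "0 < t"
  shows "ennreal t * emeasure \<sigma> {x \<in> space \<sigma>. ennreal t < maxfun \<sigma> s h x}
    \<le> ennreal (2 * C1 * 5 powr s) * (\<integral>\<^sup>+y. h y * indicator {y. ennreal t < ennreal (2 * C1) * h y} y \<partial>\<sigma>)"
proof -
  define g where "g y = h y * indicator {y. ennreal t < ennreal (2 * C1) * h y} y" for y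
  have g [measurable]: "g \<in> borel_measurable \<sigma>"
    unfolding g_def by measurable
  have hg: "h y \<le> g y + ennreal (t / (2 * C1))" for y
  proof (cases "ennreal t < ennreal (2 * C1) * h y")
    case False
    then have "ennreal (1 / (2 * C1)) * (ennreal (2 * C1) * h y) \<le> ennreal (1 / (2 * C1)) * ennreal t"
      by (intro mult_left_mono) auto
    then have "h y \<le> ennreal (t / (2 * C1))"
      using C1_pos t by (simp add: mult.assoc[symmetric] ennreal_mult[symmetric])
    then show ?thesis by (simp add: add_increasing)
  qed (simp add: g_def)
  have M: "maxfun \<sigma> s h x \<le> maxfun \<sigma> s g x + ennreal (t / 2)" if x: "x \<in> space \<sigma>" for x
    unfolding maxfun_def[of \<sigma> s h]
  proof (rule SUP_least)
    fix r :: real assume "r \<in> {0<..}"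
    then have r: "0 < r" by simp
    have "(\<integral>\<^sup>+y\<in>ball x r. h y \<partial>\<sigma>) \<le> (\<integral>\<^sup>+y. g y * indicator (ball x r) y + ennreal (t / (2 * C1)) * indicator (ball x r \<inter> space \<sigma>) y \<partial>\<sigma>)"
      using hg by (intro nn_integral_mono) (auto simp: indicator_def)
    also have "\<dots> = (\<integral>\<^sup>+y\<in>ball x r. g y \<partial>\<sigma>) + ennreal (t / (2 * C1)) * emeasure \<sigma> (ball x r \<inter> space \<sigma>)"
      using sets_of_borel[of "ball x r"]
      by (subst nn_integral_add) (auto simp: nn_integral_cmult_indicator)
    also have "\<dots> \<le> (\<integral>\<^sup>+y\<in>ball x r. g y \<partial>\<sigma>) + ennreal (t / (2 * C1)) * ennreal (C1 * r powr s)"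
      using emeasure_ball_le[OF x r] by (intro add_left_mono mult_left_mono) auto
    finally have "ennreal (1 / r powr s) * (\<integral>\<^sup>+y\<in>ball x r. h y \<partial>\<sigma>) \<le>
        ennreal (1 / r powr s) * ((\<integral>\<^sup>+y\<in>ball x r. g y \<partial>\<sigma>) + ennreal (t / (2 * C1)) * ennreal (C1 * r powr s))"
      by (rule mult_left_mono) simp
    also have "\<dots> = ennreal (1 / r powr s) * (\<integral>\<^sup>+y\<in>ball x r. g y \<partial>\<sigma>) + ennreal (t / 2)"
    proof -
      have "ennreal (1 / r powr s) * (ennreal (t / (2 * C1)) * ennreal (C1 * r powr s)) = ennreal (t / 2)"
        using C1_pos t r by (simp add: ennreal_mult[symmetric])
      then show ?thesis by (simp add: distrib_left)
    qed
    also have "\<dots> \<le> maxfun \<sigma> s g x + ennreal (t / 2)"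
      unfolding maxfun_def using r by (intro add_right_mono SUP_upper) auto
    finally show "ennreal (1 / r powr s) * (\<integral>\<^sup>+y\<in>ball x r. h y \<partial>\<sigma>) \<le> maxfun \<sigma> s g x + ennreal (t / 2)" .
  qed
  have "{x \<in> space \<sigma>. ennreal t < maxfun \<sigma> s h x} \<subseteq> {x \<in> space \<sigma>. ennreal (t / 2) < maxfun \<sigma> s g x}"
  proof clarify
    fix x assume x: "x \<in> space \<sigma>" "ennreal t < maxfun \<sigma> s h x"
    show "ennreal (t / 2) < maxfun \<sigma> s g x"
    proof (rule ccontr)
      assume "\<not> ?thesis"
      then have "maxfun \<sigma> s g x + ennreal (t / 2) \<le> ennreal (t / 2) + ennreal (t / 2)"
        by (intro add_right_mono) simp
      also have "\<dots> = ennreal t" using t by (simp add: ennreal_plus[symmetric] del: ennreal_plus)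
      finally show False using M[OF x(1)] x(2) by (meson leD order_trans)
    qed
  qed
  then have "emeasure \<sigma> {x \<in> space \<sigma>. ennreal t < maxfun \<sigma> s h x}
      \<le> emeasure \<sigma> {x \<in> space \<sigma>. ennreal (t / 2) < maxfun \<sigma> s g x}"
    by (rule emeasure_mono) measurable
  then have "ennreal t * emeasure \<sigma> {x \<in> space \<sigma>. ennreal t < maxfun \<sigma> s h x}
      \<le> ennreal t * emeasure \<sigma> {x \<in> space \<sigma>. ennreal (t / 2) < maxfun \<sigma> s g x}"
    by (rule mult_left_mono) simp
  also have "\<dots> = ennreal 2 * (ennreal (t / 2) * emeasure \<sigma> {x \<in> space \<sigma>. ennreal (t / 2) < maxfun \<sigma> s g x})"
  proof -
    have "ennreal t = ennreal 2 * ennreal (t / 2)"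
      using t by (subst ennreal_mult[symmetric]) auto
    then show ?thesis by (simp add: mult.assoc)
  qed
  also have "\<dots> \<le> ennreal 2 * (ennreal (C1 * 5 powr s) * (\<integral>\<^sup>+y. g y \<partial>\<sigma>))"
    using t by (intro mult_left_mono weak_type_maxfun) auto
  also have "\<dots> = ennreal (2 * C1 * 5 powr s) * (\<integral>\<^sup>+y. g y \<partial>\<sigma>)"
  proof -
    have "ennreal (2 * C1 * 5 powr s) = ennreal 2 * ennreal (C1 * 5 powr s)"
      using C1_pos by (subst ennreal_mult[symmetric]) (auto simp: mult.assoc)
    then show ?thesis by (simp only: mult.assoc)
  qed
  finally show ?thesis by (simp add: g_def)
qed

text \<open>
  Marcinkiewicz interpolation: the refined weak type estimate is integrated against \<open>p t powr (p - 1)\<close>,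
  and exchanging the integrals produces \<open>h\<close> times the \<open>(p - 1)\<close>-st power of \<open>h\<close>. The factor
  \<open>1 / (p - 1)\<close> comes from the integral of \<open>t powr (p - 2)\<close> near zero.
\<close>

lemma strong_type_maxfun:
  assumes h [measurable]: "h \<in> borel_measurable \<sigma>" and p: "1 < p"
  shows "(\<integral>\<^sup>+x. ennreal_powr (maxfun \<sigma> s h x) p \<partial>\<sigma>)
    \<le> ennreal (2 * C1 * 5 powr s * p / (p - 1) * (2 * C1) powr (p - 1)) * (\<integral>\<^sup>+x. ennreal_powr (h x) p \<partial>\<sigma>)"
proof -
  interpret P: pair_sigma_finite "lborel :: real measure" \<sigma> ..
  define K where "K = 2 * C1 * 5 powr s"
  have K: "0 \<le> K" using C1_pos by (simp add: K_def)
  have "(\<integral>\<^sup>+x. ennreal_powr (maxfun \<sigma> s h x) p \<partial>\<sigma>)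
      = (\<integral>\<^sup>+x. \<integral>\<^sup>+t. ennreal (p * t powr (p - 1)) * indicator {t. 0 < t \<and> ennreal t < maxfun \<sigma> s h x} t \<partial>lborel \<partial>\<sigma>)"
    using p by (simp add: nn_integral_layer)
  also have "\<dots> = (\<integral>\<^sup>+t. \<integral>\<^sup>+x. ennreal (p * t powr (p - 1)) * indicator {t. 0 < t \<and> ennreal t < maxfun \<sigma> s h x} t \<partial>\<sigma> \<partial>lborel)"
    by (rule P.Fubini') measurable
  also have "\<dots> \<le> (\<integral>\<^sup>+t. \<integral>\<^sup>+x. ennreal (K * p * t powr (p - 2)) * h x *
      indicator {t. 0 < t \<and> ennreal t < ennreal (2 * C1) * h x} t \<partial>\<sigma> \<partial>lborel)"
  proof (rule nn_integral_mono)
    fix t :: real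
    show "(\<integral>\<^sup>+x. ennreal (p * t powr (p - 1)) * indicator {t. 0 < t \<and> ennreal t < maxfun \<sigma> s h x} t \<partial>\<sigma>)
      \<le> (\<integral>\<^sup>+x. ennreal (K * p * t powr (p - 2)) * h x * indicator {t. 0 < t \<and> ennreal t < ennreal (2 * C1) * h x} t \<partial>\<sigma>)"
    proof (cases "0 < t")
      case True
      have "(\<integral>\<^sup>+x. ennreal (p * t powr (p - 1)) * indicator {t. 0 < t \<and> ennreal t < maxfun \<sigma> s h x} t \<partial>\<sigma>)
          = (\<integral>\<^sup>+x. ennreal (p * t powr (p - 1)) * indicator {x \<in> space \<sigma>. ennreal t < maxfun \<sigma> s h x} x \<partial>\<sigma>)"
        using True by (intro nn_integral_cong) (auto simp: indicator_def)
      also have "\<dots> = ennreal (p * t powr (p - 1)) * emeasure \<sigma> {x \<in> space \<sigma>. ennreal t < maxfun \<sigma> s h x}"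
        by (rule nn_integral_cmult_indicator) measurable
      also have "\<dots> = ennreal (p * t powr (p - 2)) * ennreal t * emeasure \<sigma> {x \<in> space \<sigma>. ennreal t < maxfun \<sigma> s h x}"
      proof -
        have "t powr (p - 1) = t powr (p - 2) * t"
          using True powr_add[of t "p - 2" 1] by (simp add: powr_one)
        then have "ennreal (p * t powr (p - 1)) = ennreal (p * t powr (p - 2)) * ennreal t"
          using p True by (subst ennreal_mult[symmetric]) (auto simp: mult.assoc)
        then show ?thesis by simp
      qed
      also have "\<dots> \<le> ennreal (p * t powr (p - 2)) *
            (ennreal K * (\<integral>\<^sup>+y. h y * indicator {y. ennreal t < ennreal (2 * C1) * h y} y \<partial>\<sigma>))"
        unfolding mult.assoc K_def
        by (intro mult_left_mono emeasure_maxfun_greater_le[OF h True, unfolded mult.assoc]) auto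
      also have "\<dots> = ennreal (K * p * t powr (p - 2)) * (\<integral>\<^sup>+y. h y * indicator {y. ennreal t < ennreal (2 * C1) * h y} y \<partial>\<sigma>)"
      proof -
        have "ennreal (K * p * t powr (p - 2)) = ennreal (p * t powr (p - 2)) * ennreal K"
          using K p by (subst ennreal_mult[symmetric]) (auto simp: mult_ac)
        then show ?thesis by (simp only: mult.assoc)
      qed
      also have "\<dots> = (\<integral>\<^sup>+y. ennreal (K * p * t powr (p - 2)) * (h y * indicator {y. ennreal t < ennreal (2 * C1) * h y} y) \<partial>\<sigma>)"
        by (rule nn_integral_cmult[symmetric]) measurable
      also have "\<dots> = (\<integral>\<^sup>+x. ennreal (K * p * t powr (p - 2)) * h x * indicator {t. 0 < t \<and> ennreal t < ennreal (2 * C1) * h x} t \<partial>\<sigma>)"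
        using True by (intro nn_integral_cong) (auto simp: indicator_def)
      finally show ?thesis .
    qed (simp add: indicator_def)
  qed
  also have "\<dots> = (\<integral>\<^sup>+x. \<integral>\<^sup>+t. ennreal (K * p * t powr (p - 2)) * h x *
      indicator {t. 0 < t \<and> ennreal t < ennreal (2 * C1) * h x} t \<partial>lborel \<partial>\<sigma>)"
    by (rule P.Fubini'[symmetric]) measurable
  also have "\<dots> = (\<integral>\<^sup>+x. ennreal (K * p / (p - 1) * (2 * C1) powr (p - 1)) * ennreal_powr (h x) p \<partial>\<sigma>)"
  proof (rule nn_integral_cong)
    fix x
    have "(\<integral>\<^sup>+t. ennreal (K * p * t powr (p - 2)) * h x *
        indicator {t. 0 < t \<and> ennreal t < ennreal (2 * C1) * h x} t \<partial>lborel)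
      = (\<integral>\<^sup>+t. (ennreal (K * p / (p - 1)) * h x) * (ennreal ((p - 1) * t powr ((p - 1) - 1)) *
        indicator {t. 0 < t \<and> ennreal t < ennreal (2 * C1) * h x} t) \<partial>lborel)"
    proof (rule nn_integral_cong)
      fix t :: real
      have "ennreal (K * p * t powr (p - 2)) = ennreal (K * p / (p - 1)) * ennreal ((p - 1) * t powr ((p - 1) - 1))"
        using K p by (subst ennreal_mult[symmetric]) auto
      then show "ennreal (K * p * t powr (p - 2)) * h x * indicator {t. 0 < t \<and> ennreal t < ennreal (2 * C1) * h x} t
        = (ennreal (K * p / (p - 1)) * h x) * (ennreal ((p - 1) * t powr ((p - 1) - 1)) *
        indicator {t. 0 < t \<and> ennreal t < ennreal (2 * C1) * h x} t)"
        by (simp only: mult_ac)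
    qed
    also have "\<dots> = (ennreal (K * p / (p - 1)) * h x) * ennreal_powr (ennreal (2 * C1) * h x) (p - 1)"
    proof -
      have "(\<integral>\<^sup>+t. ennreal ((p - 1) * t powr ((p - 1) - 1)) *
          indicator {t. 0 < t \<and> ennreal t < ennreal (2 * C1) * h x} t \<partial>lborel)
        = ennreal_powr (ennreal (2 * C1) * h x) (p - 1)"
        by (rule nn_integral_layer) (use p in simp)
      then show ?thesis by (subst nn_integral_cmult) auto
    qed
    also have "\<dots> = ennreal (K * p / (p - 1)) * ennreal ((2 * C1) powr (p - 1)) * (h x * ennreal_powr (h x) (p - 1))"
      using C1_pos by (subst ennreal_powr_cmult) (simp_all add: mult_ac)
    also have "h x * ennreal_powr (h x) (p - 1) = ennreal_powr (h x) p"
    proof (cases "h x")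
      case (real b)
      have "b * b powr (p - 1) = b powr p"
        using real p powr_add[of b 1 "p - 1"] by (cases "b = 0") auto
      then show ?thesis using real by (simp add: ennreal_powr_ennreal ennreal_mult[symmetric])
    qed simp
    also have "ennreal (K * p / (p - 1)) * ennreal ((2 * C1) powr (p - 1)) = ennreal (K * p / (p - 1) * (2 * C1) powr (p - 1))"
      using K p by (subst ennreal_mult[symmetric]) auto
    finally show "(\<integral>\<^sup>+t. ennreal (K * p * t powr (p - 2)) * h x *
        indicator {t. 0 < t \<and> ennreal t < ennreal (2 * C1) * h x} t \<partial>lborel)
      = ennreal (K * p / (p - 1) * (2 * C1) powr (p - 1)) * ennreal_powr (h x) p" .
  qed
  also have "\<dots> = ennreal (K * p / (p - 1) * (2 * C1) powr (p - 1)) * (\<integral>\<^sup>+x. ennreal_powr (h x) p \<partial>\<sigma>)"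
    by (rule nn_integral_cmult) measurable
  finally show ?thesis unfolding K_def .
qed

end

section \<open>Ahlfors regular boundaries\<close>

text \<open>
  A set of diameter \<open>D \<le> d\<close> has Lebesgue measure at most a constant times
  \<open>D ^ N \<le> d powr (N - s) * D powr s\<close>, where \<open>N\<close> is the dimension. Summing over a covering and
  letting \<open>d\<close> tend to zero gives measure zero.
\<close>

lemma lborel_null_if_hausdorff_finite:
  fixes A :: "'a::euclidean_space set"
  assumes A: "A \<in> sets borel" and s: "s < real DIM('a)" and fin: "hausdorff_outer s A < \<infinity>"
  shows "emeasure lborel A = 0"
proof -
  obtain K where K: "0 \<le> K" "hausdorff_outer s A = ennreal K"
    using fin by (cases "hausdorff_outer s A") auto
  define V where "V = unit_ball_vol (real DIM('a))"
  have V: "0 \<le> V" by (simp add: V_def)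
  \<comment> \<open>The gain: covering sets of diameter at most \<open>d\<close> leaves the factor \<open>d powr e\<close>.\<close>
  define e where "e = real DIM('a) - s"
  have e: "0 < e" using s by (simp add: e_def)
  have bound: "emeasure lborel A \<le> ennreal (V * d powr e * (K + 1))" if d: "0 < d" for d
  proof -
    have "hausdorff_pre d s A < ennreal (K + 1)"
      using hausdorff_pre_le_outer[OF d, of s A] K by (simp add: ennreal_lessI order_le_less_trans)
    then obtain C :: "nat \<Rightarrow> 'a set" where C: "A \<subseteq> (\<Union>i. C i)" "\<And>i. bounded (C i)" "\<And>i. diameter (C i) \<le> d"
      and sum: "(\<Sum>i. ennreal (diameter (C i) powr s)) < ennreal (K + 1)"
      by (auto simp: hausdorff_pre_def INF_less_iff)
    define B where "B i = (if C i = {} then {} else cball (SOME x. x \<in> C i) (diameter (C i)))" for i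
    have CB: "C i \<subseteq> B i" for i
    proof
      fix x assume x: "x \<in> C i"
      then have "(SOME x. x \<in> C i) \<in> C i" by (rule someI)
      from diameter_bounded_bound[OF C(2) this x] show "x \<in> B i" using x by (auto simp: B_def)
    qed
    have B: "emeasure lborel (B i) \<le> ennreal (V * d powr e) * ennreal (diameter (C i) powr s)" for i
    proof (cases "C i = {}")
      case False
      let ?D = "diameter (C i)"
      have D: "0 \<le> ?D" by (rule diameter_ge_0[OF C(2)])
      have "?D ^ DIM('a) \<le> d powr e * ?D powr s"
      proof (cases "?D = 0")
        case False
        then have "?D ^ DIM('a) = ?D powr e * ?D powr s"
          using D by (simp add: e_def powr_add[symmetric] powr_realpow)
        also have "\<dots> \<le> d powr e * ?D powr s"
          using C(3) D e by (intro mult_right_mono powr_mono2) auto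
        finally show ?thesis .
      qed (simp add: zero_power)
      then have "V * ?D ^ DIM('a) \<le> V * (d powr e * ?D powr s)"
        using V by (rule mult_left_mono)
      then show ?thesis
        using False D V by (simp add: B_def V_def[symmetric] emeasure_cball ennreal_mult[symmetric] mult.assoc ennreal_leI)
    qed (simp add: B_def)
    have "A \<subseteq> (\<Union>i. B i)" using C(1) CB by blast
    then have "emeasure lborel A \<le> emeasure lborel (\<Union>i. B i)"
      by (rule emeasure_mono) (auto simp: B_def)
    also have "\<dots> \<le> (\<Sum>i. emeasure lborel (B i))"
      by (intro emeasure_subadditive_countably) (auto simp: B_def)
    also have "\<dots> \<le> (\<Sum>i. ennreal (V * d powr e) * ennreal (diameter (C i) powr s))"
      by (intro suminf_le B) auto
    also have "\<dots> = ennreal (V * d powr e) * (\<Sum>i. ennreal (diameter (C i) powr s))" by simp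
    also have "\<dots> \<le> ennreal (V * d powr e) * ennreal (K + 1)"
      using sum by (intro mult_left_mono) auto
    also have "\<dots> = ennreal (V * d powr e * (K + 1))"
      using V K by (simp add: ennreal_mult)
    finally show ?thesis .
  qed
  have "((\<lambda>d. ennreal (V * d powr e * (K + 1))) \<longlongrightarrow> ennreal (V * 0 * (K + 1))) (at_right 0)"
    using e by (intro tendsto_ennrealI tendsto_intros) (auto intro!: tendsto_eq_intros simp: eventually_at_right_field)
  moreover have "\<forall>\<^sub>F d in at_right 0. emeasure lborel A \<le> ennreal (V * d powr e * (K + 1))"
    using bound by (auto simp: eventually_at_right_field intro!: exI[of _ 1])
  ultimately have "emeasure lborel A \<le> ennreal (V * 0 * (K + 1))"
    by (intro tendsto_lowerbound) auto
  then show ?thesis by simp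
qed

lemma dist_le_ediam: "x \<in> E \<Longrightarrow> y \<in> E \<Longrightarrow> ennreal (dist x y) \<le> ediam E"
  unfolding ediam_def by (intro SUP_upper2[of x] SUP_upper2[of y]) auto

text \<open>
  A ball inside the set would have finite Hausdorff measure of dimension below that of the space,
  although its Lebesgue measure is positive.
\<close>

lemma ahlfors_regular_interior_empty:
  fixes E :: "'a::euclidean_space set"
  assumes E: "ahlfors_regular s C0 E" and s: "s < real DIM('a)"
  shows "interior E = {}"
proof (rule ccontr)
  assume "interior E \<noteq> {}"
  then obtain x r where r: "0 < r" "ball x r \<subseteq> E" by (auto simp: mem_interior)
  define y where "y = x + (r / 2) *\<^sub>R (SOME b. b \<in> Basis)"
  have "dist x y = r / 2" using r by (simp add: y_def dist_norm)
  then have "ennreal (r / 2) \<le> ediam E"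
    using dist_le_ediam[of x E y] r by (auto simp: subset_iff)
  moreover have "ennreal (r / 4) < ennreal (r / 2)" using r by (intro ennreal_lessI) auto
  ultimately have "ennreal (r / 4) < ediam E" by (rule less_le_trans[rotated])
  moreover have "x \<in> E" using r by auto
  ultimately have "emeasure (hausdorff_measure s) (E \<inter> ball x (r / 4)) \<le> ennreal (C0 * (r / 4) powr s)"
    using E r by (simp add: ahlfors_regular_def)
  moreover have "E \<inter> ball x (r / 4) = ball x (r / 4)" using r by auto
  ultimately have "hausdorff_outer s (ball x (r / 4)) < \<infinity>"
    by (simp add: emeasure_hausdorff_measure le_less_trans)
  then have "emeasure lborel (ball x (r / 4)) = 0"
    by (intro lborel_null_if_hausdorff_finite[OF _ s]) auto
  then show False
    using content_ball_pos[of "r / 4" x] r by (simp add: measure_def)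
qed

text \<open>
  For \<open>s < n\<close> the domain is the complement of a regular set; since that set has no interior, it is
  equal to the boundary of the domain.
\<close>

lemma AR_domain_frontier:
  fixes \<Omega> :: "'a::euclidean_space set"
  assumes "AR_domain n s C0 c \<Omega>" "DIM('a) = n + 1" "s \<le> real n"
  shows "open \<Omega>" "ahlfors_regular s C0 (frontier \<Omega>)"
proof -
  have "open \<Omega> \<and> ahlfors_regular s C0 (frontier \<Omega>)"
  proof (cases "s = real n")
    case False
    then obtain E where E: "ahlfors_regular s C0 E" "\<Omega> = - E"
      using assms(1) by (auto simp: AR_domain_def)
    have cl: "closed E" using E(1) by (simp add: ahlfors_regular_def)
    have "interior E = {}"
      by (rule ahlfors_regular_interior_empty[OF E(1)]) (use assms in auto)
    then have "frontier \<Omega> = E"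
      using cl E(2) by (simp add: frontier_complement frontier_def[of E])
    then show ?thesis using E cl by auto
  qed (use assms in \<open>auto simp: AR_domain_def\<close>)
  then show "open \<Omega>" "ahlfors_regular s C0 (frontier \<Omega>)" by auto
qed

lemma space_surface_measure [simp]: "space (surface_measure s \<Omega>) = frontier \<Omega>"
  by (simp add: surface_measure_def space_restrict_space)

lemma measurable_id_surface_measure: "(\<lambda>x. x) \<in> borel_measurable (surface_measure s \<Omega>)"
  unfolding surface_measure_def by (intro measurable_restrict_space1) (simp cong: measurable_cong_sets)

lemma emeasure_surface_measure:
  "A \<in> sets borel \<Longrightarrow> emeasure (surface_measure s \<Omega>) (A \<inter> frontier \<Omega>) =
    emeasure (hausdorff_measure s) (frontier \<Omega> \<inter> A)"
  unfolding surface_measure_def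
  by (subst emeasure_restrict_space) (auto simp: Int_commute)

text \<open>
  For a boundary with at most one point the regularity condition is void, but the surface measure
  vanishes, and so do all norms.
\<close>

lemma surface_measure_null:
  fixes \<Omega> :: "'a::euclidean_space set"
  assumes "0 < s" "ediam (frontier \<Omega>) = 0"
  shows "emeasure (surface_measure s \<Omega>) (frontier \<Omega>) = 0"
proof -
  obtain x where x: "frontier \<Omega> \<subseteq> {x}"
  proof (cases "frontier \<Omega> = {}")
    case False
    then obtain x where "x \<in> frontier \<Omega>" by blast
    then have "y = x" if "y \<in> frontier \<Omega>" for y
      using dist_le_ediam[of x "frontier \<Omega>" y] that assms(2) by simp
    then show ?thesis using that by blast
  qed (use that in blast)
  have "hausdorff_pre d s (frontier \<Omega>) = 0" if "0 < d" for d
  proof -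
    have "hausdorff_pre d s (frontier \<Omega>) \<le> (\<Sum>i::nat. ennreal (diameter {x} powr s))"
      unfolding hausdorff_pre_def using x that by (intro INF_lower2[of "\<lambda>_. {x}"]) auto
    then show ?thesis by simp
  qed
  then have "hausdorff_outer s (frontier \<Omega>) = 0" by (simp add: hausdorff_outer_def)
  then show ?thesis
    using emeasure_surface_measure[of UNIV s \<Omega>] by (simp add: emeasure_hausdorff_measure)
qed

text \<open>
  Regularity only speaks of radii below the diameter. If the diameter is finite, then the boundary is
  compact and covered by finitely many balls to which the bound applies; its total measure is then finite,
  which bounds balls of larger radius.
\<close>

lemma surface_measure_upper_regular:
  fixes \<Omega> :: "'a::euclidean_space set"
  assumes s: "0 < s" and E: "ahlfors_regular s C0 (frontier \<Omega>)" and diam: "ediam (frontier \<Omega>) \<noteq> 0"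
  shows "\<exists>C1. upper_regular_measure (surface_measure s \<Omega>) s C1"
proof -
  let ?E = "frontier \<Omega>" and ?\<sigma> = "surface_measure s \<Omega>"
  have C0: "0 < C0" using E by (simp add: ahlfors_regular_def)
  have up: "emeasure ?\<sigma> (ball x r \<inter> ?E) \<le> ennreal (C0 * r powr s)"
    if "x \<in> ?E" "0 < r" "ennreal r < ediam ?E" for x r
    using E that by (simp add: ahlfors_regular_def emeasure_surface_measure)
  have "\<exists>C1>0. \<forall>x\<in>?E. \<forall>r>0. emeasure ?\<sigma> (ball x r \<inter> ?E) \<le> ennreal (C1 * r powr s)"
  proof (cases "ediam ?E")
    case top
    then show ?thesis using up C0 by (intro exI[of _ C0]) auto
  next
    case (real D)
    then have D: "0 < D" using diam by (cases "D = 0") auto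
    have dD: "dist x y \<le> D" if "x \<in> ?E" "y \<in> ?E" for x y
      using dist_le_ediam[OF that] real by simp
    have "bounded ?E"
    proof (cases "?E = {}")
      case False
      then obtain x where "x \<in> ?E" by blast
      then show ?thesis using dD by (auto simp: bounded_def)
    qed simp
    then have "compact ?E" by (simp add: compact_eq_bounded_closed)
    then obtain T where T: "T \<subseteq> ?E" "finite T" "?E \<subseteq> (\<Union>x\<in>T. ball x (D / 2))"
      by (rule compactE_image[of ?E ?E "\<lambda>x. ball x (D / 2)"]) (use D in auto)
    have ball_sets: "ball x r \<inter> ?E \<in> sets ?\<sigma>" for x r
      using measurable_sets[OF measurable_id_surface_measure, of "ball x r" s \<Omega>]
      by (simp add: vimage_def Int_def)
    have tot: "emeasure ?\<sigma> ?E \<le> ennreal (real (card T) * (C0 * (D / 2) powr s))"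
    proof -
      have "emeasure ?\<sigma> ?E \<le> emeasure ?\<sigma> (\<Union>x\<in>T. ball x (D / 2) \<inter> ?E)"
        using T(3) T(2) ball_sets by (intro emeasure_mono sets.finite_UN) auto
      also have "\<dots> \<le> (\<Sum>x\<in>T. emeasure ?\<sigma> (ball x (D / 2) \<inter> ?E))"
        using T(2) ball_sets by (intro emeasure_subadditive_finite) auto
      also have "\<dots> \<le> (\<Sum>x\<in>T. ennreal (C0 * (D / 2) powr s))"
        using T(1) D real by (intro sum_mono up) (auto intro!: ennreal_lessI)
      also have "\<dots> = ennreal (real (card T) * (C0 * (D / 2) powr s))"
        using C0 by (simp add: ennreal_of_nat_eq_real_of_nat ennreal_mult)
      finally show ?thesis .
    qed
    have "emeasure ?\<sigma> (ball x r \<inter> ?E) \<le> ennreal (C0 * (real (card T) + 1) * r powr s)"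
      if x: "x \<in> ?E" and r: "0 < r" for x r
    proof (cases "r < D")
      case True
      then have "emeasure ?\<sigma> (ball x r \<inter> ?E) \<le> ennreal (C0 * r powr s)"
        using x r real D by (intro up) (auto intro!: ennreal_lessI)
      also have "\<dots> \<le> ennreal (C0 * (real (card T) + 1) * r powr s)"
        using C0 by (intro ennreal_leI mult_right_mono) (auto simp: field_simps)
      finally show ?thesis .
    next
      case False
      have "emeasure ?\<sigma> (ball x r \<inter> ?E) \<le> emeasure ?\<sigma> ?E"
        using sets.top[of ?\<sigma>] by (intro emeasure_mono) auto
      also have "\<dots> \<le> ennreal (real (card T) * (C0 * (D / 2) powr s))" by (rule tot)
      also have "\<dots> \<le> ennreal ((real (card T) + 1) * (C0 * r powr s))"
        using C0 s D False by (intro ennreal_leI mult_mono powr_mono2) auto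
      finally show ?thesis by (simp add: mult_ac)
    qed
    then show ?thesis using C0 by (intro exI[of _ "C0 * (real (card T) + 1)"]) auto
  qed
  then obtain C1 where "0 < C1" "\<forall>x\<in>?E. \<forall>r>0. emeasure ?\<sigma> (ball x r \<inter> ?E) \<le> ennreal (C1 * r powr s)"
    by blast
  then have "upper_regular_measure ?\<sigma> s C1"
    by unfold_locales (use s measurable_id_surface_measure in auto)
  then show ?thesis by blast
qed

text \<open>
  The segment from \<open>x\<close> to a nearest point of the complement meets the boundary.
\<close>

lemma bdist_eq_infdist_frontier:
  fixes \<Omega> :: "'a::euclidean_space set"
  assumes "open \<Omega>" "x \<in> \<Omega>" "frontier \<Omega> \<noteq> {}"
  shows "bdist \<Omega> x = infdist x (frontier \<Omega>)"
proof (rule antisym)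
  have sub: "frontier \<Omega> \<subseteq> - \<Omega>" using assms(1) by (auto simp: frontier_def interior_open)
  then show "bdist \<Omega> x \<le> infdist x (frontier \<Omega>)"
    unfolding bdist_def by (rule infdist_mono) (rule assms(3))
  have "- \<Omega> \<noteq> {}" "closed (- \<Omega>)" using sub assms by auto
  then obtain y where y: "y \<in> - \<Omega>" "infdist x (- \<Omega>) = dist x y"
    using infdist_attains_inf by metis
  have "closed_segment x y \<inter> frontier \<Omega> \<noteq> {}"
    by (rule connected_Int_frontier) (use assms y in auto)
  then obtain z where z: "z \<in> closed_segment x y" "z \<in> frontier \<Omega>" by blast
  have "infdist x (frontier \<Omega>) \<le> dist x z" by (rule infdist_le[OF z(2)])
  also have "\<dots> \<le> dist x y" using segment_bound(1)[OF z(1)] by (simp add: dist_norm norm_minus_commute)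
  finally show "infdist x (frontier \<Omega>) \<le> bdist \<Omega> x" using y by (simp add: bdist_def)
qed

text \<open>
  Dyadic decomposition around \<open>\<eta>\<close>: the shell of radius \<open>R / 2^k\<close> contributes at most a constant
  times \<open>R / 2^k\<close>, as the dimension exceeds the exponent by one.
\<close>

lemma nn_integral_dist_powr_le:
  fixes \<eta> :: "'a::euclidean_space"
  assumes dim: "DIM('a) = n + 1" and R: "0 < R"
  shows "(\<integral>\<^sup>+x\<in>ball \<eta> R. ennreal (1 / dist \<eta> x ^ n) \<partial>lborel) \<le> ennreal (2 ^ (n + 1) * unit_ball_vol (real (n + 1)) * R)"
proof -
  define V where "V = unit_ball_vol (real (n + 1))"
  have V: "0 \<le> V" by (simp add: V_def)
  let ?g = "\<lambda>k x. ennreal ((2 ^ (k + 1) / R) ^ n) * indicator (ball \<eta> (R / 2 ^ k)) x"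
  have "ennreal (1 / dist \<eta> x ^ n) * indicator (ball \<eta> R) x \<le> (\<Sum>k. ?g k x)" if "x \<noteq> \<eta>" for x
  proof (cases "x \<in> ball \<eta> R")
    case True
    define t where "t = dist \<eta> x"
    have t: "0 < t" "t < R" using that True by (auto simp: t_def)
    obtain k0 where "(1 / 2) ^ k0 < t / R"
      using real_arch_pow_inv[of "t / R" "1 / 2"] t R by auto
    then have ex: "R / 2 ^ (k0 + 1) \<le> t"
      using R t by (simp add: power_divide field_simps)
    \<comment> \<open>The index of the dyadic shell that contains \<open>x\<close>.\<close>
    define k where "k = (LEAST k. R / 2 ^ (k + 1) \<le> t)"
    have k1: "R / 2 ^ (k + 1) \<le> t" unfolding k_def by (rule LeastI[of _ k0]) (rule ex)
    have k2: "t < R / 2 ^ k"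
    proof (cases k)
      case (Suc j)
      then have "\<not> R / 2 ^ (j + 1) \<le> t" using not_less_Least[of j "\<lambda>k. R / 2 ^ (k + 1) \<le> t"] by (simp add: k_def)
      then show ?thesis using Suc by simp
    qed (use t in simp)
    have "1 / t \<le> 2 ^ (k + 1) / R"
      using k1 t R by (simp add: field_simps)
    then have "(1 / t) ^ n \<le> (2 ^ (k + 1) / R) ^ n"
      using t by (intro power_mono) auto
    then have "ennreal (1 / dist \<eta> x ^ n) * indicator (ball \<eta> R) x \<le> ?g k x"
      using k2 True by (simp add: t_def[symmetric] power_one_over ennreal_leI del: power_Suc)
    also have "\<dots> = (\<Sum>k\<in>{k}. ?g k x)"
      by (subst sum.insert) (simp_all only: finite.emptyI empty_iff not_False_eq_True sum.empty add_0_right)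
    also have "\<dots> \<le> (\<Sum>k. ?g k x)" by (intro sum_le_suminf) auto
    finally show ?thesis .
  qed simp
  then have "(\<integral>\<^sup>+x\<in>ball \<eta> R. ennreal (1 / dist \<eta> x ^ n) \<partial>lborel) \<le> (\<integral>\<^sup>+x. (\<Sum>k. ?g k x) \<partial>lborel)"
    using AE_lborel_singleton[of \<eta>] by (intro nn_integral_mono_AE) auto
  also have "\<dots> = (\<Sum>k. \<integral>\<^sup>+x. ?g k x \<partial>lborel)"
    by (rule nn_integral_suminf) measurable
  also have "\<dots> = (\<Sum>k. ennreal (2 ^ n * V * R * (1 / 2) ^ k))"
  proof (rule suminf_cong)
    fix k
    have "(\<integral>\<^sup>+x. ?g k x \<partial>lborel) = ennreal ((2 ^ (k + 1) / R) ^ n) * emeasure lborel (ball \<eta> (R / 2 ^ k))"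
      by (rule nn_integral_cmult_indicator) simp
    also have "\<dots> = ennreal ((2 ^ (k + 1) / R) ^ n * (V * (R / 2 ^ k) ^ (n + 1)))"
    proof -
      have "emeasure lborel (ball \<eta> (R / 2 ^ k)) = ennreal (V * (R / 2 ^ k) ^ (n + 1))"
        using R dim by (subst emeasure_ball) (auto simp: V_def)
      moreover have "ennreal ((2 ^ (k + 1) / R) ^ n) * ennreal (V * (R / 2 ^ k) ^ (n + 1))
          = ennreal ((2 ^ (k + 1) / R) ^ n * (V * (R / 2 ^ k) ^ (n + 1)))"
        by (rule ennreal_mult[symmetric]) (use V R in simp_all)
      ultimately show ?thesis by (simp only:)
    qed
    also have "(2 ^ (k + 1) / R) ^ n * (V * (R / 2 ^ k) ^ (n + 1)) = V * ((2 ^ (k + 1) / R) * (R / 2 ^ k)) ^ n * (R / 2 ^ k)"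
      by (simp only: power_mult_distrib power_add power_one_right mult_ac)
    also have "(2 ^ (k + 1) / R) * (R / 2 ^ k) = 2" using R by (simp add: field_simps)
    also have "V * 2 ^ n * (R / 2 ^ k) = 2 ^ n * V * R * (1 / 2) ^ k" by (simp add: power_one_over divide_simps)
    finally show "(\<integral>\<^sup>+x. ?g k x \<partial>lborel) = ennreal (2 ^ n * V * R * (1 / 2) ^ k)" .
  qed
  also have "\<dots> = ennreal (2 ^ (n + 1) * V * R)"
  proof (rule suminf_ennreal_eq)
    have "(\<lambda>k. (1 / 2 :: real) ^ k) sums 2" using geometric_sums[of "1 / 2 :: real"] by simp
    from sums_mult[OF this, of "2 ^ n * V * R"]
    show "(\<lambda>k. 2 ^ n * V * R * (1 / 2) ^ k) sums (2 ^ (n + 1) * V * R)" by (simp add: mult_ac)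
  qed (use V R in auto)
  finally show ?thesis by (simp add: V_def)
qed

section \<open>Density of smooth functions in Lp\<close>

lemma borel_measurable_infdist [measurable (raw)]:
  fixes f :: "'b \<Rightarrow> 'a::euclidean_space"
  assumes "f \<in> borel_measurable M"
  shows "(\<lambda>x. infdist (f x) A) \<in> borel_measurable M"
proof (rule measurable_compose[OF assms])
  show "(\<lambda>x. infdist x A) \<in> borel_measurable borel"
    by (intro borel_measurable_continuous_onI continuous_intros)
qed

lemma abs_add_powr_le:
  fixes a b p :: real
  assumes "0 \<le> p"
  shows "\<bar>a + b\<bar> powr p \<le> 2 powr p * (\<bar>a\<bar> powr p + \<bar>b\<bar> powr p)"
proof -
  have "\<bar>a + b\<bar> powr p \<le> (2 * max \<bar>a\<bar> \<bar>b\<bar>) powr p"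
    using assms by (intro powr_mono2) auto
  also have "\<dots> = 2 powr p * max \<bar>a\<bar> \<bar>b\<bar> powr p" by (simp add: powr_mult)
  also have "\<dots> \<le> 2 powr p * (\<bar>a\<bar> powr p + \<bar>b\<bar> powr p)"
    by (intro mult_left_mono) (auto simp: max_def)
  finally show ?thesis .
qed

abbreviation Lp_mass :: "'a measure \<Rightarrow> real \<Rightarrow> ('a \<Rightarrow> real) \<Rightarrow> ennreal" where
  "Lp_mass M p f \<equiv> \<integral>\<^sup>+x. ennreal (\<bar>f x\<bar> powr p) \<partial>M"

text \<open>
  The approximating class. Its members are defined on the whole space, so that they serve as
  extensions of their own boundary values.
\<close>

definition test_function :: "('a::euclidean_space \<Rightarrow> real) \<Rightarrow> bool" where
  "test_function g \<longleftrightarrow> smooth_on UNIV g \<and> (\<exists>L. \<forall>x y. \<bar>g x - g y\<bar> \<le> L * dist x y) \<and>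
     (\<exists>R. \<forall>x. R \<le> norm x \<longrightarrow> g x = 0)"

lemma test_functionD:
  assumes "test_function g"
  shows "smooth_on UNIV g" "continuous_on S g" "g \<in> borel_measurable borel"
proof -
  show 1: "smooth_on UNIV g" using assms by (simp add: test_function_def)
  then have "continuous_on UNIV g" by (rule smooth_on_imp_continuous)
  then show "continuous_on S g" "g \<in> borel_measurable borel"
    by (auto intro: continuous_on_subset borel_measurable_continuous_onI)
qed

lemma test_function_bounds:
  assumes "test_function g"
  shows "\<exists>L R. 0 < L \<and> 0 < R \<and> (\<forall>x y. \<bar>g x - g y\<bar> \<le> L * dist x y) \<and> (\<forall>x. R \<le> norm x \<longrightarrow> g x = 0)"
proof -
  obtain L where L: "\<And>x y. \<bar>g x - g y\<bar> \<le> L * dist x y"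
    using assms unfolding test_function_def by blast
  obtain R where R: "\<And>x. R \<le> norm x \<Longrightarrow> g x = 0"
    using assms unfolding test_function_def by blast
  have "\<bar>g x - g y\<bar> \<le> max 1 L * dist x y" for x y
    by (rule order_trans[OF L]) (intro mult_right_mono, auto)
  moreover have "g x = 0" if "max 1 R \<le> norm x" for x
    by (rule R) (use that in simp)
  ultimately show ?thesis by - (rule exI[of _ "max 1 L"], rule exI[of _ "max 1 R"], simp add: less_max_iff_disj)
qed

lemma test_function_add:
  assumes f: "test_function f" and g: "test_function g"
  shows "test_function (\<lambda>x. f x + g x)"
proof -
  obtain L R where 1: "\<And>x y. \<bar>f x - f y\<bar> \<le> L * dist x y" "\<And>x. R \<le> norm x \<Longrightarrow> f x = 0"
    using test_function_bounds[OF f] by blast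
  obtain L' R' where 2: "\<And>x y. \<bar>g x - g y\<bar> \<le> L' * dist x y" "\<And>x. R' \<le> norm x \<Longrightarrow> g x = 0"
    using test_function_bounds[OF g] by blast
  have "\<bar>f x + g x - (f y + g y)\<bar> \<le> (L + L') * dist x y" for x y
    using 1(1)[of x y] 2(1)[of x y] by (simp add: distrib_right)
  moreover have "f x + g x = 0" if "max R R' \<le> norm x" for x using 1(2)[of x] 2(2)[of x] that by simp
  ultimately show ?thesis
    unfolding test_function_def using smooth_on_add[OF open_UNIV test_functionD(1)[OF f] test_functionD(1)[OF g]]
    by blast
qed

lemma test_function_cmult:
  assumes g: "test_function g"
  shows "test_function (\<lambda>x. c * g x)"
proof -
  obtain L R where 1: "\<And>x y. \<bar>g x - g y\<bar> \<le> L * dist x y" "\<And>x. R \<le> norm x \<Longrightarrow> g x = 0"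
    using test_function_bounds[OF g] by blast
  have "\<bar>c * g x - c * g y\<bar> \<le> (\<bar>c\<bar> * L) * dist x y" for x y
    using mult_left_mono[OF 1(1)[of x y], of "\<bar>c\<bar>"]
    by (simp add: abs_mult[symmetric] right_diff_distrib mult.assoc)
  moreover have "c * g x = 0" if "R \<le> norm x" for x using 1(2)[OF that] by simp
  ultimately show ?thesis
    unfolding test_function_def using smooth_on_mult[OF open_UNIV smooth_on_const test_functionD(1)[OF g], of c]
    by blast
qed

lemma test_function_diff: "test_function f \<Longrightarrow> test_function g \<Longrightarrow> test_function (\<lambda>x. f x - g x)"
  using test_function_add[of f "\<lambda>x. (- 1) * g x"] test_function_cmult[of g "-1"] by simp

lemma test_function_0: "test_function (\<lambda>_. 0)"
  by (auto simp: test_function_def smooth_on_const intro: exI[of _ 0])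

lemma test_function_mollify:
  assumes t: "0 < t" and L: "\<And>x y. \<bar>g x - g y\<bar> \<le> L * dist x y" and R: "\<And>x. R \<le> norm x \<Longrightarrow> g x = 0"
    and c: "continuous_on UNIV g"
  shows "test_function (mollify t g)"
proof -
  have "mollify t g x = 0" if "R + t \<le> norm x" for x
  proof -
    have "g y = 0" if "dist x y < t" for y
      using that \<open>R + t \<le> norm x\<close> norm_triangle_ineq2[of x y] by (intro R) (simp add: dist_norm)
    then show ?thesis by (rule mollify_eq_const[OF t c])
  qed
  then show ?thesis
    unfolding test_function_def using mollify_lipschitz[OF t L] smooth_on_mollify[OF t c] by blast
qed

context upper_regular_measure
begin

definition approximable :: "real \<Rightarrow> ('a \<Rightarrow> real) \<Rightarrow> bool" where
  "approximable p f \<longleftrightarrow> (\<forall>e>0. \<exists>G. test_function G \<and> Lp_mass \<sigma> p (\<lambda>x. f x - G x) < ennreal e)"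

lemma borel_measurable_test_function: "test_function G \<Longrightarrow> G \<in> borel_measurable \<sigma>"
  by (rule borel_measurable_of_borel[OF test_functionD(3)])

lemma nn_integral_powr_add_le:
  assumes [measurable]: "f \<in> borel_measurable \<sigma>" "g \<in> borel_measurable \<sigma>" and p: "0 \<le> p"
  shows "Lp_mass \<sigma> p (\<lambda>x. f x + g x)
    \<le> ennreal (2 powr p) * (Lp_mass \<sigma> p f + Lp_mass \<sigma> p g)"
proof -
  have "Lp_mass \<sigma> p (\<lambda>x. f x + g x)
    \<le> (\<integral>\<^sup>+x. ennreal (2 powr p) * (ennreal (\<bar>f x\<bar> powr p) + ennreal (\<bar>g x\<bar> powr p)) \<partial>\<sigma>)"
  proof (rule nn_integral_mono)
    fix x
    have "ennreal (\<bar>f x + g x\<bar> powr p) \<le> ennreal (2 powr p * (\<bar>f x\<bar> powr p + \<bar>g x\<bar> powr p))"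
      by (rule ennreal_leI[OF abs_add_powr_le[OF p]])
    then show "ennreal (\<bar>f x + g x\<bar> powr p) \<le> ennreal (2 powr p) * (ennreal (\<bar>f x\<bar> powr p) + ennreal (\<bar>g x\<bar> powr p))"
      by (simp add: ennreal_mult)
  qed
  also have "\<dots> = ennreal (2 powr p) * (Lp_mass \<sigma> p f + Lp_mass \<sigma> p g)"
    by (simp add: nn_integral_cmult nn_integral_add)
  finally show ?thesis .
qed

lemma approximable_trans:
  assumes p: "0 \<le> p" and f [measurable]: "f \<in> borel_measurable \<sigma>"
    and ex: "\<And>e. 0 < e \<Longrightarrow> \<exists>g \<in> borel_measurable \<sigma>. approximable p g \<and> Lp_mass \<sigma> p (\<lambda>x. f x - g x) < ennreal e"
  shows "approximable p f"
  unfolding approximable_def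
proof (intro allI impI)
  fix e :: real assume e: "0 < e"
  define d where "d = e / (2 * 2 powr p)"
  have d: "0 < d" using e by (simp add: d_def)
  obtain g where g [measurable]: "g \<in> borel_measurable \<sigma>" and ag: "approximable p g"
    and gd: "Lp_mass \<sigma> p (\<lambda>x. f x - g x) < ennreal d"
    using ex[OF d] by blast
  obtain G where G: "test_function G" and Gd: "Lp_mass \<sigma> p (\<lambda>x. g x - G x) < ennreal d"
    using ag d unfolding approximable_def by blast
  note [measurable] = borel_measurable_test_function[OF G]
  have "Lp_mass \<sigma> p (\<lambda>x. f x - G x) = Lp_mass \<sigma> p (\<lambda>x. (f x - g x) + (g x - G x))" by simp
  also have "\<dots> \<le> ennreal (2 powr p) * (Lp_mass \<sigma> p (\<lambda>x. f x - g x) + Lp_mass \<sigma> p (\<lambda>x. g x - G x))"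
    by (rule nn_integral_powr_add_le) (use p in measurable)
  also have "\<dots> < ennreal (2 powr p) * (ennreal d + ennreal d)"
    by (intro ennreal_mult_strict_left_mono add_strict_mono gd Gd) auto
  also have "\<dots> = ennreal e"
    using d by (simp add: ennreal_plus[symmetric] ennreal_mult[symmetric] d_def del: ennreal_plus)
  finally show "\<exists>G. test_function G \<and> Lp_mass \<sigma> p (\<lambda>x. f x - G x) < ennreal e"
    using G by blast
qed

lemma approximable_add:
  assumes p: "0 \<le> p" and [measurable]: "f \<in> borel_measurable \<sigma>" "g \<in> borel_measurable \<sigma>"
    and f: "approximable p f" and g: "approximable p g"
  shows "approximable p (\<lambda>x. f x + g x)"
  unfolding approximable_def
proof (intro allI impI)
  fix e :: real assume e: "0 < e"
  define d where "d = e / (2 * 2 powr p)"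
  have d: "0 < d" using e by (simp add: d_def)
  obtain F where F: "test_function F" and Fd: "Lp_mass \<sigma> p (\<lambda>x. f x - F x) < ennreal d"
    using f d unfolding approximable_def by blast
  obtain G where G: "test_function G" and Gd: "Lp_mass \<sigma> p (\<lambda>x. g x - G x) < ennreal d"
    using g d unfolding approximable_def by blast
  note [measurable] = borel_measurable_test_function[OF G] borel_measurable_test_function[OF F]
  have "Lp_mass \<sigma> p (\<lambda>x. f x + g x - (F x + G x)) = Lp_mass \<sigma> p (\<lambda>x. (f x - F x) + (g x - G x))"
    by (simp add: algebra_simps)
  also have "\<dots> \<le> ennreal (2 powr p) * (Lp_mass \<sigma> p (\<lambda>x. f x - F x) + Lp_mass \<sigma> p (\<lambda>x. g x - G x))"
    by (rule nn_integral_powr_add_le) (use p in measurable)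
  also have "\<dots> < ennreal (2 powr p) * (ennreal d + ennreal d)"
    by (intro ennreal_mult_strict_left_mono add_strict_mono Fd Gd) auto
  also have "\<dots> = ennreal e"
    using d by (simp add: ennreal_plus[symmetric] ennreal_mult[symmetric] d_def del: ennreal_plus)
  finally show "\<exists>H. test_function H \<and> Lp_mass \<sigma> p (\<lambda>x. f x + g x - H x) < ennreal e"
    using test_function_add[OF F G] by blast
qed

lemma approximable_cmult:
  assumes [measurable]: "f \<in> borel_measurable \<sigma>" and f: "approximable p f"
  shows "approximable p (\<lambda>x. c * f x)"
  unfolding approximable_def
proof (intro allI impI)
  fix e :: real assume e: "0 < e"
  define d where "d = e / (\<bar>c\<bar> powr p + 1)"
  have c: "0 < \<bar>c\<bar> powr p + 1" by (simp add: add_nonneg_pos)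
  have d: "0 < d" using e c by (simp add: d_def)
  obtain F where F: "test_function F" and Fd: "Lp_mass \<sigma> p (\<lambda>x. f x - F x) < ennreal d"
    using f d unfolding approximable_def by blast
  note [measurable] = borel_measurable_test_function[OF F]
  have "\<bar>c * f x - c * F x\<bar> powr p = \<bar>c\<bar> powr p * \<bar>f x - F x\<bar> powr p" for x
    by (simp add: right_diff_distrib[symmetric] abs_mult powr_mult)
  then have "Lp_mass \<sigma> p (\<lambda>x. c * f x - c * F x) = ennreal (\<bar>c\<bar> powr p) * Lp_mass \<sigma> p (\<lambda>x. f x - F x)"
    by (simp add: ennreal_mult nn_integral_cmult)
  also have "\<dots> \<le> ennreal (\<bar>c\<bar> powr p) * ennreal d"
    using Fd by (intro mult_left_mono) auto
  also have "\<dots> = ennreal (\<bar>c\<bar> powr p * d)" using d by (simp add: ennreal_mult)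
  also have "\<dots> < ennreal e"
  proof (rule ennreal_lessI[OF e])
    have "\<bar>c\<bar> powr p * d < (\<bar>c\<bar> powr p + 1) * d" using d by simp
    also have "\<dots> = e" using c by (simp add: d_def)
    finally show "\<bar>c\<bar> powr p * d < e" .
  qed
  finally show "\<exists>H. test_function H \<and> Lp_mass \<sigma> p (\<lambda>x. c * f x - H x) < ennreal e"
    using test_function_cmult[OF F] by blast
qed

text \<open>
  Mollifying at scale \<open>t\<close> moves the function by at most \<open>L * t\<close>, and only on a bounded set, which has
  finite measure.
\<close>

lemma approximable_lipschitz:
  assumes p: "0 < p" and L: "\<And>x y. \<bar>g x - g y\<bar> \<le> L * dist x y" "0 < L"
    and R: "\<And>x. R \<le> norm x \<Longrightarrow> g x = 0" and c: "continuous_on UNIV g"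
  shows "approximable p g"
  unfolding approximable_def
proof (intro allI impI)
  fix e :: real assume e: "0 < e"
  let ?B = "ball 0 (R + 1) :: 'a set"
  obtain m where m: "0 \<le> m" "emeasure \<sigma> (?B \<inter> space \<sigma>) = ennreal m"
    using emeasure_bounded[of ?B] by (cases "emeasure \<sigma> (?B \<inter> space \<sigma>)") auto
  define t where "t = min 1 ((e / (m + 1)) powr (1 / p) / L)"
  have t: "0 < t" "t \<le> 1" using e m L by (auto simp: t_def)
  have "L * t \<le> (e / (m + 1)) powr (1 / p)"
    using L by (auto simp: t_def min_def field_simps)
  then have "(L * t) powr p \<le> ((e / (m + 1)) powr (1 / p)) powr p"
    using L t p by (intro powr_mono2) auto
  also have "\<dots> = e / (m + 1)" using p e m by (simp add: powr_powr)
  finally have Lt: "(L * t) powr p \<le> e / (m + 1)" .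
  have close: "\<bar>g x - mollify t g x\<bar> \<le> L * t" for x
  proof -
    have b: "\<bar>g y - g x\<bar> \<le> L * t" if "dist x y < t" for y
    proof -
      have "\<bar>g y - g x\<bar> \<le> L * dist y x" by (rule L)
      also have "\<dots> \<le> L * t" using that L by (intro mult_left_mono) (auto simp: dist_commute)
      finally show ?thesis .
    qed
    have "mollify t g x \<le> g x + L * t"
    proof (rule mollify_bounds(1)[OF t(1) c])
      show "g y \<le> g x + L * t" if "dist x y < t" for y using b[OF that] by linarith
    qed
    moreover have "g x - L * t \<le> mollify t g x"
    proof (rule mollify_bounds(2)[OF t(1) c])
      show "g x - L * t \<le> g y" if "dist x y < t" for y using b[OF that] by linarith
    qed
    ultimately show ?thesis by linarith
  qed
  have zero: "g x = 0 \<and> mollify t g x = 0" if "x \<notin> ?B" for x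
  proof -
    have "g y = 0" if "dist x y < t" for y
      using that \<open>x \<notin> ?B\<close> t norm_triangle_ineq2[of x y] by (intro R) (simp add: dist_norm)
    then have "mollify t g x = 0" by (rule mollify_eq_const[OF t(1) c])
    then show ?thesis using R[of x] that by simp
  qed
  have "Lp_mass \<sigma> p (\<lambda>x. g x - mollify t g x)
      \<le> (\<integral>\<^sup>+x. ennreal ((L * t) powr p) * indicator (?B \<inter> space \<sigma>) x \<partial>\<sigma>)"
  proof (rule nn_integral_mono)
    fix x assume "x \<in> space \<sigma>"
    then show "ennreal (\<bar>g x - mollify t g x\<bar> powr p) \<le> ennreal ((L * t) powr p) * indicator (?B \<inter> space \<sigma>) x"
      using zero[of x] powr_mono2[of p "\<bar>g x - mollify t g x\<bar>" "L * t"] close[of x] p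
      by (cases "x \<in> ?B") (auto simp: ennreal_leI)
  qed
  also have "\<dots> = ennreal ((L * t) powr p) * ennreal m"
    unfolding m(2)[symmetric] by (rule nn_integral_cmult_indicator) (rule sets_of_borel, simp)
  also have "\<dots> = ennreal ((L * t) powr p * m)" using m by (simp add: ennreal_mult)
  also have "\<dots> \<le> ennreal (e / (m + 1) * m)"
    by (intro ennreal_leI mult_right_mono Lt m)
  also have "\<dots> < ennreal e"
    using m e by (intro ennreal_lessI) (auto simp: field_simps)
  finally show "\<exists>G. test_function G \<and> Lp_mass \<sigma> p (\<lambda>x. g x - G x) < ennreal e"
    using test_function_mollify[OF t(1) L(1) R c] by blast
qed

text \<open>
  The Lipschitz functions \<open>max 0 (1 - m * infdist x K)\<close> differ from the indicator of \<open>K\<close> only in the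
  punctured neighbourhood \<open>0 < infdist x K < 1 / m\<close>. These shrink to the empty set and have finite measure.
\<close>

lemma approximable_compact:
  assumes p: "0 < p" and K: "compact K"
  shows "approximable p (indicator K)"
proof (cases "K = {}")
  case True
  then show ?thesis unfolding approximable_def
    by (intro allI impI exI[of _ "\<lambda>_. 0"]) (auto simp: test_function_0)
next
  case False
  define g where "g m x = max 0 (1 - real m * infdist x K)" for m :: nat and x :: 'a
  obtain B where B: "0 < B" "\<And>x. x \<in> K \<Longrightarrow> norm x \<le> B"
    using compact_imp_bounded[OF K] by (auto simp: bounded_pos)
  define S where "S m = {x. 0 < infdist x K \<and> infdist x K < 1 / real (Suc m)} \<inter> space \<sigma>" for m
  have approx: "approximable p (g (Suc m))" for m
  proof (rule approximable_lipschitz[OF p])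
    show "\<bar>g (Suc m) x - g (Suc m) y\<bar> \<le> real (Suc m) * dist x y" for x y
    proof -
      have "\<bar>infdist x K - infdist y K\<bar> \<le> dist x y"
        using infdist_triangle[of x K y] infdist_triangle[of y K x] by (simp add: dist_commute)
      then have 1: "real (Suc m) * \<bar>infdist x K - infdist y K\<bar> \<le> real (Suc m) * dist x y"
        by (rule mult_left_mono) simp
      have "\<bar>g (Suc m) x - g (Suc m) y\<bar> \<le> \<bar>real (Suc m) * infdist x K - real (Suc m) * infdist y K\<bar>"
        by (auto simp: g_def)
      also have "\<dots> = real (Suc m) * \<bar>infdist x K - infdist y K\<bar>"
        by (simp only: right_diff_distrib[symmetric] abs_mult abs_of_nat)
      finally show ?thesis using 1 by (rule order_trans)
    qed
    show "g (Suc m) x = 0" if "B + 1 \<le> norm x" for x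
    proof -
      obtain y where y: "y \<in> K" "infdist x K = dist x y"
        using infdist_attains_inf[OF compact_imp_closed[OF K] False] by metis
      have "1 \<le> 1 * infdist x K"
        using B(2)[OF y(1)] that y(2) norm_triangle_ineq2[of x y] by (simp add: dist_norm)
      also have "1 * infdist x K \<le> real (Suc m) * infdist x K"
        by (rule mult_right_mono) (auto simp: infdist_nonneg)
      finally have "1 \<le> real (Suc m) * infdist x K" by (simp only: mult_1)
      then show ?thesis by (simp add: g_def max_def del: of_nat_Suc)
    qed
    show "continuous_on UNIV (g (Suc m))"
      unfolding g_def by (intro continuous_intros)
  qed simp
  have Sb: "S m = {x. 0 < infdist x K \<and> infdist x K < 1 / real (Suc m)} \<inter> ball 0 (B + 2) \<inter> space \<sigma>" for m
  proof -
    have "norm x < B + 2" if "infdist x K < 1 / real (Suc m)" for x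
    proof -
      obtain y where y: "y \<in> K" "infdist x K = dist x y"
        using infdist_attains_inf[OF compact_imp_closed[OF K] False] by metis
      have "1 / real (Suc m) \<le> 1" by simp
      then have "dist x y < 1" using that y by linarith
      then show ?thesis using B(2)[OF y(1)] norm_triangle_ineq2[of x y] by (simp add: dist_norm)
    qed
    then show ?thesis by (auto simp: S_def)
  qed
  have Sm: "S m \<in> sets \<sigma>" for m
    unfolding S_def by (rule sets_of_borel) measurable
  have "(\<lambda>m. emeasure \<sigma> (S m)) \<longlonglongrightarrow> emeasure \<sigma> (\<Inter>m. S m)"
  proof (rule Lim_emeasure_decseq)
    show "decseq S"
    proof (rule decseq_SucI)
      fix m
      have "1 / real (Suc (Suc m)) \<le> 1 / real (Suc m)" by (simp add: field_simps)
      then show "S (Suc m) \<subseteq> S m" by (auto simp: S_def)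
    qed
    show "emeasure \<sigma> (S m) \<noteq> \<infinity>" for m
    proof -
      have "emeasure \<sigma> (S m) < \<infinity>" unfolding Sb
        by (rule emeasure_bounded) (auto intro: bounded_subset[of "ball 0 (B + 2)"])
      then show ?thesis by simp
    qed
  qed (use Sm in auto)
  moreover have "(\<Inter>m. S m) = {}"
  proof -
    have "\<exists>m. \<not> infdist x K < 1 / real (Suc m)" if pos: "0 < infdist x K" for x
    proof -
      obtain m where "inverse (real (Suc m)) < infdist x K" using reals_Archimedean[OF pos] by blast
      then have "\<not> infdist x K < 1 / real (Suc m)" by (simp add: inverse_eq_divide del: of_nat_Suc)
      then show ?thesis by blast
    qed
    then show ?thesis unfolding S_def by blast
  qed
  ultimately have lim: "(\<lambda>m. emeasure \<sigma> (S m)) \<longlonglongrightarrow> 0" by simp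
  show ?thesis
  proof (rule approximable_trans)
    show "0 \<le> p" using p by simp
    show "indicator K \<in> borel_measurable \<sigma>"
      by (intro borel_measurable_of_borel borel_measurable_indicator borel_compact K)
    fix e :: real assume "0 < e"
    then have "\<forall>\<^sub>F m in sequentially. emeasure \<sigma> (S m) < ennreal e"
      by (intro order_tendstoD(2)[OF lim]) simp
    from eventually_happens'[OF sequentially_bot this]
    obtain m where m: "emeasure \<sigma> (S m) < ennreal e" by blast
    have "Lp_mass \<sigma> p (\<lambda>x. indicator K x - g (Suc m) x) \<le> (\<integral>\<^sup>+x. indicator (S m) x \<partial>\<sigma>)"
    proof (rule nn_integral_mono)
      fix x assume x: "x \<in> space \<sigma>"
      show "ennreal (\<bar>indicator K x - g (Suc m) x\<bar> powr p) \<le> indicator (S m) x"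
      proof (cases "x \<in> K")
        case True
        then show ?thesis by (simp add: g_def)
      next
        case False
        then have pos: "0 < infdist x K"
          using in_closed_iff_infdist_zero[OF compact_imp_closed[OF K] \<open>K \<noteq> {}\<close>, of x] infdist_nonneg[of x K] by linarith
        show ?thesis
        proof (cases "infdist x K < 1 / real (Suc m)")
          case True
          then have "x \<in> S m" using pos x by (simp add: S_def)
          moreover have "0 \<le> g (Suc m) x" "g (Suc m) x \<le> 1"
            using infdist_nonneg[of x K] by (auto simp: g_def)
          then have "\<bar>indicator K x - g (Suc m) x\<bar> powr p \<le> 1"
            using False p by (simp add: powr_le1)
          ultimately show ?thesis by simp
        next
          case c: False
          then have "1 \<le> real (Suc m) * infdist x K"
            by (simp add: not_less pos_divide_le_eq mult.commute del: of_nat_Suc)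
          then have "g (Suc m) x = 0" by (simp add: g_def max_def del: of_nat_Suc)
          then show ?thesis using False by simp
        qed
      qed
    qed
    also have "\<dots> = emeasure \<sigma> (S m)" using Sm by simp
    also note m
    finally have "Lp_mass \<sigma> p (\<lambda>x. indicator K x - g (Suc m) x) < ennreal e" .
    moreover have "g (Suc m) \<in> borel_measurable \<sigma>"
      by (rule borel_measurable_of_borel, unfold g_def) measurable
    ultimately show "\<exists>g\<in>borel_measurable \<sigma>. approximable p g \<and>
        Lp_mass \<sigma> p (\<lambda>x. indicator K x - g x) < ennreal e"
      using approx by blast
  qed
qed

text \<open>
  Inner regularity of finite Borel measures on the Euclidean space reduces the claim to compact sets.
\<close>

lemma approximable_bounded_borel:
  assumes p: "0 < p" and B: "B \<in> sets borel" "bounded B"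
  shows "approximable p (indicator B)"
proof (rule approximable_trans)
  show "0 \<le> p" using p by simp
  show "indicator B \<in> borel_measurable \<sigma>"
    by (rule borel_measurable_of_borel) (use B in auto)
  fix e :: real assume e: "0 < e"
  \<comment> \<open>The restriction of \<open>\<sigma>\<close> to \<open>B\<close> as a finite Borel measure on the whole space.\<close>
  define M where "M = distr (density \<sigma> (indicator B)) borel (\<lambda>x. x)"
  have M: "emeasure M S = emeasure \<sigma> (S \<inter> B \<inter> space \<sigma>)" if [measurable]: "S \<in> sets borel" for S
  proof -
    have "emeasure M S = emeasure (density \<sigma> (indicator B)) (S \<inter> space \<sigma>)"
      unfolding M_def by (subst emeasure_distr) (simp_all add: vimage_def Int_def measurable_id)
    also have "\<dots> = (\<integral>\<^sup>+x. indicator B x * indicator (S \<inter> space \<sigma>) x \<partial>\<sigma>)"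
      by (rule emeasure_density[OF borel_measurable_of_borel sets_of_borel]) (use B in auto)
    also have "\<dots> = (\<integral>\<^sup>+x. indicator (S \<inter> B \<inter> space \<sigma>) x \<partial>\<sigma>)"
      by (intro nn_integral_cong) (auto simp: indicator_def)
    finally show ?thesis using sets_of_borel[of "S \<inter> B"] B by simp
  qed
  have finB: "emeasure \<sigma> (S \<inter> space \<sigma>) < \<infinity>" if "S \<in> sets borel" "S \<subseteq> B" for S
    using that B by (intro emeasure_bounded) (auto intro: bounded_subset)
  have "\<exists>K. compact K \<and> K \<subseteq> B \<and> emeasure M B < emeasure M K + ennreal e"
  proof (rule ccontr)
    assume "\<not> ?thesis"
    then have le: "emeasure M K + ennreal e \<le> emeasure M B" if "K \<in> {K. K \<subseteq> B \<and> compact K}" for K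
      using that by (auto simp: not_less)
    have "emeasure M B = (SUP K\<in>{K. K \<subseteq> B \<and> compact K}. emeasure M K)"
    proof (rule inner_regular)
      show "sets M = sets borel" by (simp add: M_def)
      show "emeasure M (space M) \<noteq> \<infinity>"
        using M[of UNIV] finB[of B] B by (simp add: M_def)
    qed (use B in simp)
    then have "emeasure M B + ennreal e = (SUP K\<in>{K. K \<subseteq> B \<and> compact K}. emeasure M K + ennreal e)"
      by (subst ennreal_SUP_add_left) auto
    also have "\<dots> \<le> emeasure M B" by (rule SUP_least) (rule le)
    finally show False
      using M[of B] finB[of B] B e by (cases "emeasure M B") (auto simp: ennreal_plus[symmetric] simp del: ennreal_plus)
  qed
  then obtain K where K: "compact K" "K \<subseteq> B" "emeasure M B < emeasure M K + ennreal e" by blast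
  have Kb: "K \<in> sets borel" using K(1) by (rule borel_compact)
  have "Lp_mass \<sigma> p (\<lambda>x. indicator B x - indicator K x) = (\<integral>\<^sup>+x. indicator ((B - K) \<inter> space \<sigma>) x \<partial>\<sigma>)"
    using K(2) by (intro nn_integral_cong) (auto simp: indicator_def)
  also have "\<dots> = emeasure \<sigma> ((B - K) \<inter> space \<sigma>)"
    using sets_of_borel[of "B - K"] B Kb by simp
  also have "\<dots> < ennreal e"
  proof -
    have "emeasure \<sigma> (B \<inter> space \<sigma>) = emeasure \<sigma> (K \<inter> space \<sigma>) + emeasure \<sigma> ((B - K) \<inter> space \<sigma>)"
      using sets_of_borel[of "B - K"] sets_of_borel[of K] B Kb K(2)
      by (subst plus_emeasure) (auto intro!: arg_cong[where f = "emeasure \<sigma>"])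
    moreover have "emeasure \<sigma> (B \<inter> space \<sigma>) < emeasure \<sigma> (K \<inter> space \<sigma>) + ennreal e"
      using K(3) M[of B] M[of K] B Kb K(2) by (simp add: Int_absorb2)
    ultimately have "emeasure \<sigma> (K \<inter> space \<sigma>) + emeasure \<sigma> ((B - K) \<inter> space \<sigma>) < emeasure \<sigma> (K \<inter> space \<sigma>) + ennreal e"
      by (simp only:)
    then show ?thesis using add_left_mono[of "ennreal e" _ "emeasure \<sigma> (K \<inter> space \<sigma>)"] by (meson leD leI)
  qed
  finally show "\<exists>g\<in>borel_measurable \<sigma>. approximable p g \<and>
      Lp_mass \<sigma> p (\<lambda>x. indicator B x - g x) < ennreal e"
    by (intro bexI[of _ "indicator K"] conjI approximable_compact[OF p K(1)] borel_measurable_of_borel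
        borel_measurable_indicator Kb)
qed

lemma approximable_seq:
  assumes p: "0 < p" and u [measurable]: "u \<in> borel_measurable \<sigma>" and U [measurable]: "\<And>i. U i \<in> borel_measurable \<sigma>"
    and fin: "Lp_mass \<sigma> p u < \<infinity>"
    and le: "\<And>i x. x \<in> space \<sigma> \<Longrightarrow> 0 \<le> U i x \<and> U i x \<le> u x"
    and lim: "\<And>x. x \<in> space \<sigma> \<Longrightarrow> (\<lambda>i. U i x) \<longlonglongrightarrow> u x"
    and ap: "\<And>i. approximable p (U i)"
  shows "approximable p u"
proof (rule approximable_trans[OF _ u])
  show "0 \<le> p" using p by simp
  fix e :: real assume e: "0 < e"
  have "(\<lambda>i. \<integral>\<^sup>+x. ennreal (\<bar>u x - U i x\<bar> powr p) \<partial>\<sigma>) \<longlonglongrightarrow> (\<integral>\<^sup>+x. 0 \<partial>\<sigma>)"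
  proof (rule nn_integral_dominated_convergence[where w = "\<lambda>x. ennreal (\<bar>u x\<bar> powr p)"])
    show "AE x in \<sigma>. ennreal (\<bar>u x - U i x\<bar> powr p) \<le> ennreal (\<bar>u x\<bar> powr p)" for i
    proof (rule AE_I2)
      fix x assume "x \<in> space \<sigma>"
      from le[OF this, of i] show "ennreal (\<bar>u x - U i x\<bar> powr p) \<le> ennreal (\<bar>u x\<bar> powr p)"
        using p by (intro ennreal_leI powr_mono2) auto
    qed
    show "AE x in \<sigma>. (\<lambda>i. ennreal (\<bar>u x - U i x\<bar> powr p)) \<longlonglongrightarrow> 0"
    proof (rule AE_I2)
      fix x assume x: "x \<in> space \<sigma>"
      have "(\<lambda>i. \<bar>u x - U i x\<bar>) \<longlonglongrightarrow> \<bar>u x - u x\<bar>" by (intro tendsto_intros lim x)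
      then have "(\<lambda>i. \<bar>u x - U i x\<bar> powr p) \<longlonglongrightarrow> 0 powr p"
        by (intro tendsto_powr') (use p in auto)
      then show "(\<lambda>i. ennreal (\<bar>u x - U i x\<bar> powr p)) \<longlonglongrightarrow> 0"
        using tendsto_ennrealI by fastforce
    qed
  qed (use fin in auto)
  then have "\<forall>\<^sub>F i in sequentially. Lp_mass \<sigma> p (\<lambda>x. u x - U i x) < ennreal e"
    using e by (intro order_tendstoD(2)) auto
  from eventually_happens'[OF sequentially_bot this]
  obtain i where "Lp_mass \<sigma> p (\<lambda>x. u x - U i x) < ennreal e" by blast
  then show "\<exists>g\<in>borel_measurable \<sigma>. approximable p g \<and> Lp_mass \<sigma> p (\<lambda>x. u x - g x) < ennreal e"
    by (intro bexI[of _ "U i"] conjI ap U)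
qed

text \<open>
  Measurable induction, with the integrability of the power as a hypothesis inside the induction
  predicate, since it passes to the pieces of the function. The \<open>\<sigma>\<close>-algebra is assumed to consist of the
  traces of Borel sets, as finer measurable sets could not be approximated from inside.
\<close>

lemma approximable_nonneg:
  assumes p: "0 < p" and sets: "sets \<sigma> = (\<lambda>B. B \<inter> space \<sigma>) ` sets borel"
    and u: "u \<in> borel_measurable \<sigma>" "\<And>x. 0 \<le> u x"
  shows "Lp_mass \<sigma> p u < \<infinity> \<longrightarrow> approximable p u"
  using u
proof (rule borel_measurable_induct_real[where P = "\<lambda>u. Lp_mass \<sigma> p u < \<infinity> \<longrightarrow> approximable p u"])
  fix A assume A: "A \<in> sets \<sigma>"
  then have "A \<in> (\<lambda>B. B \<inter> space \<sigma>) ` sets borel" by (simp only: sets)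
  then obtain B where B: "B \<in> sets borel" "A = B \<inter> space \<sigma>" by blast
  show "Lp_mass \<sigma> p (\<lambda>x. indicator A x) < \<infinity> \<longrightarrow> approximable p (indicator A)"
  proof
    assume fin: "Lp_mass \<sigma> p (\<lambda>x. indicator A x) < \<infinity>"
    show "approximable p (indicator A)"
    proof (rule approximable_seq[OF p _ _ fin, where U = "\<lambda>i. indicator (B \<inter> ball 0 (real i))"])
      show "indicator A \<in> borel_measurable \<sigma>" using A by simp
      show "indicator (B \<inter> ball 0 (real i)) \<in> borel_measurable \<sigma>" for i
        by (rule borel_measurable_of_borel) (use B in auto)
      show "0 \<le> (indicator (B \<inter> ball 0 (real i)) x :: real) \<and> indicator (B \<inter> ball 0 (real i)) x \<le> (indicator A x :: real)"
        if "x \<in> space \<sigma>" for x i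
        using that B by (auto simp: indicator_def)
      show "approximable p (indicator (B \<inter> ball 0 (real i)))" for i
        using B by (intro approximable_bounded_borel[OF p]) (auto intro: bounded_subset[of "ball 0 (real i)"])
      show "(\<lambda>i. indicator (B \<inter> ball 0 (real i)) x) \<longlonglongrightarrow> (indicator A x :: real)" if x: "x \<in> space \<sigma>" for x
      proof (rule tendsto_eventually)
        obtain k where k: "norm x < real k" using reals_Archimedean2 by blast
        show "\<forall>\<^sub>F i in sequentially. indicator (B \<inter> ball 0 (real i)) x = (indicator A x :: real)"
        proof (rule eventually_sequentiallyI[of k])
          fix i assume "k \<le> i"
          then have "norm x < real i" using k by linarith
          then show "indicator (B \<inter> ball 0 (real i)) x = (indicator A x :: real)"
            using x B by (auto simp: indicator_def)
        qed
      qed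
    qed
  qed
next
  fix v :: "'a \<Rightarrow> real" and c :: real
  assume c: "0 \<le> c" and v: "v \<in> borel_measurable \<sigma>"
    and IH: "Lp_mass \<sigma> p v < \<infinity> \<longrightarrow> approximable p v"
  show "Lp_mass \<sigma> p (\<lambda>x. c * v x) < \<infinity> \<longrightarrow> approximable p (\<lambda>x. c * v x)"
  proof
    assume fin: "Lp_mass \<sigma> p (\<lambda>x. c * v x) < \<infinity>"
    show "approximable p (\<lambda>x. c * v x)"
    proof (cases "c = 0")
      case True
      then show ?thesis unfolding approximable_def
        by (intro allI impI exI[of _ "\<lambda>_. 0"]) (auto simp: test_function_0)
    next
      case False
      have "Lp_mass \<sigma> p v = (\<integral>\<^sup>+x. ennreal ((1 / c) powr p) * ennreal (\<bar>c * v x\<bar> powr p) \<partial>\<sigma>)"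
        using c False by (intro nn_integral_cong) (simp add: ennreal_mult[symmetric] powr_mult[symmetric] abs_mult)
      also have "\<dots> = ennreal ((1 / c) powr p) * Lp_mass \<sigma> p (\<lambda>x. c * v x)"
        by (rule nn_integral_cmult) (use v in measurable)
      also have "\<dots> < \<infinity>" using fin by (simp add: ennreal_mult_less_top)
      finally show ?thesis using IH approximable_cmult[OF v] by blast
    qed
  qed
next
  fix v w :: "'a \<Rightarrow> real"
  assume v: "v \<in> borel_measurable \<sigma>" "\<And>x. 0 \<le> v x" and w: "w \<in> borel_measurable \<sigma>" "\<And>x. 0 \<le> w x"
    and IH: "Lp_mass \<sigma> p v < \<infinity> \<longrightarrow> approximable p v"
      "Lp_mass \<sigma> p w < \<infinity> \<longrightarrow> approximable p w"
  show "Lp_mass \<sigma> p (\<lambda>x. w x + v x) < \<infinity> \<longrightarrow> approximable p (\<lambda>x. w x + v x)"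
  proof
    assume fin: "Lp_mass \<sigma> p (\<lambda>x. w x + v x) < \<infinity>"
    have "\<bar>w x\<bar> powr p \<le> \<bar>w x + v x\<bar> powr p" "\<bar>v x\<bar> powr p \<le> \<bar>w x + v x\<bar> powr p" for x
      using p v(2)[of x] w(2)[of x] by (auto intro!: powr_mono2)
    then have "Lp_mass \<sigma> p w < \<infinity>" "Lp_mass \<sigma> p v < \<infinity>"
      by (intro le_less_trans[OF nn_integral_mono fin] ennreal_leI; simp)+
    then show "approximable p (\<lambda>x. w x + v x)"
      using IH p by (intro approximable_add w v) auto
  qed
next
  fix U :: "nat \<Rightarrow> 'a \<Rightarrow> real"
  assume U: "\<And>i. U i \<in> borel_measurable \<sigma>" "\<And>i x. 0 \<le> U i x" "incseq U"
    and IH: "\<And>i. Lp_mass \<sigma> p (\<lambda>x. U i x) < \<infinity> \<longrightarrow> approximable p (U i)"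
    and lim: "\<And>x. x \<in> space \<sigma> \<Longrightarrow> (\<lambda>i. U i x) \<longlonglongrightarrow> u x"
  have le: "U i x \<le> u x" if "x \<in> space \<sigma>" for i x
    using incseq_le[OF _ lim[OF that]] U(3) by (auto simp: incseq_def le_fun_def)
  show "Lp_mass \<sigma> p u < \<infinity> \<longrightarrow> approximable p u"
  proof
    assume fin: "Lp_mass \<sigma> p u < \<infinity>"
    have "Lp_mass \<sigma> p (\<lambda>x. U i x) < \<infinity>" for i
    proof (rule le_less_trans[OF nn_integral_mono fin])
      fix x assume "x \<in> space \<sigma>"
      then have "U i x \<le> u x" by (rule le)
      then show "ennreal (\<bar>U i x\<bar> powr p) \<le> ennreal (\<bar>u x\<bar> powr p)"
        using U(2)[of i x] p by (intro ennreal_leI powr_mono2) auto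
    qed
    then have "approximable p (U i)" for i using IH by blast
    then show "approximable p u"
      using U le lim by (intro approximable_seq[OF p u(1) U(1) fin]) auto
  qed
qed

lemma approximable_Lp:
  assumes p: "0 < p" and sets: "sets \<sigma> = (\<lambda>B. B \<inter> space \<sigma>) ` sets borel"
    and f [measurable]: "f \<in> borel_measurable \<sigma>" and fin: "Lp_mass \<sigma> p f < \<infinity>"
  shows "approximable p f"
proof -
  have "approximable p (\<lambda>x. max 0 (f x))"
  proof (rule approximable_nonneg[OF p sets, THEN mp])
    show "Lp_mass \<sigma> p (\<lambda>x. max 0 (f x)) < \<infinity>"
      by (rule le_less_trans[OF nn_integral_mono fin], intro ennreal_leI powr_mono2) (use p in auto)
  qed auto
  moreover have "approximable p (\<lambda>x. max 0 (- f x))"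
  proof (rule approximable_nonneg[OF p sets, THEN mp])
    show "Lp_mass \<sigma> p (\<lambda>x. max 0 (- f x)) < \<infinity>"
      by (rule le_less_trans[OF nn_integral_mono fin], intro ennreal_leI powr_mono2) (use p in auto)
  qed auto
  ultimately have "approximable p (\<lambda>x. max 0 (f x) + (- 1) * max 0 (- f x))"
    using p by (intro approximable_add approximable_cmult) auto
  moreover have "(\<lambda>x. max 0 (f x) + (- 1) * max 0 (- f x)) = f" by (auto simp: fun_eq_iff max_def)
  ultimately show ?thesis by simp
qed

end

section \<open>Boundary layers and the area integral\<close>

text \<open>
  The difference quotient in the direction of the gradient \<open>G\<close> tends to \<open>G \<bullet> G\<close> and is at most
  \<open>L * norm G\<close>. The bound compares \<open>f\<close> with its value at \<open>x\<close> alone, as this is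
  what one gets for a product of Lipschitz functions, with a constant depending on \<open>x\<close>.
\<close>

lemma norm_gradient_le:
  fixes f :: "'a::euclidean_space \<Rightarrow> real"
  assumes f: "f differentiable at x" and L: "0 \<le> L" "\<And>y. \<bar>f y - f x\<bar> \<le> L * dist x y"
  shows "norm (gradient f x) \<le> L"
proof (cases "gradient f x = 0")
  case False
  define G where "G = gradient f x"
  have "(f has_derivative (\<lambda>h. h \<bullet> G)) (at x)"
    using GDERIV_gradient[OF f] by (simp add: gderiv_def G_def)
  moreover have "((\<lambda>t::real. x + t *\<^sub>R G) has_derivative (\<lambda>t. t *\<^sub>R G)) (at 0)"
    by (auto intro!: derivative_eq_intros)
  ultimately have "((\<lambda>t::real. f (x + t *\<^sub>R G)) has_derivative (\<lambda>t. (t *\<^sub>R G) \<bullet> G)) (at 0)"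
    using has_derivative_compose[of "\<lambda>t::real. x + t *\<^sub>R G" "\<lambda>t. t *\<^sub>R G" 0 UNIV f "\<lambda>h. h \<bullet> G"] by simp
  then have "((\<lambda>t::real. f (x + t *\<^sub>R G)) has_field_derivative G \<bullet> G) (at 0)"
    unfolding has_field_derivative_def by (rule has_derivative_eq_rhs) (simp add: fun_eq_iff)
  then have "((\<lambda>t. (f (x + t *\<^sub>R G) - f x) / t) \<longlongrightarrow> G \<bullet> G) (at 0)"
    by (simp add: DERIV_def)
  moreover have "(f (x + t *\<^sub>R G) - f x) / t \<le> L * norm G" if "t \<noteq> 0" for t
  proof -
    have "(f (x + t *\<^sub>R G) - f x) / t \<le> \<bar>f (x + t *\<^sub>R G) - f x\<bar> / \<bar>t\<bar>"
      by (metis abs_divide abs_ge_self)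
    also have "\<dots> \<le> L * dist x (x + t *\<^sub>R G) / \<bar>t\<bar>"
      by (intro divide_right_mono L) simp
    also have "\<dots> = L * norm G" using that by (simp add: dist_norm)
    finally show ?thesis .
  qed
  ultimately have "G \<bullet> G \<le> L * norm G"
    by (intro tendsto_upperbound[of _ "G \<bullet> G" "at 0"]) (auto simp: eventually_at_filter)
  then have "norm G * norm G \<le> L * norm G" by (simp add: dot_square_norm power2_eq_square)
  then show ?thesis using False by (simp add: G_def)
qed (use L in simp)

lemma gradient_eq_0_if_locally_0:
  assumes "open U" "x \<in> U" "\<And>y. y \<in> U \<Longrightarrow> f y = 0"
  shows "gradient f x = 0"
proof -
  have "frechet_derivative f (at x) = frechet_derivative (\<lambda>_. 0) (at x)"
    by (rule frechet_derivative_eq_on_open[OF assms(1,2)]) (use assms in auto)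
  then show ?thesis by (simp add: gradient_def)
qed

text \<open>
  A piecewise linear function of the distance, equal to \<open>1\<close> up to distance \<open>\<epsilon> / 3\<close> and to \<open>0\<close> from
  \<open>2 * \<epsilon> / 3\<close> on, is mollified at scale \<open>\<epsilon> / 8\<close>. Only its Lipschitz constant matters, and that is
  not affected by the mollification.
\<close>

lemma smooth_cutoff:
  fixes S :: "'a::euclidean_space set"
  assumes e: "0 < \<epsilon>"
  obtains \<phi> where "smooth_on UNIV \<phi>" "\<And>x. 0 \<le> \<phi> x \<and> \<phi> x \<le> 1" "\<And>x. infdist x S < \<epsilon> / 8 \<Longrightarrow> \<phi> x = 1"
    "\<And>x. \<epsilon> \<le> infdist x S \<Longrightarrow> \<phi> x = 0" "\<And>x y. \<bar>\<phi> x - \<phi> y\<bar> \<le> 3 / \<epsilon> * dist x y"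
proof -
  define v where "v x = max 0 (min 1 (2 - 3 / \<epsilon> * infdist x S))" for x :: 'a
  have c: "continuous_on UNIV v" unfolding v_def by (intro continuous_intros)
  have tri: "\<bar>infdist x S - infdist y S\<bar> \<le> dist x y" for x y
    using infdist_triangle[of x S y] infdist_triangle[of y S x] by (simp add: dist_commute)
  have L: "\<bar>v x - v y\<bar> \<le> 3 / \<epsilon> * dist x y" for x y
  proof -
    have "\<bar>v x - v y\<bar> \<le> \<bar>3 / \<epsilon> * infdist x S - 3 / \<epsilon> * infdist y S\<bar>"
      by (auto simp: v_def)
    also have "\<dots> = 3 / \<epsilon> * \<bar>infdist x S - infdist y S\<bar>"
      using e by (simp only: right_diff_distrib[symmetric] abs_mult) simp
    also have "\<dots> \<le> 3 / \<epsilon> * dist x y" using e by (intro mult_left_mono tri) simp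
    finally show ?thesis .
  qed
  have t: "0 < \<epsilon> / 8" using e by simp
  show ?thesis
  proof (rule that[of "mollify (\<epsilon> / 8) v"])
    show "smooth_on UNIV (mollify (\<epsilon> / 8) v)" by (rule smooth_on_mollify[OF t c])
    show "0 \<le> mollify (\<epsilon> / 8) v x \<and> mollify (\<epsilon> / 8) v x \<le> 1" for x
      by (intro conjI mollify_bounds[OF t c]) (auto simp: v_def)
    show "mollify (\<epsilon> / 8) v x = 1" if "infdist x S < \<epsilon> / 8" for x
    proof (rule mollify_eq_const[OF t c])
      fix y assume "dist x y < \<epsilon> / 8"
      then have "infdist y S \<le> \<epsilon> / 4" using that tri[of x y] by linarith
      then have "3 / \<epsilon> * infdist y S \<le> 1" using e by (simp add: field_simps)
      then show "v y = 1" by (simp add: v_def)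
    qed
    show "mollify (\<epsilon> / 8) v x = 0" if "\<epsilon> \<le> infdist x S" for x
    proof (rule mollify_eq_const[OF t c])
      fix y assume "dist x y < \<epsilon> / 8"
      then have "7 / 8 * \<epsilon> \<le> infdist y S" using that tri[of x y] by linarith
      then have "2 \<le> 3 / \<epsilon> * infdist y S" using e by (simp add: field_simps)
      then show "v y = 0" by (simp add: v_def)
    qed
    show "\<bar>mollify (\<epsilon> / 8) v x - mollify (\<epsilon> / 8) v y\<bar> \<le> 3 / \<epsilon> * dist x y" for x y
      by (rule mollify_lipschitz[OF t L])
  qed
qed

text \<open>
  The building block \<open>u = \<phi> * g\<close>. For \<open>x\<close> in the cone over \<open>\<eta>\<close> and in the layer, the values
  \<open>g x\<close> and \<open>g \<eta>\<close> differ by at most \<open>L * A * \<epsilon> \<le> \<mu>\<close>. The gradient is at most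
  \<open>3 / \<epsilon> * \<bar>g x\<bar> + L\<close>, and the second summand is absorbed because \<open>L \<le> \<mu> / \<epsilon>\<close>. The term with the
  indicator absorbs the difference at all vertices \<open>\<eta>\<close> whose cone meets the support of \<open>g\<close> inside the layer.
\<close>

lemma boundary_layer_extension:
  fixes S :: "'a::euclidean_space set" and g :: "'a \<Rightarrow> real"
  assumes g: "smooth_on UNIV g" and L: "0 < L" "\<And>x y. \<bar>g x - g y\<bar> \<le> L * dist x y"
    and R: "\<And>x. R \<le> norm x \<Longrightarrow> g x = 0"
    and e: "0 < \<epsilon>" "\<epsilon> \<le> 1" and A: "1 \<le> A" and l: "L * A * \<epsilon> \<le> \<mu>"
  defines "h \<equiv> \<lambda>\<eta>. \<bar>g \<eta>\<bar> + \<mu> * indicator (ball 0 (R + A + 1)) \<eta>"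
  obtains u where "smooth_on UNIV u" "\<And>\<eta>. \<eta> \<in> S \<Longrightarrow> u \<eta> = g \<eta>"
    "\<And>x. \<epsilon> \<le> infdist x S \<Longrightarrow> u x = 0" "\<And>x. \<epsilon> < infdist x S \<Longrightarrow> gradient u x = 0"
    "\<And>x \<eta>. \<eta> \<in> S \<Longrightarrow> dist x \<eta> < A * infdist x S \<Longrightarrow> \<bar>u x\<bar> \<le> h \<eta>"
    "\<And>x \<eta>. \<eta> \<in> S \<Longrightarrow> dist x \<eta> < A * infdist x S \<Longrightarrow> norm (gradient u x) \<le> 4 / \<epsilon> * h \<eta>"
proof -
  obtain \<phi> where \<phi>: "smooth_on UNIV \<phi>" "\<And>x. 0 \<le> \<phi> x \<and> \<phi> x \<le> 1" "\<And>x. infdist x S < \<epsilon> / 8 \<Longrightarrow> \<phi> x = 1"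
      "\<And>x. \<epsilon> \<le> infdist x S \<Longrightarrow> \<phi> x = 0" "\<And>x y. \<bar>\<phi> x - \<phi> y\<bar> \<le> 3 / \<epsilon> * dist x y"
    using smooth_cutoff[OF e(1), of S] by metis
  define u where "u x = \<phi> x * g x" for x
  have su: "smooth_on UNIV u"
    unfolding u_def by (rule smooth_on_mult[OF open_UNIV \<phi>(1) g])
  have l0: "0 < \<mu>" using L(1) e A by (intro less_le_trans[OF _ l]) auto
  have h0: "0 \<le> h \<eta>" for \<eta> using l0 by (auto simp: h_def indicator_def)
  have grad0: "gradient u x = 0" if "\<epsilon> < infdist x S" for x
  proof (rule gradient_eq_0_if_locally_0[of "{y. \<epsilon> < infdist y S}"])
    show "open {y. \<epsilon> < infdist y S}" by (intro open_Collect_less continuous_intros)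
  qed (use that \<phi>(4) in \<open>auto simp: u_def\<close>)
  have grad_out: "gradient u x = 0" if "R < norm x" for x
  proof (rule gradient_eq_0_if_locally_0[of "{y. R < norm y}"])
    show "open {y::'a. R < norm y}" by (intro open_Collect_less continuous_intros)
  qed (use that R in \<open>auto simp: u_def\<close>)
  have near: "\<bar>g x\<bar> + L * \<epsilon> \<le> \<bar>g \<eta>\<bar> + 2 * \<mu> \<and> \<bar>g x\<bar> \<le> \<bar>g \<eta>\<bar> + \<mu> \<and> L * \<epsilon> \<le> \<mu> \<and> norm \<eta> < norm x + A + 1"
    if "dist x \<eta> < A * infdist x S" "infdist x S \<le> \<epsilon>" for x \<eta>
  proof -
    have d: "dist x \<eta> \<le> A * \<epsilon>"
    proof -
      have "A * infdist x S \<le> A * \<epsilon>" using that A by (intro mult_left_mono) auto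
      then show ?thesis using that by linarith
    qed
    have "\<bar>g x - g \<eta>\<bar> \<le> L * (A * \<epsilon>)"
      using L(2)[of x \<eta>] mult_left_mono[OF d, of L] L(1) by linarith
    then have 1: "\<bar>g x\<bar> \<le> \<bar>g \<eta>\<bar> + \<mu>" using l by (simp add: mult.assoc)
    have "L * \<epsilon> * 1 \<le> L * \<epsilon> * A" using L(1) e A by (intro mult_left_mono) auto
    then have 2: "L * \<epsilon> \<le> \<mu>" using l by (simp add: mult_ac)
    have "A * \<epsilon> \<le> A" using A e by (simp add: mult_left_le)
    then have "norm \<eta> < norm x + A + 1"
      using d norm_triangle_ineq2[of \<eta> x] by (simp add: dist_norm norm_minus_commute)
    with 1 2 show ?thesis by simp
  qed
  show ?thesis
  proof (rule that[of u])
    show "u \<eta> = g \<eta>" if "\<eta> \<in> S" for \<eta>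
      using that e \<phi>(3)[of \<eta>] by (simp add: u_def)
    show "u x = 0" if "\<epsilon> \<le> infdist x S" for x using \<phi>(4)[OF that] by (simp add: u_def)
    show "gradient u x = 0" if "\<epsilon> < infdist x S" for x by (rule grad0[OF that])
    fix x \<eta> assume \<eta>: "\<eta> \<in> S" and cone: "dist x \<eta> < A * infdist x S"
    show "\<bar>u x\<bar> \<le> h \<eta>"
    proof (cases "infdist x S < \<epsilon> \<and> norm x < R")
      case True
      then have "\<bar>g x\<bar> \<le> h \<eta>" using near[OF cone] by (auto simp: h_def)
      moreover have "\<bar>u x\<bar> \<le> 1 * \<bar>g x\<bar>"
        unfolding u_def abs_mult using \<phi>(2)[of x] by (intro mult_right_mono) auto
      ultimately show ?thesis by simp
    next
      case False
      then have "u x = 0" using \<phi>(4)[of x] R[of x] by (auto simp: u_def)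
      then show ?thesis using h0 by simp
    qed
    show "norm (gradient u x) \<le> 4 / \<epsilon> * h \<eta>"
    proof (cases "infdist x S \<le> \<epsilon> \<and> norm x \<le> R")
      case True
      have "norm (gradient u x) \<le> 3 / \<epsilon> * \<bar>g x\<bar> + L"
      proof (rule norm_gradient_le)
        show "u differentiable at x" using smooth_on_imp_differentiable[OF su] by simp
        show "0 \<le> 3 / \<epsilon> * \<bar>g x\<bar> + L" using e L by (intro add_nonneg_nonneg mult_nonneg_nonneg) auto
        fix y
        have "u y - u x = (\<phi> y - \<phi> x) * g x + \<phi> y * (g y - g x)" by (simp add: u_def algebra_simps)
        then have "\<bar>u y - u x\<bar> \<le> \<bar>\<phi> y - \<phi> x\<bar> * \<bar>g x\<bar> + \<bar>\<phi> y\<bar> * \<bar>g y - g x\<bar>"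
          by (metis abs_mult abs_triangle_ineq)
        also have "\<dots> \<le> (3 / \<epsilon> * dist y x) * \<bar>g x\<bar> + 1 * (L * dist y x)"
          using \<phi>(2)[of y] L e by (intro add_mono mult_mono \<phi>(5) L(2)) auto
        also have "\<dots> = (3 / \<epsilon> * \<bar>g x\<bar> + L) * dist x y" by (simp add: algebra_simps dist_commute)
        finally show "\<bar>u y - u x\<bar> \<le> (3 / \<epsilon> * \<bar>g x\<bar> + L) * dist x y" .
      qed
      also have "\<dots> = (3 * \<bar>g x\<bar> + L * \<epsilon>) / \<epsilon>" using e by (simp add: field_simps)
      also have "\<dots> \<le> (4 * h \<eta>) / \<epsilon>"
        using near[OF cone] True e by (intro divide_right_mono) (auto simp: h_def)
      finally show ?thesis by simp
    next
      case False
      then have "gradient u x = 0" using grad0[of x] grad_out[of x] by auto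
      then show ?thesis using h0[of \<eta>] e by simp
    qed
  qed (rule su)
qed

text \<open>
  Lower regularity is required for radii up to some \<open>d0\<close> only; the extensions are supported
  so close to the boundary that larger radii never occur.
\<close>

locale ahlfors_measure = upper_regular_measure \<sigma> s C1
  for \<sigma> :: "'a::euclidean_space measure" and s C1 :: real +
  fixes n :: nat and C0 d0 :: real
  assumes dim: "DIM('a) = n + 1"
    and closed_space: "closed (space \<sigma>)" and space_ne: "space \<sigma> \<noteq> {}"
    and C0_pos: "0 < C0" and d0_pos: "0 < d0"
    and emeasure_ball_ge: "x \<in> space \<sigma> \<Longrightarrow> 0 < r \<Longrightarrow> r \<le> d0 \<Longrightarrow>
      ennreal (r powr s / C0) \<le> emeasure \<sigma> (ball x r \<inter> space \<sigma>)"
begin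

abbreviation bd :: "'a \<Rightarrow> real" where "bd x \<equiv> infdist x (space \<sigma>)"

text \<open>
  A point \<open>x\<close> at distance \<open>d\<close> from the boundary satisfies \<open>d powr s \<le> C0 * \<sigma> (ball x (2 * d))\<close>, by lower
  regularity at a nearest boundary point. Inserting this and exchanging the integrals by Fubini turns the integral
  over a ball centred at \<open>\<xi>\<close> into the boundary integral of \<open>A\<close> over the ball with three times the radius.
\<close>

lemma carleson_average_le_maxfun:
  assumes F [measurable]: "F \<in> borel_measurable borel"
    and supp: "\<And>x. F x \<noteq> 0 \<Longrightarrow> 0 < bd x \<and> bd x \<le> d0"
    and area: "\<And>\<eta>. \<eta> \<in> space \<sigma> \<Longrightarrow>
      (\<integral>\<^sup>+x. F x * ennreal (1 / bd x ^ n) * indicator {x. dist x \<eta> < 2 * bd x} x \<partial>lborel) \<le> A \<eta>"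
    and A [measurable]: "A \<in> borel_measurable \<sigma>"
    and \<xi>: "\<xi> \<in> space \<sigma>" and r: "0 < r"
  shows "ennreal (1 / r powr s) * (\<integral>\<^sup>+x\<in>ball \<xi> r. F x * ennreal (bd x powr (s - real n)) \<partial>lborel)
    \<le> ennreal (C0 * 3 powr s) * maxfun \<sigma> s A \<xi>"
proof -
  interpret P: pair_sigma_finite "lborel :: 'a measure" \<sigma> ..
  let ?f = "\<lambda>x \<eta>. F x * ennreal (1 / bd x ^ n) * indicator {x. dist x \<eta> < 2 * bd x} x"
  have pt: "F x * ennreal (bd x powr (s - real n)) * indicator (ball \<xi> r) x
      \<le> (\<integral>\<^sup>+\<eta>. ennreal C0 * (?f x \<eta> * indicator (ball \<xi> (3 * r)) \<eta>) \<partial>\<sigma>)" for x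
  proof (cases "F x \<noteq> 0 \<and> x \<in> ball \<xi> r")
    case True
    define d where "d = bd x"
    have d: "0 < d" "d \<le> d0" using supp[of x] True by (auto simp: d_def)
    have dr: "d < r" using infdist_le[OF \<xi>, of x] True by (simp add: d_def dist_commute)
    obtain z where z: "z \<in> space \<sigma>" "d = dist x z"
      using infdist_attains_inf[OF closed_space space_ne] unfolding d_def by metis
    have sub: "ball z d \<inter> space \<sigma> \<subseteq> {\<eta> \<in> space \<sigma>. dist x \<eta> < 2 * d \<and> \<eta> \<in> ball \<xi> (3 * r)}"
    proof
      fix \<eta> assume \<eta>: "\<eta> \<in> ball z d \<inter> space \<sigma>"
      have "dist x \<eta> < 2 * d" using \<eta> z dist_triangle[of x \<eta> z] by simp
      moreover have "dist \<xi> \<eta> < 3 * r"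
        using calculation dr True dist_triangle[of \<xi> \<eta> x] by simp
      ultimately show "\<eta> \<in> {\<eta> \<in> space \<sigma>. dist x \<eta> < 2 * d \<and> \<eta> \<in> ball \<xi> (3 * r)}" using \<eta> by simp
    qed
    have "ennreal (d powr s / C0) \<le> emeasure \<sigma> (ball z d \<inter> space \<sigma>)"
      by (rule emeasure_ball_ge[OF z(1) d])
    also have "\<dots> \<le> emeasure \<sigma> {\<eta> \<in> space \<sigma>. dist x \<eta> < 2 * d \<and> \<eta> \<in> ball \<xi> (3 * r)}"
      by (rule emeasure_mono[OF sub]) measurable
    finally have "ennreal C0 * ennreal (d powr s / C0) \<le> ennreal C0 * emeasure \<sigma> {\<eta> \<in> space \<sigma>. dist x \<eta> < 2 * d \<and> \<eta> \<in> ball \<xi> (3 * r)}"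
      by (rule mult_left_mono) simp
    then have lower: "ennreal (d powr s) \<le> ennreal C0 * emeasure \<sigma> {\<eta> \<in> space \<sigma>. dist x \<eta> < 2 * d \<and> \<eta> \<in> ball \<xi> (3 * r)}"
      using C0_pos by (simp add: ennreal_mult[symmetric])
    have "d powr (s - real n) = 1 / d ^ n * d powr s"
      using d by (simp add: powr_diff powr_realpow)
    then have "ennreal (d powr (s - real n)) = ennreal (1 / d ^ n) * ennreal (d powr s)"
      using d by (subst ennreal_mult[symmetric]) auto
    then have "F x * ennreal (d powr (s - real n)) = F x * ennreal (1 / d ^ n) * ennreal (d powr s)"
      by (simp only: mult.assoc)
    also have "\<dots> \<le> F x * ennreal (1 / d ^ n) * (ennreal C0 * emeasure \<sigma> {\<eta> \<in> space \<sigma>. dist x \<eta> < 2 * d \<and> \<eta> \<in> ball \<xi> (3 * r)})"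
      by (rule mult_left_mono[OF lower]) simp
    also have "\<dots> = (\<integral>\<^sup>+\<eta>. (F x * ennreal (1 / d ^ n) * ennreal C0) * indicator {\<eta> \<in> space \<sigma>. dist x \<eta> < 2 * d \<and> \<eta> \<in> ball \<xi> (3 * r)} \<eta> \<partial>\<sigma>)"
      by (subst nn_integral_cmult_indicator) (measurable, simp add: mult.assoc)
    also have "\<dots> = (\<integral>\<^sup>+\<eta>. ennreal C0 * (?f x \<eta> * indicator (ball \<xi> (3 * r)) \<eta>) \<partial>\<sigma>)"
      by (intro nn_integral_cong) (auto simp: indicator_def d_def mult_ac)
    finally show ?thesis using True by (simp add: d_def)
  qed auto
  have "(\<integral>\<^sup>+x\<in>ball \<xi> r. F x * ennreal (bd x powr (s - real n)) \<partial>lborel)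
      \<le> (\<integral>\<^sup>+x. \<integral>\<^sup>+\<eta>. ennreal C0 * (?f x \<eta> * indicator (ball \<xi> (3 * r)) \<eta>) \<partial>\<sigma> \<partial>lborel)"
    by (rule nn_integral_mono) (rule pt)
  also have "\<dots> = (\<integral>\<^sup>+\<eta>. \<integral>\<^sup>+x. ennreal C0 * (?f x \<eta> * indicator (ball \<xi> (3 * r)) \<eta>) \<partial>lborel \<partial>\<sigma>)"
    by (rule P.Fubini'[symmetric]) measurable
  also have "\<dots> \<le> (\<integral>\<^sup>+\<eta>. ennreal C0 * (A \<eta> * indicator (ball \<xi> (3 * r)) \<eta>) \<partial>\<sigma>)"
  proof (rule nn_integral_mono)
    fix \<eta> assume \<eta>: "\<eta> \<in> space \<sigma>"
    have "(\<integral>\<^sup>+x. ennreal C0 * (?f x \<eta> * indicator (ball \<xi> (3 * r)) \<eta>) \<partial>lborel)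
        = ennreal C0 * ((\<integral>\<^sup>+x. ?f x \<eta> \<partial>lborel) * indicator (ball \<xi> (3 * r)) \<eta>)"
    proof -
      \<comment> \<open>Measurability now refers to Lebesgue measure, not to \<open>\<sigma>\<close>.\<close>
      note measurable_id [measurable del]
      have [measurable]: "(\<lambda>x. ?f x \<eta>) \<in> borel_measurable lborel" by measurable
      show ?thesis
      proof (cases "\<eta> \<in> ball \<xi> (3 * r)")
        case True
        have "(\<integral>\<^sup>+x. ennreal C0 * ?f x \<eta> \<partial>lborel) = ennreal C0 * (\<integral>\<^sup>+x. ?f x \<eta> \<partial>lborel)"
          by (rule nn_integral_cmult) measurable
        then show ?thesis using True by simp
      qed simp
    qed
    also have "\<dots> \<le> ennreal C0 * (A \<eta> * indicator (ball \<xi> (3 * r)) \<eta>)"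
      by (intro mult_left_mono mult_right_mono area[OF \<eta>]) auto
    finally show "(\<integral>\<^sup>+x. ennreal C0 * (?f x \<eta> * indicator (ball \<xi> (3 * r)) \<eta>) \<partial>lborel)
        \<le> ennreal C0 * (A \<eta> * indicator (ball \<xi> (3 * r)) \<eta>)" .
  qed
  also have "\<dots> \<le> ennreal C0 * (ennreal ((3 * r) powr s) * maxfun \<sigma> s A \<xi>)"
  proof -
    have "(\<integral>\<^sup>+\<eta>. ennreal C0 * (A \<eta> * indicator (ball \<xi> (3 * r)) \<eta>) \<partial>\<sigma>)
        = ennreal C0 * (\<integral>\<^sup>+\<eta>\<in>ball \<xi> (3 * r). A \<eta> \<partial>\<sigma>)"
      by (rule nn_integral_cmult) measurable
    also have "\<dots> \<le> ennreal C0 * (ennreal ((3 * r) powr s) * maxfun \<sigma> s A \<xi>)"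
      using r by (intro mult_left_mono ball_average_le_maxfun) auto
    finally show ?thesis .
  qed
  finally have "ennreal (1 / r powr s) * (\<integral>\<^sup>+x\<in>ball \<xi> r. F x * ennreal (bd x powr (s - real n)) \<partial>lborel)
      \<le> ennreal (1 / r powr s) * (ennreal C0 * (ennreal ((3 * r) powr s) * maxfun \<sigma> s A \<xi>))"
    by (rule mult_left_mono) simp
  also have "\<dots> = ennreal (C0 * 3 powr s) * maxfun \<sigma> s A \<xi>"
  proof -
    have "ennreal (1 / r powr s) * ennreal C0 * ennreal ((3 * r) powr s) = ennreal (C0 * 3 powr s)"
      using r C0_pos by (simp add: ennreal_mult[symmetric] powr_mult)
    then show ?thesis by (simp only: mult.assoc[symmetric])
  qed
  finally show ?thesis .
qed

text \<open>
  In the cone over \<open>\<eta>\<close> the distance to the boundary is comparable to the distance to \<open>\<eta>\<close>, so this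
  is the integral of the kernel \<open>1 / dist \<eta> x ^ n\<close> over a ball of radius \<open>2 * \<rho>\<close>.
\<close>

lemma area_kernel_le:
  assumes \<eta>: "\<eta> \<in> space \<sigma>" and \<rho>: "0 < \<rho>"
  shows "(\<integral>\<^sup>+x. indicator {x. 0 < bd x \<and> bd x \<le> \<rho>} x * ennreal (1 / bd x ^ n) * indicator {x. dist x \<eta> < 2 * bd x} x \<partial>lborel)
    \<le> ennreal (2 ^ n * (2 ^ (n + 1) * unit_ball_vol (real (n + 1)) * (2 * \<rho>)))"
proof -
  have "indicator {x. 0 < bd x \<and> bd x \<le> \<rho>} x * ennreal (1 / bd x ^ n) * indicator {x. dist x \<eta> < 2 * bd x} x
      \<le> ennreal (2 ^ n) * (ennreal (1 / dist \<eta> x ^ n) * indicator (ball \<eta> (2 * \<rho>)) x)" for x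
  proof (cases "0 < bd x \<and> bd x \<le> \<rho> \<and> dist x \<eta> < 2 * bd x")
    case True
    have "bd x \<le> dist \<eta> x" using infdist_le[OF \<eta>, of x] by (simp add: dist_commute)
    then have pos: "0 < dist \<eta> x" using True by (blast intro: less_le_trans)
    have "1 / bd x \<le> 2 / dist \<eta> x"
      using True pos by (simp add: field_simps dist_commute)
    then have "(1 / bd x) ^ n \<le> (2 / dist \<eta> x) ^ n" using True by (intro power_mono) auto
    then have "1 / bd x ^ n \<le> 2 ^ n * (1 / dist \<eta> x ^ n)" by (simp add: power_divide)
    then have "ennreal (1 / bd x ^ n) \<le> ennreal (2 ^ n) * ennreal (1 / dist \<eta> x ^ n)"
      using pos by (subst ennreal_mult[symmetric]) (auto intro: ennreal_leI)
    then show ?thesis using True by (simp add: dist_commute)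
  qed auto
  then have "(\<integral>\<^sup>+x. indicator {x. 0 < bd x \<and> bd x \<le> \<rho>} x * ennreal (1 / bd x ^ n) * indicator {x. dist x \<eta> < 2 * bd x} x \<partial>lborel)
      \<le> (\<integral>\<^sup>+x. ennreal (2 ^ n) * (ennreal (1 / dist \<eta> x ^ n) * indicator (ball \<eta> (2 * \<rho>)) x) \<partial>lborel)"
    by (rule nn_integral_mono)
  also have "\<dots> = ennreal (2 ^ n) * (\<integral>\<^sup>+x\<in>ball \<eta> (2 * \<rho>). ennreal (1 / dist \<eta> x ^ n) \<partial>lborel)"
  proof (rule nn_integral_cmult, rule borel_measurable_times_ennreal)
    note measurable_id [measurable del]
    show "(\<lambda>x. ennreal (1 / dist \<eta> x ^ n)) \<in> borel_measurable lborel"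
      by (simp, measurable)
    show "indicator (ball \<eta> (2 * \<rho>)) \<in> borel_measurable lborel"
      by (rule borel_measurable_indicator) simp
  qed
  also have "\<dots> \<le> ennreal (2 ^ n) * ennreal (2 ^ (n + 1) * unit_ball_vol (real (n + 1)) * (2 * \<rho>))"
    using \<rho> by (intro mult_left_mono nn_integral_dist_powr_le[OF dim]) auto
  also have "\<dots> = ennreal (2 ^ n * (2 ^ (n + 1) * unit_ball_vol (real (n + 1)) * (2 * \<rho>)))"
    by (rule ennreal_mult[symmetric]) (use \<rho> in auto)
  finally show ?thesis .
qed

end

section \<open>Series of boundary layers\<close>

lemma gradient_sum:
  assumes "\<And>i. i \<in> I \<Longrightarrow> f i differentiable at x"
  shows "gradient (\<lambda>x. \<Sum>i\<in>I. f i x) x = (\<Sum>i\<in>I. gradient (f i) x)"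
proof -
  have "((\<lambda>x. \<Sum>i\<in>I. f i x) has_derivative (\<lambda>h. \<Sum>i\<in>I. frechet_derivative (f i) (at x) h)) (at x)"
    using assms by (intro has_derivative_sum) (auto simp: frechet_derivative_works)
  then have "frechet_derivative (\<lambda>x. \<Sum>i\<in>I. f i x) (at x) = (\<lambda>h. \<Sum>i\<in>I. frechet_derivative (f i) (at x) h)"
    by (rule frechet_derivative_at[symmetric])
  then show ?thesis
    unfolding gradient_def by (simp add: scaleR_sum_left) (rule sum.swap)
qed

text \<open>
  With \<open>S\<close> the supremum of \<open>2 ^ j * a j\<close> the sum is at most \<open>2 * S\<close>, and the power of a supremum is
  at most the sum of the powers. This replaces Minkowski's inequality for series with geometric decay.
\<close>

lemma ennreal_powr_suminf_le:
  fixes a :: "nat \<Rightarrow> ennreal"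
  assumes p: "0 < p"
  shows "ennreal_powr (\<Sum>j. a j) p \<le> ennreal (2 powr p) * (\<Sum>j. ennreal_powr (ennreal (2 ^ j) * a j) p)"
proof -
  define T where "T = (\<Sum>j. ennreal_powr (ennreal (2 ^ j) * a j) p)"
  define S where "S = ennreal_powr T (1 / p)"
  have term_le: "ennreal (2 ^ j) * a j \<le> S" for j
  proof -
    have "ennreal_powr (ennreal (2 ^ j) * a j) p \<le> T"
      using sum_le_suminf[of "\<lambda>j. ennreal_powr (ennreal (2 ^ j) * a j) p" "{j}"] by (simp add: T_def)
    then have "ennreal_powr (ennreal_powr (ennreal (2 ^ j) * a j) p) (1 / p) \<le> S"
      unfolding S_def using p by (intro ennreal_powr_mono) auto
    then show ?thesis using p by (simp add: ennreal_powr_powr)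
  qed
  have "(\<Sum>j. a j) \<le> (\<Sum>j. ennreal ((1 / 2) ^ j) * S)"
  proof (intro suminf_le allI)
    fix j
    have "a j = ennreal ((1 / 2) ^ j) * (ennreal (2 ^ j) * a j)"
      by (simp add: mult.assoc[symmetric] ennreal_mult[symmetric] power_mult_distrib[symmetric])
    also have "\<dots> \<le> ennreal ((1 / 2) ^ j) * S" by (intro mult_left_mono term_le) simp
    finally show "a j \<le> ennreal ((1 / 2) ^ j) * S" .
  qed auto
  also have "\<dots> = (\<Sum>j. ennreal ((1 / 2) ^ j)) * S" by simp
  also have "(\<Sum>j. ennreal ((1 / 2) ^ j)) = ennreal 2"
  proof (rule suminf_ennreal_eq)
    show "(\<lambda>j. (1 / 2 :: real) ^ j) sums 2" using geometric_sums[of "1 / 2 :: real"] by simp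
  qed simp
  finally have "ennreal_powr (\<Sum>j. a j) p \<le> ennreal_powr (ennreal 2 * S) p"
    using p by (intro ennreal_powr_mono) auto
  also have "\<dots> = ennreal (2 powr p) * ennreal_powr S p" by (rule ennreal_powr_cmult) simp
  also have "ennreal_powr S p = T" using p by (simp add: S_def ennreal_powr_powr)
  finally show ?thesis by (simp add: T_def)
qed

text \<open>
  The superlevel sets are unions of the sets \<open>{x. dist x y < r x}\<close>, which are open.
\<close>

lemma borel_measurable_sup_ball:
  fixes w :: "'a::euclidean_space \<Rightarrow> ennreal"
  assumes "continuous_on UNIV r"
  shows "(\<lambda>x. SUP y\<in>ball x (r x). w y) \<in> borel_measurable borel"
proof (rule borel_measurableI_greater)
  fix t
  have "{x \<in> space borel. t < (SUP y\<in>ball x (r x). w y)} = (\<Union>y\<in>{y. t < w y}. {x. dist x y < r x})"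
    by (auto simp: less_SUP_iff)
  moreover have "open \<dots>"
    using assms by (intro open_UN ballI open_Collect_less continuous_intros) auto
  ultimately show "{x \<in> space borel. t < (SUP y\<in>ball x (r x). w y)} \<in> sets borel" by simp
qed

context ahlfors_measure
begin

text \<open>
  The constant in the bound of the area integral of the gradient by \<open>H\<close>: the factor \<open>8\<close> is \<open>4\<close> from the
  gradient bound of a layer times \<open>2\<close>, since a ball \<open>ball x (bd x / 4)\<close> can meet the layer of width \<open>\<epsilon>\<close>
  only if \<open>bd x \<le> 2 * \<epsilon>\<close>.
\<close>

definition area_const :: real where
  "area_const = 8 * (2 ^ n * (2 ^ (n + 1) * unit_ball_vol (real (n + 1)) * 2))"

lemma area_const_nonneg: "0 \<le> area_const"
  by (simp add: area_const_def)

lemma bd_lipschitz: "bd x \<le> bd y + dist x y"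
  by (rule infdist_triangle)

lemma bd_pos_iff: "0 < bd x \<longleftrightarrow> x \<notin> space \<sigma>"
  using in_closed_iff_infdist_zero[OF closed_space space_ne, of x] infdist_nonneg[of x "space \<sigma>"]
  by (auto simp: less_le)

text \<open>
  Away from the boundary only finitely many layers are present, because \<open>\<epsilon> j \<le> 1 / 2 ^ j\<close>; this gives
  smoothness, and turns sums of the bounds of the pieces into bounds of \<open>v\<close>. Aperture at least \<open>3\<close>
  is needed because a point \<open>y\<close> of \<open>ball x (bd x / 4)\<close> lies in the cone of aperture \<open>3\<close> when \<open>x\<close> lies in the
  one of aperture \<open>2\<close>. At a vertex where \<open>H\<close> is finite, the series converges uniformly in the cone, while
  each partial sum is continuous up to the vertex.
\<close>

lemma layer_series:
  fixes u g h :: "nat \<Rightarrow> 'a \<Rightarrow> real" and \<epsilon> :: "nat \<Rightarrow> real"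
  assumes \<epsilon>: "\<And>j. 0 < \<epsilon> j" "\<And>j. \<epsilon> j \<le> 1 / 2 ^ j" "\<And>j. \<epsilon> j \<le> d0 / 2"
    and A: "3 \<le> A"
    and smooth: "\<And>j. smooth_on UNIV (u j)"
    and u0: "\<forall>j x. \<epsilon> j \<le> bd x \<longrightarrow> u j x = 0"
    and du0: "\<forall>j x. \<epsilon> j < bd x \<longrightarrow> gradient (u j) x = 0"
    and trace: "\<forall>j. \<forall>\<eta>\<in>space \<sigma>. u j \<eta> = g j \<eta>"
    and u: "\<forall>j x. \<forall>\<eta>\<in>space \<sigma>. dist x \<eta> < A * bd x \<longrightarrow> \<bar>u j x\<bar> \<le> h j \<eta>"
    and du: "\<forall>j x. \<forall>\<eta>\<in>space \<sigma>. dist x \<eta> < A * bd x \<longrightarrow> norm (gradient (u j) x) \<le> 4 / \<epsilon> j * h j \<eta>"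
    and h [measurable]: "\<And>j. h j \<in> borel_measurable \<sigma>" and h0: "\<And>j \<eta>. 0 \<le> h j \<eta>"
  defines "v \<equiv> \<lambda>x. \<Sum>j. u j x" and "H \<equiv> \<lambda>\<eta>. \<Sum>j. ennreal (h j \<eta>)"
  shows layer_series_smooth: "smooth_on (- space \<sigma>) v"
    and layer_series_bound: "\<And>x \<eta>. \<eta> \<in> space \<sigma> \<Longrightarrow> dist x \<eta> < A * bd x \<Longrightarrow> ennreal \<bar>v x\<bar> \<le> H \<eta>"
    and layer_series_gradient_bound: "\<And>x \<eta>. \<eta> \<in> space \<sigma> \<Longrightarrow> dist x \<eta> < A * bd x \<Longrightarrow>
      ennreal (bd x * norm (gradient v x)) \<le> ennreal 4 * H \<eta>"
    and layer_series_carleson: "\<And>\<xi> r. \<xi> \<in> space \<sigma> \<Longrightarrow> 0 < r \<Longrightarrow>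
      ennreal (1 / r powr s) * (\<integral>\<^sup>+x\<in>ball \<xi> r.
        (SUP y\<in>ball x (bd x / 4). ennreal (norm (gradient v y))) * ennreal (bd x powr (s - real n)) \<partial>lborel)
      \<le> ennreal (C0 * 3 powr s) * maxfun \<sigma> s (\<lambda>\<eta>. ennreal area_const * H \<eta>) \<xi>"
    and layer_series_limit: "\<And>\<xi> X l. \<xi> \<in> space \<sigma> \<Longrightarrow> H \<xi> < \<infinity> \<Longrightarrow> (\<lambda>J. \<Sum>j<J. g j \<xi>) \<longlonglongrightarrow> l \<Longrightarrow>
      (\<And>k. dist (X k) \<xi> < A * bd (X k)) \<Longrightarrow> X \<longlonglongrightarrow> \<xi> \<Longrightarrow> (\<lambda>k. v (X k)) \<longlonglongrightarrow> l"
proof -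
  note u0 = u0[rule_format] and du0 = du0[rule_format] and trace = trace[rule_format]
    and u = u[rule_format] and du = du[rule_format]
  have small: "\<epsilon> j \<le> 1 / 2 ^ J" if "J \<le> j" for j J
  proof -
    have "(2::real) ^ J \<le> 2 ^ j" using that by (intro power_increasing) auto
    then have "1 / 2 ^ j \<le> 1 / (2::real) ^ J" by (intro divide_left_mono) auto
    then show ?thesis using \<epsilon>(2)[of j] by linarith
  qed
  have level: "\<exists>J. 1 / 2 ^ J < bd x" if "0 < bd x" for x
    using real_arch_pow_inv[OF that, of "1 / 2"] by (auto simp: power_one_over)
  have v_eq: "v x = (\<Sum>j<J. u j x)" if "1 / 2 ^ J < bd x" for x J
  proof -
    have "u j x = 0" if "j \<notin> {..<J}" for j
      using small[of J j] that \<open>1 / 2 ^ J < bd x\<close> by (intro u0) (simp add: not_less)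
    then show ?thesis unfolding v_def by (intro suminf_finite) auto
  qed
  have open_level: "open {x. 1 / 2 ^ J < bd x}" for J :: nat
    by (intro open_Collect_less continuous_intros)
  show "smooth_on (- space \<sigma>) v"
  proof (rule smooth_on_locally)
    fix x assume "x \<in> - space \<sigma>"
    then obtain J where "1 / 2 ^ J < bd x" using level bd_pos_iff by auto
    moreover have "smooth_on {x. 1 / 2 ^ J < bd x} (\<lambda>x. \<Sum>j<J. u j x)"
      by (intro smooth_on_sum open_level smooth_on_subset[OF smooth]) auto
    ultimately show "\<exists>U w. open U \<and> x \<in> U \<and> smooth_on U w \<and> (\<forall>y\<in>U. v y = w y)"
      using open_level v_eq by (intro exI[of _ "{x. 1 / 2 ^ J < bd x}"] exI[of _ "\<lambda>x. \<Sum>j<J. u j x"]) auto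
  qed
  have grad_eq: "gradient v x = (\<Sum>j<J. gradient (u j) x)" if "1 / 2 ^ J < bd x" for x J
  proof -
    have "frechet_derivative v (at x) = frechet_derivative (\<lambda>x. \<Sum>j<J. u j x) (at x)"
      by (rule frechet_derivative_eq_on_open[OF open_level[of J]]) (use that v_eq in auto)
    then have "gradient v x = gradient (\<lambda>x. \<Sum>j<J. u j x) x" by (simp add: gradient_def)
    also have "\<dots> = (\<Sum>j<J. gradient (u j) x)"
      by (rule gradient_sum) (rule smooth_on_imp_differentiable[OF smooth UNIV_I])
    finally show ?thesis .
  qed
  have sum_le: "ennreal (\<Sum>j<J. a j) \<le> (\<Sum>j. ennreal (b j))" if "\<And>j. a j \<le> b j" "\<And>j. 0 \<le> b j" for a b :: "nat \<Rightarrow> real" and J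
  proof -
    have "ennreal (\<Sum>j<J. a j) \<le> ennreal (\<Sum>j<J. b j)" by (intro ennreal_leI sum_mono that)
    also have "\<dots> = (\<Sum>j<J. ennreal (b j))" using that by simp
    also have "\<dots> \<le> (\<Sum>j. ennreal (b j))" by (intro sum_le_suminf) auto
    finally show ?thesis .
  qed
  have grad_sum_le: "ennreal (norm (gradient v x)) \<le> (\<Sum>j. ennreal (b j))"
    if "0 < bd x" "\<And>j. norm (gradient (u j) x) \<le> b j" for x b
  proof -
    obtain J where J: "1 / 2 ^ J < bd x" using level[OF \<open>0 < bd x\<close>] by blast
    have "ennreal (norm (gradient v x)) \<le> ennreal (\<Sum>j<J. norm (gradient (u j) x))"
      unfolding grad_eq[OF J] by (intro ennreal_leI norm_sum)
    also have "\<dots> \<le> (\<Sum>j. ennreal (b j))"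
      using that(2) by (intro sum_le) (auto intro: order_trans[OF norm_ge_zero])
    finally show ?thesis .
  qed
  have bd_pos: "0 < bd x" if "dist x \<eta> < A * bd x" for x \<eta>
    using that A zero_le_dist[of x \<eta>] infdist_nonneg[of x "space \<sigma>"] by (cases "bd x = 0") auto
  show "ennreal \<bar>v x\<bar> \<le> H \<eta>" if \<eta>: "\<eta> \<in> space \<sigma>" "dist x \<eta> < A * bd x" for x \<eta>
  proof -
    obtain J where J: "1 / 2 ^ J < bd x" using level bd_pos[OF \<eta>(2)] by blast
    have "ennreal \<bar>v x\<bar> \<le> ennreal (\<Sum>j<J. \<bar>u j x\<bar>)"
      unfolding v_eq[OF J] by (intro ennreal_leI sum_abs)
    also have "\<dots> \<le> H \<eta>" unfolding H_def by (intro sum_le u[OF \<eta>] h0)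
    finally show ?thesis .
  qed
  show "ennreal (bd x * norm (gradient v x)) \<le> ennreal 4 * H \<eta>" if \<eta>: "\<eta> \<in> space \<sigma>" "dist x \<eta> < A * bd x" for x \<eta>
  proof -
    have pos: "0 < bd x" by (rule bd_pos[OF \<eta>(2)])
    have b: "norm (gradient (u j) x) \<le> 4 * h j \<eta> / bd x" for j
    proof (cases "bd x \<le> \<epsilon> j")
      case True
      have "4 / \<epsilon> j * h j \<eta> \<le> 4 / bd x * h j \<eta>"
        using True pos by (intro mult_right_mono h0 divide_left_mono) auto
      then show ?thesis using du[OF \<eta>, of j] by simp
    next
      case False
      then show ?thesis using du0[of j x] h0[of j \<eta>] pos by simp
    qed
    have "ennreal (bd x * norm (gradient v x)) = ennreal (bd x) * ennreal (norm (gradient v x))"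
      using pos by (simp add: ennreal_mult)
    also have "\<dots> \<le> ennreal (bd x) * (\<Sum>j. ennreal (4 * h j \<eta> / bd x))"
      by (intro mult_left_mono grad_sum_le[OF pos b]) simp
    also have "\<dots> = (\<Sum>j. ennreal (bd x) * ennreal (4 * h j \<eta> / bd x))" by simp
    also have "\<dots> = (\<Sum>j. ennreal 4 * ennreal (h j \<eta>))"
      using pos h0 by (intro suminf_cong) (simp add: ennreal_mult[symmetric] del: ennreal_numeral)
    also have "\<dots> = ennreal 4 * H \<eta>" unfolding H_def by (rule ennreal_suminf_cmult)
    finally show ?thesis .
  qed
  define F where "F x = (SUP y\<in>ball x (bd x / 4). ennreal (norm (gradient v y)))" for x
  note measurable_id [measurable del]
  have F_meas: "F \<in> borel_measurable borel"
    unfolding F_def by (rule borel_measurable_sup_ball) (intro continuous_intros, simp)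
  have near: "3 / 4 * bd x \<le> bd y" if "y \<in> ball x (bd x / 4)" for x y
    using bd_lipschitz[of x y] that by simp
  have F_supp: "0 < bd x \<and> bd x \<le> d0" if "F x \<noteq> 0" for x
  proof (rule ccontr)
    assume neg: "\<not> ?thesis"
    have "ennreal (norm (gradient v y)) \<le> 0" if y: "y \<in> ball x (bd x / 4)" for y
    proof -
      have "0 < bd x" using y zero_le_dist[of x y] by (simp del: zero_le_dist)
      then have big: "d0 < bd x" using neg by simp
      have "\<epsilon> j < bd y" for j
        using near[OF y] big \<epsilon>(3)[of j] d0_pos by simp
      then have "ennreal (norm (gradient v y)) \<le> (\<Sum>j. ennreal 0)"
        using near[OF y] big d0_pos by (intro grad_sum_le) (auto simp: du0)
      then show ?thesis by simp
    qed
    then have "F x \<le> 0" unfolding F_def by (intro SUP_least)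
    then show False using that by simp
  qed
  have area: "(\<integral>\<^sup>+x. F x * ennreal (1 / bd x ^ n) * indicator {x. dist x \<eta> < 2 * bd x} x \<partial>lborel) \<le> ennreal area_const * H \<eta>"
    if \<eta>: "\<eta> \<in> space \<sigma>" for \<eta>
  proof -
    let ?k = "\<lambda>j x. indicator {x. 0 < bd x \<and> bd x \<le> 2 * \<epsilon> j} x * ennreal (1 / bd x ^ n) * indicator {x. dist x \<eta> < 2 * bd x} x"
    have "F x * ennreal (1 / bd x ^ n) * indicator {x. dist x \<eta> < 2 * bd x} x
        \<le> (\<Sum>j. ennreal (4 / \<epsilon> j * h j \<eta>) * ?k j x)" for x
    proof (cases "dist x \<eta> < 2 * bd x")
      case True
      have pos: "0 < bd x" using True zero_le_dist[of x \<eta>] by linarith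
      have "ennreal (norm (gradient v y)) \<le> (\<Sum>j. ennreal (4 / \<epsilon> j * h j \<eta> * indicator {x. 0 < bd x \<and> bd x \<le> 2 * \<epsilon> j} x))"
        if y: "y \<in> ball x (bd x / 4)" for y
      proof (rule grad_sum_le)
        show posy: "0 < bd y" using near[OF y] pos by linarith
        fix j
        have "dist y \<eta> < 3 * bd y"
          using near[OF y] True y dist_triangle[of y \<eta> x] by (simp add: dist_commute)
        also have "\<dots> \<le> A * bd y" using A posy by simp
        finally have c: "dist y \<eta> < A * bd y" .
        show "norm (gradient (u j) y) \<le> 4 / \<epsilon> j * h j \<eta> * indicator {x. 0 < bd x \<and> bd x \<le> 2 * \<epsilon> j} x"
        proof (cases "bd x \<le> 2 * \<epsilon> j")
          case True
          then show ?thesis using du[OF \<eta> c, of j] pos by simp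
        next
          case False
          then have "\<epsilon> j < bd y" using near[OF y] \<epsilon>(1)[of j] by linarith
          then show ?thesis using False by (simp add: du0)
        qed
      qed
      then have "F x \<le> (\<Sum>j. ennreal (4 / \<epsilon> j * h j \<eta> * indicator {x. 0 < bd x \<and> bd x \<le> 2 * \<epsilon> j} x))"
        unfolding F_def by (rule SUP_least)
      also have "\<dots> = (\<Sum>j. ennreal (4 / \<epsilon> j * h j \<eta>) * indicator {x. 0 < bd x \<and> bd x \<le> 2 * \<epsilon> j} x)"
        by (intro suminf_cong) (simp add: indicator_def)
      finally have "F x * ennreal (1 / bd x ^ n) \<le>
          (\<Sum>j. ennreal (4 / \<epsilon> j * h j \<eta>) * indicator {x. 0 < bd x \<and> bd x \<le> 2 * \<epsilon> j} x) * ennreal (1 / bd x ^ n)"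
        by (rule mult_right_mono) simp
      also have "\<dots> = (\<Sum>j. ennreal (4 / \<epsilon> j * h j \<eta>) * indicator {x. 0 < bd x \<and> bd x \<le> 2 * \<epsilon> j} x * ennreal (1 / bd x ^ n))"
        by (rule ennreal_suminf_multc[symmetric])
      also have "\<dots> = (\<Sum>j. ennreal (4 / \<epsilon> j * h j \<eta>) * ?k j x)"
        using True by (intro suminf_cong) (simp add: mult.assoc)
      finally show ?thesis using True by simp
    qed simp
    then have "(\<integral>\<^sup>+x. F x * ennreal (1 / bd x ^ n) * indicator {x. dist x \<eta> < 2 * bd x} x \<partial>lborel)
        \<le> (\<integral>\<^sup>+x. (\<Sum>j. ennreal (4 / \<epsilon> j * h j \<eta>) * ?k j x) \<partial>lborel)"
      by (rule nn_integral_mono)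
    also have "\<dots> = (\<Sum>j. \<integral>\<^sup>+x. ennreal (4 / \<epsilon> j * h j \<eta>) * ?k j x \<partial>lborel)"
      by (rule nn_integral_suminf) measurable
    also have "\<dots> = (\<Sum>j. ennreal (4 / \<epsilon> j * h j \<eta>) * (\<integral>\<^sup>+x. ?k j x \<partial>lborel))"
      by (intro suminf_cong nn_integral_cmult) measurable
    also have "\<dots> \<le> (\<Sum>j. ennreal area_const * ennreal (h j \<eta>))"
    proof (intro suminf_le allI)
      fix j
      define c where "c = 2 ^ n * (2 ^ (n + 1) * unit_ball_vol (real (n + 1)) * 2)"
      have c: "0 \<le> c" by (simp add: c_def)
      have "(\<integral>\<^sup>+x. ?k j x \<partial>lborel) \<le> ennreal (c * (2 * \<epsilon> j))"
        using area_kernel_le[OF \<eta>, of "2 * \<epsilon> j"] \<epsilon>(1)[of j] by (simp add: c_def mult_ac)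
      then have "ennreal (4 / \<epsilon> j * h j \<eta>) * (\<integral>\<^sup>+x. ?k j x \<partial>lborel) \<le> ennreal (4 / \<epsilon> j * h j \<eta>) * ennreal (c * (2 * \<epsilon> j))"
        by (rule mult_left_mono) simp
      also have "\<dots> = ennreal ((4 / \<epsilon> j * h j \<eta>) * (c * (2 * \<epsilon> j)))"
        using c h0[of j \<eta>] \<epsilon>(1)[of j] by (intro ennreal_mult[symmetric]) auto
      also have "(4 / \<epsilon> j * h j \<eta>) * (c * (2 * \<epsilon> j)) = area_const * h j \<eta>"
        using \<epsilon>(1)[of j] unfolding area_const_def c_def[symmetric] by (simp add: field_simps)
      also have "ennreal (area_const * h j \<eta>) = ennreal area_const * ennreal (h j \<eta>)"
        by (rule ennreal_mult[OF area_const_nonneg h0])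
      finally show "ennreal (4 / \<epsilon> j * h j \<eta>) * (\<integral>\<^sup>+x. ?k j x \<partial>lborel) \<le> ennreal area_const * ennreal (h j \<eta>)" .
    qed auto
    also have "\<dots> = ennreal area_const * H \<eta>" unfolding H_def by (rule ennreal_suminf_cmult)
    finally show ?thesis .
  qed
  have H_meas: "(\<lambda>\<eta>. ennreal area_const * H \<eta>) \<in> borel_measurable \<sigma>"
    unfolding H_def by measurable
  show "ennreal (1 / r powr s) * (\<integral>\<^sup>+x\<in>ball \<xi> r.
        (SUP y\<in>ball x (bd x / 4). ennreal (norm (gradient v y))) * ennreal (bd x powr (s - real n)) \<partial>lborel)
      \<le> ennreal (C0 * 3 powr s) * maxfun \<sigma> s (\<lambda>\<eta>. ennreal area_const * H \<eta>) \<xi>"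
    if "\<xi> \<in> space \<sigma>" "0 < r" for \<xi> r
    using carleson_average_le_maxfun[OF F_meas F_supp area H_meas that] unfolding F_def by simp
  show "(\<lambda>k. v (X k)) \<longlonglongrightarrow> l"
    if \<xi>: "\<xi> \<in> space \<sigma>" and fin: "H \<xi> < \<infinity>" and l: "(\<lambda>J. \<Sum>j<J. g j \<xi>) \<longlonglongrightarrow> l"
      and X: "\<And>k. dist (X k) \<xi> < A * bd (X k)" "X \<longlonglongrightarrow> \<xi>" for \<xi> X l
  proof (rule LIMSEQ_I)
    fix e :: real assume e: "0 < e"
    have sh: "summable (\<lambda>j. h j \<xi>)"
      using fin h0 by (intro summable_suminf_not_top) (auto simp: H_def)
    have "\<forall>\<^sub>F J in sequentially. norm (\<Sum>j. h (j + J) \<xi>) < e / 3"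
      using suminf_exist_split[of "e / 3" "\<lambda>j. h j \<xi>"] e sh by (auto simp: eventually_sequentially)
    moreover have "\<forall>\<^sub>F J in sequentially. dist (\<Sum>j<J. g j \<xi>) l < e / 3"
      using e by (intro tendstoD[OF l]) simp
    ultimately have "\<forall>\<^sub>F J in sequentially. norm (\<Sum>j. h (j + J) \<xi>) < e / 3 \<and> dist (\<Sum>j<J. g j \<xi>) l < e / 3"
      by eventually_elim simp
    from eventually_happens'[OF sequentially_bot this]
    obtain J where J: "norm (\<Sum>j. h (j + J) \<xi>) < e / 3" "dist (\<Sum>j<J. g j \<xi>) l < e / 3" by blast
    have tail: "\<bar>v (X k) - (\<Sum>j<J. u j (X k))\<bar> < e / 3" for k
    proof -
      have le: "norm (u j (X k)) \<le> h j \<xi>" for j using u[OF \<xi> X(1)] by simp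
      then have su: "summable (\<lambda>j. u j (X k))" by (intro summable_comparison_test'[OF sh]) auto
      have "v (X k) - (\<Sum>j<J. u j (X k)) = (\<Sum>j. u (j + J) (X k))"
        unfolding v_def using suminf_minus_initial_segment[OF su, of J] by simp
      also have "norm \<dots> \<le> (\<Sum>j. h (j + J) \<xi>)"
        by (intro norm_suminf_le le) (use sh in \<open>simp add: summable_iff_shift[of "\<lambda>j. h j \<xi>"]\<close>)
      also have "\<dots> < e / 3" using J(1) by simp
      finally show ?thesis by simp
    qed
    have "(\<lambda>k. \<Sum>j<J. u j (X k)) \<longlonglongrightarrow> (\<Sum>j<J. u j \<xi>)"
    proof (intro tendsto_sum)
      fix j
      have "isCont (u j) \<xi>"
        using smooth_on_imp_continuous[OF smooth] by (simp add: continuous_on_eq_continuous_at)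
      then show "(\<lambda>k. u j (X k)) \<longlonglongrightarrow> u j \<xi>" by (rule isCont_tendsto_compose[OF _ X(2)])
    qed
    moreover have "(\<Sum>j<J. u j \<xi>) = (\<Sum>j<J. g j \<xi>)" by (simp add: trace[OF \<xi>])
    ultimately have "\<forall>\<^sub>F k in sequentially. dist (\<Sum>j<J. u j (X k)) (\<Sum>j<J. g j \<xi>) < e / 3"
      using e by (intro tendstoD) auto
    then obtain K where K: "\<And>k. K \<le> k \<Longrightarrow> dist (\<Sum>j<J. u j (X k)) (\<Sum>j<J. g j \<xi>) < e / 3"
      by (auto simp: eventually_sequentially)
    have "norm (v (X k) - l) < e" if "K \<le> k" for k
      using K[OF that] tail[of k] J(2) unfolding dist_real_def real_norm_def by linarith
    then show "\<exists>K. \<forall>k\<ge>K. norm (v (X k) - l) < e" by blast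
  qed
qed

end

section \<open>The extension of an Lp function\<close>

text \<open>
  The powers of \<open>2\<close> come, from the outside in, from \<open>ennreal_powr_suminf_le\<close>, from splitting \<open>h j\<close> into
  \<open>\<bar>g j\<bar>\<close> and the indicator, and from splitting \<open>g j\<close> into two successive errors; the last factor is
  the sum of the geometric series.
\<close>

definition series_const :: "real \<Rightarrow> real" where
  "series_const p = 2 powr p * (2 powr p * (2 powr p * 2 + 1)) * 2"

lemma series_const_pos: "0 < series_const p"
  by (simp add: series_const_def add_nonneg_pos)

context ahlfors_measure
begin

text \<open>
  All parameters are chosen along the approximating sequence: \<open>e j\<close> is the admissible error,
  \<open>\<mu> j\<close> makes the indicator in \<open>h j\<close> as small in norm as \<open>e j\<close>, and finally \<open>\<epsilon> j\<close> is taken small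
  compared with \<open>\<mu> j / L j\<close>, where \<open>L j\<close> is the Lipschitz constant of \<open>g j\<close>. The weights \<open>2 ^ j\<close> lost in
  \<open>ennreal_powr_suminf_le\<close> are compensated by the factor \<open>4 powr (-p j)\<close> in the errors.
\<close>

lemma extension_exists:
  assumes sets: "sets \<sigma> = (\<lambda>B. B \<inter> space \<sigma>) ` sets borel"
    and p: "1 < p" and A: "3 \<le> A"
    and f [measurable]: "f \<in> borel_measurable \<sigma>" and fin: "Lp_mass \<sigma> p f < \<infinity>"
  obtains v H where "H \<in> borel_measurable \<sigma>" "smooth_on (- space \<sigma>) v"
    "\<And>x \<eta>. \<eta> \<in> space \<sigma> \<Longrightarrow> dist x \<eta> < A * bd x \<Longrightarrow> ennreal \<bar>v x\<bar> \<le> H \<eta>"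
    "\<And>x \<eta>. \<eta> \<in> space \<sigma> \<Longrightarrow> dist x \<eta> < A * bd x \<Longrightarrow> ennreal (bd x * norm (gradient v x)) \<le> ennreal 4 * H \<eta>"
    "\<And>\<xi> r. \<xi> \<in> space \<sigma> \<Longrightarrow> 0 < r \<Longrightarrow> ennreal (1 / r powr s) * (\<integral>\<^sup>+x\<in>ball \<xi> r.
        (SUP y\<in>ball x (bd x / 4). ennreal (norm (gradient v y))) * ennreal (bd x powr (s - real n)) \<partial>lborel)
      \<le> ennreal (C0 * 3 powr s) * maxfun \<sigma> s (\<lambda>\<eta>. ennreal area_const * H \<eta>) \<xi>"
    "(\<integral>\<^sup>+\<eta>. ennreal_powr (H \<eta>) p \<partial>\<sigma>) \<le> ennreal (series_const p) * Lp_mass \<sigma> p f"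
    "AE \<xi> in \<sigma>. \<forall>X. (\<forall>k. dist (X k) \<xi> < A * bd (X k)) \<longrightarrow> X \<longlonglongrightarrow> \<xi> \<longrightarrow> (\<lambda>k. v (X k)) \<longlonglongrightarrow> f \<xi>"
proof -
  obtain F where F: "0 \<le> F" "Lp_mass \<sigma> p f = ennreal F"
    using fin by (cases "\<integral>\<^sup>+x. ennreal (\<bar>f x\<bar> powr p) \<partial>\<sigma>") auto
  \<comment> \<open>If \<open>f\<close> vanishes almost everywhere, no positive errors \<open>e j\<close> are admissible; then \<open>v = 0\<close> does.\<close>
  show thesis
  proof (cases "F = 0")
    case True
    then have "AE x in \<sigma>. ennreal (\<bar>f x\<bar> powr p) = 0"
      using F(2) by (subst nn_integral_0_iff_AE[symmetric]) auto
    then have f0: "AE x in \<sigma>. f x = 0" by eventually_elim simp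
    have g0: "gradient (\<lambda>_. 0) x = 0" for x :: 'a
      by (rule gradient_eq_0_if_locally_0[of UNIV]) auto
    show thesis
    proof (rule that[of "\<lambda>_. 0" "\<lambda>_. 0"])
      show "AE \<xi> in \<sigma>. \<forall>X. (\<forall>k. dist (X k) \<xi> < A * bd (X k)) \<longrightarrow> X \<longlonglongrightarrow> \<xi> \<longrightarrow> (\<lambda>k. 0) \<longlonglongrightarrow> f \<xi>"
        using f0 by eventually_elim simp
      show "ennreal (1 / r powr s) * (\<integral>\<^sup>+x\<in>ball \<xi> r.
        (SUP y\<in>ball x (bd x / 4). ennreal (norm (gradient (\<lambda>_. 0) y))) * ennreal (bd x powr (s - real n)) \<partial>lborel)
        \<le> ennreal (C0 * 3 powr s) * maxfun \<sigma> s (\<lambda>\<eta>. ennreal area_const * 0) \<xi>" for \<xi> r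
      proof -
        have "(SUP y\<in>ball x (bd x / 4). ennreal (norm (gradient (\<lambda>_. 0) y))) \<le> 0" for x
          by (intro SUP_least) (simp add: g0)
        then show ?thesis by simp
      qed
    qed (simp_all add: smooth_on_const g0)
  next
    case False
    then have Fpos: "0 < F" using F(1) by simp
    define e where "e j = F * 4 powr - (p * real j)" for j :: nat
    have e0: "0 < e j" for j using Fpos by (simp add: e_def)
    have e_Suc: "e (Suc j) \<le> e j" for j
      unfolding e_def using Fpos p by (intro mult_left_mono powr_mono) (auto simp: algebra_simps)
    have ap: "approximable p f"
      by (rule approximable_Lp[OF _ sets f fin]) (use p in simp)
    have "\<exists>G. test_function G \<and> Lp_mass \<sigma> p (\<lambda>x. f x - G x) \<le> ennreal (e j)" for j
      using ap e0[of j] unfolding approximable_def by (blast intro: less_imp_le)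
    then obtain G' where G': "\<And>j. test_function (G' j)"
        "\<And>j. Lp_mass \<sigma> p (\<lambda>x. f x - G' j x) \<le> ennreal (e j)"
      by metis
    \<comment> \<open>Starting from zero, the traces of the first \<open>j\<close> layers add up to \<open>G j\<close>.\<close>
    define G where "G j = (if j = 0 then (\<lambda>_. 0) else G' j)" for j :: nat
    have Gt: "test_function (G j)" for j by (simp add: G_def G' test_function_0)
    have Ge: "Lp_mass \<sigma> p (\<lambda>x. f x - G j x) \<le> ennreal (e j)" for j
      using G'(2)[of j] F by (simp add: G_def e_def)
    note [measurable] = borel_measurable_test_function[OF Gt]
    define g where "g j x = G (Suc j) x - G j x" for j x
    have gt: "test_function (g j)" for j
      unfolding g_def by (rule test_function_diff[OF Gt Gt])
    note [measurable] = borel_measurable_test_function[OF gt]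
    have "\<exists>L R. 0 < L \<and> 0 < R \<and> (\<forall>x y. \<bar>g j x - g j y\<bar> \<le> L * dist x y) \<and> (\<forall>x. R \<le> norm x \<longrightarrow> g j x = 0)" for j
      by (rule test_function_bounds[OF gt])
    then obtain L R where LR: "\<And>j. 0 < L j" "\<And>j x y. \<bar>g j x - g j y\<bar> \<le> L j * dist x y" "\<And>j x. R j \<le> norm x \<Longrightarrow> g j x = 0"
      by metis
    define K where "K j = ball (0::'a) (R j + A + 1)" for j
    define m where "m j = enn2real (emeasure \<sigma> (K j \<inter> space \<sigma>))" for j
    have m: "emeasure \<sigma> (K j \<inter> space \<sigma>) = ennreal (m j)" "0 \<le> m j" for j
      using emeasure_bounded[of "K j"] by (auto simp: m_def K_def)
    \<comment> \<open>The summand \<open>1\<close> avoids a division by zero when the ball has measure zero.\<close>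
    define \<mu> where "\<mu> j = (e j / (m j + 1)) powr (1 / p)" for j
    have mu0: "0 < \<mu> j" for j
      using e0[of j] m(2)[of j] unfolding \<mu>_def by (simp add: divide_pos_pos)
    have mu_m: "\<mu> j powr p * m j \<le> e j" for j
    proof -
      have "\<mu> j powr p = e j / (m j + 1)" using p e0[of j] m(2)[of j] by (simp add: \<mu>_def powr_powr)
      then have "\<mu> j powr p + m j * \<mu> j powr p = e j"
        using m(2)[of j] by (simp add: field_simps)
      moreover have "0 \<le> \<mu> j powr p" by simp
      ultimately have "m j * \<mu> j powr p \<le> e j" by linarith
      then show ?thesis by (simp add: mult.commute)
    qed
    \<comment> \<open>The bound \<open>1 / 2 ^ j\<close> makes the layers locally finite, \<open>d0 / 2\<close> keeps them where lower regularity applies, and the last one absorbs the Lipschitz constant.\<close>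
    define \<epsilon> where "\<epsilon> j = min (min 1 (1 / 2 ^ j)) (min (d0 / 2) (\<mu> j / (L j * A)))" for j
    have eps: "0 < \<epsilon> j" "\<epsilon> j \<le> 1" "\<epsilon> j \<le> 1 / 2 ^ j" "\<epsilon> j \<le> d0 / 2" "L j * A * \<epsilon> j \<le> \<mu> j" for j
    proof -
      have LA: "0 < L j * A" using LR(1)[of j] A by simp
      show "0 < \<epsilon> j" using LA mu0[of j] d0_pos by (simp add: \<epsilon>_def)
      show "\<epsilon> j \<le> 1" "\<epsilon> j \<le> 1 / 2 ^ j" "\<epsilon> j \<le> d0 / 2"
        unfolding \<epsilon>_def by (blast intro: min.coboundedI1 min.coboundedI2 order_refl)+
      have "\<epsilon> j \<le> \<mu> j / (L j * A)" by (simp add: \<epsilon>_def)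
      then show "L j * A * \<epsilon> j \<le> \<mu> j" using LA by (simp add: pos_le_divide_eq mult.commute)
    qed
    define h where "h j \<eta> = \<bar>g j \<eta>\<bar> + \<mu> j * indicator (K j) \<eta>" for j \<eta>
    have [measurable]: "K j \<in> sets borel" for j by (simp add: K_def)
    have hm [measurable]: "h j \<in> borel_measurable \<sigma>" for j unfolding h_def by measurable
    have h0: "0 \<le> h j \<eta>" for j \<eta> using mu0[of j] by (simp add: h_def)
    define P where "P j u \<longleftrightarrow> smooth_on UNIV u \<and> (\<forall>\<eta>\<in>space \<sigma>. u \<eta> = g j \<eta>) \<and>
        (\<forall>x. \<epsilon> j \<le> bd x \<longrightarrow> u x = 0) \<and> (\<forall>x. \<epsilon> j < bd x \<longrightarrow> gradient u x = 0) \<and>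
        (\<forall>x. \<forall>\<eta>\<in>space \<sigma>. dist x \<eta> < A * bd x \<longrightarrow> \<bar>u x\<bar> \<le> h j \<eta> \<and> norm (gradient u x) \<le> 4 / \<epsilon> j * h j \<eta>)" for j u
    have "\<exists>u. P j u" for j
    proof -
      have A1: "1 \<le> A" using A by simp
      let ?h = "\<lambda>\<eta>. \<bar>g j \<eta>\<bar> + \<mu> j * indicat_real (ball 0 (R j + A + 1)) \<eta>"
      show ?thesis
      proof (rule boundary_layer_extension[where g = "g j" and L = "L j" and R = "R j" and \<epsilon> = "\<epsilon> j" and A = A
              and \<mu> = "\<mu> j" and S = "space \<sigma>", OF test_functionD(1)[OF gt] LR eps(1,2) A1 eps(5)])
        fix u assume u: "smooth_on UNIV u" "\<And>\<eta>. \<eta> \<in> space \<sigma> \<Longrightarrow> u \<eta> = g j \<eta>"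
          "\<And>x. \<epsilon> j \<le> bd x \<Longrightarrow> u x = 0" "\<And>x. \<epsilon> j < bd x \<Longrightarrow> gradient u x = 0"
          "\<And>x \<eta>. \<eta> \<in> space \<sigma> \<Longrightarrow> dist x \<eta> < A * bd x \<Longrightarrow> \<bar>u x\<bar> \<le> ?h \<eta>"
          "\<And>x \<eta>. \<eta> \<in> space \<sigma> \<Longrightarrow> dist x \<eta> < A * bd x \<Longrightarrow> norm (gradient u x) \<le> 4 / \<epsilon> j * ?h \<eta>"
        have "h j = ?h" by (simp add: h_def[abs_def] K_def)
        then show ?thesis unfolding P_def using u by (intro exI[of _ u]) auto
      qed
    qed
    then have "\<forall>j. \<exists>u. P j u" by blast
    from choice[OF this] obtain u where "\<And>j. P j (u j)" by blast
    then have u: "\<And>j. smooth_on UNIV (u j)" "\<forall>j. \<forall>\<eta>\<in>space \<sigma>. u j \<eta> = g j \<eta>"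
        "\<forall>j x. \<epsilon> j \<le> bd x \<longrightarrow> u j x = 0" "\<forall>j x. \<epsilon> j < bd x \<longrightarrow> gradient (u j) x = 0"
        "\<forall>j x. \<forall>\<eta>\<in>space \<sigma>. dist x \<eta> < A * bd x \<longrightarrow> \<bar>u j x\<bar> \<le> h j \<eta>"
        "\<forall>j x. \<forall>\<eta>\<in>space \<sigma>. dist x \<eta> < A * bd x \<longrightarrow> norm (gradient (u j) x) \<le> 4 / \<epsilon> j * h j \<eta>"
      by (simp_all add: P_def)
    define v where "v x = (\<Sum>j. u j x)" for x
    define H where "H \<eta> = (\<Sum>j. ennreal (h j \<eta>))" for \<eta>
    note series = layer_series[where u = u and g = g and h = h and \<epsilon> = \<epsilon> and A = A,
        OF eps(1,3,4) A u(1,3,4,2,5,6) hm h0, folded v_def H_def]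
    define K1 where "K1 = 2 powr p * (2 powr p * 2 + 1)"
    have K1: "0 \<le> K1" by (simp add: K1_def)
    have p0: "0 \<le> p" using p by simp
    have hp: "(\<integral>\<^sup>+x. ennreal (h j x powr p) \<partial>\<sigma>) \<le> ennreal (K1 * e j)" for j
    proof -
      have gj: "Lp_mass \<sigma> p (\<lambda>x. g j x) \<le> ennreal (2 powr p * 2 * e j)"
      proof -
        have "Lp_mass \<sigma> p (\<lambda>x. g j x) = Lp_mass \<sigma> p (\<lambda>x. (f x - G j x) + (G (Suc j) x - f x))"
          by (simp add: g_def)
        also have "\<dots> \<le> ennreal (2 powr p) * (Lp_mass \<sigma> p (\<lambda>x. f x - G j x) + Lp_mass \<sigma> p (\<lambda>x. G (Suc j) x - f x))"
          by (rule nn_integral_powr_add_le) (use p0 in measurable)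
        also have "\<dots> \<le> ennreal (2 powr p) * (ennreal (e j) + ennreal (e j))"
        proof (intro mult_left_mono add_mono Ge)
          have "Lp_mass \<sigma> p (\<lambda>x. G (Suc j) x - f x) \<le> ennreal (e (Suc j))"
            using Ge[of "Suc j"] by (simp add: abs_minus_commute)
          also have "\<dots> \<le> ennreal (e j)" by (rule ennreal_leI[OF e_Suc])
          finally show "Lp_mass \<sigma> p (\<lambda>x. G (Suc j) x - f x) \<le> ennreal (e j)" .
        qed simp
        also have "\<dots> = ennreal (2 powr p * 2 * e j)"
          using e0[of j] by (simp add: ennreal_plus[symmetric] ennreal_mult[symmetric] del: ennreal_plus)
        finally show ?thesis .
      qed
      have mj: "Lp_mass \<sigma> p (\<lambda>x. \<mu> j * indicator (K j) x) \<le> ennreal (e j)"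
      proof -
        have "Lp_mass \<sigma> p (\<lambda>x. \<mu> j * indicator (K j) x)
            = (\<integral>\<^sup>+x. ennreal (\<mu> j powr p) * indicator (K j \<inter> space \<sigma>) x \<partial>\<sigma>)"
          using mu0[of j] by (intro nn_integral_cong) (auto simp: indicator_def)
        also have "\<dots> = ennreal (\<mu> j powr p) * ennreal (m j)"
          unfolding m(1)[symmetric] by (rule nn_integral_cmult_indicator) (rule sets_of_borel, simp add: K_def)
        also have "\<dots> \<le> ennreal (e j)"
          using mu_m[of j] m(2)[of j] by (simp add: ennreal_mult[symmetric] ennreal_leI)
        finally show ?thesis .
      qed
      have "(\<integral>\<^sup>+x. ennreal (h j x powr p) \<partial>\<sigma>) = Lp_mass \<sigma> p (\<lambda>x. \<bar>g j x\<bar> + \<mu> j * indicator (K j) x)"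
        using h0[of j] by (simp add: h_def)
      also have "\<dots> \<le> ennreal (2 powr p) * (Lp_mass \<sigma> p (\<lambda>x. \<bar>g j x\<bar>) + Lp_mass \<sigma> p (\<lambda>x. \<mu> j * indicator (K j) x))"
        by (rule nn_integral_powr_add_le) (use p0 in measurable)
      also have "\<dots> \<le> ennreal (2 powr p) * (ennreal (2 powr p * 2 * e j) + ennreal (e j))"
        using gj by (intro mult_left_mono add_mono mj) auto
      also have "\<dots> = ennreal (K1 * e j)"
        using e0[of j] by (simp add: K1_def ennreal_plus[symmetric] ennreal_mult[symmetric] algebra_simps del: ennreal_plus)
      finally show ?thesis .
    qed
    have Hm: "H \<in> borel_measurable \<sigma>" unfolding H_def[abs_def] by measurable
    have Hp: "(\<integral>\<^sup>+\<eta>. ennreal_powr (H \<eta>) p \<partial>\<sigma>) \<le> ennreal (series_const p) * ennreal F"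
    proof -
      have "(\<integral>\<^sup>+\<eta>. ennreal_powr (H \<eta>) p \<partial>\<sigma>) \<le>
          (\<integral>\<^sup>+\<eta>. ennreal (2 powr p) * (\<Sum>j. ennreal_powr (ennreal (2 ^ j) * ennreal (h j \<eta>)) p) \<partial>\<sigma>)"
        unfolding H_def using p by (intro nn_integral_mono ennreal_powr_suminf_le) simp
      also have "\<dots> = (\<integral>\<^sup>+\<eta>. ennreal (2 powr p) * (\<Sum>j. ennreal ((2 ^ j) powr p) * ennreal (h j \<eta> powr p)) \<partial>\<sigma>)"
        using h0 by (intro nn_integral_cong) (simp add: ennreal_powr_cmult ennreal_powr_ennreal)
      also have "\<dots> = ennreal (2 powr p) * (\<Sum>j. ennreal ((2 ^ j) powr p) * (\<integral>\<^sup>+\<eta>. ennreal (h j \<eta> powr p) \<partial>\<sigma>))"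
        by (simp add: nn_integral_cmult nn_integral_suminf)
      also have "\<dots> \<le> ennreal (2 powr p) * (\<Sum>j. ennreal (K1 * F) * ennreal ((1 / 2) ^ j))"
      proof (intro mult_left_mono suminf_le allI)
        fix j
        have "ennreal ((2 ^ j) powr p) * (\<integral>\<^sup>+\<eta>. ennreal (h j \<eta> powr p) \<partial>\<sigma>) \<le> ennreal ((2 ^ j) powr p) * ennreal (K1 * e j)"
          by (intro mult_left_mono hp) simp
        also have "\<dots> = ennreal ((2 ^ j) powr p * (K1 * e j))"
          using K1 e0[of j] by (intro ennreal_mult[symmetric]) auto
        also have "\<dots> \<le> ennreal ((K1 * F) * (1 / 2) ^ j)"
        proof (rule ennreal_leI)
          have "(2 ^ j) powr p = 2 powr (p * real j)" by (simp add: powr_realpow[symmetric] powr_powr mult.commute)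
          moreover have "4 powr - (p * real j) = 2 powr (- (2 * (p * real j)))"
            using powr_powr[of 2 2 "- (p * real j)"] by simp
          ultimately have "(2 ^ j) powr p * 4 powr - (p * real j) = 2 powr (- (p * real j))"
            by (simp add: powr_add[symmetric])
          also have "\<dots> \<le> 2 powr (- real j)" using p by (intro powr_mono) (auto simp: mult_le_cancel_right1)
          also have "\<dots> = (1 / 2) ^ j" by (simp add: powr_minus powr_realpow power_one_over inverse_eq_divide)
          finally have "(K1 * F) * ((2 ^ j) powr p * 4 powr - (p * real j)) \<le> (K1 * F) * (1 / 2) ^ j"
            using K1 F(1) by (intro mult_left_mono) auto
          then show "(2 ^ j) powr p * (K1 * e j) \<le> (K1 * F) * (1 / 2) ^ j" by (simp add: e_def mult_ac)
        qed
        also have "\<dots> = ennreal (K1 * F) * ennreal ((1 / 2) ^ j)" using K1 F(1) by (intro ennreal_mult) auto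
        finally show "ennreal ((2 ^ j) powr p) * (\<integral>\<^sup>+\<eta>. ennreal (h j \<eta> powr p) \<partial>\<sigma>) \<le> ennreal (K1 * F) * ennreal ((1 / 2) ^ j)" .
      qed auto
      also have "\<dots> = ennreal (2 powr p) * (ennreal (K1 * F) * (\<Sum>j. ennreal ((1 / 2) ^ j)))" by simp
      also have "(\<Sum>j. ennreal ((1 / 2) ^ j)) = ennreal 2"
      proof (rule suminf_ennreal_eq)
        show "(\<lambda>j. (1 / 2 :: real) ^ j) sums 2" using geometric_sums[of "1 / 2 :: real"] by simp
      qed simp
      also have "ennreal (2 powr p) * (ennreal (K1 * F) * ennreal 2) = ennreal (2 powr p * (K1 * F * 2))"
        using K1 F(1) by (simp add: ennreal_mult[symmetric] del: ennreal_numeral)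
      also have "2 powr p * (K1 * F * 2) = series_const p * F" by (simp add: series_const_def K1_def)
      also have "ennreal (series_const p * F) = ennreal (series_const p) * ennreal F"
        using series_const_pos[of p] F(1) by (intro ennreal_mult) auto
      finally show ?thesis .
    qed
    have Hfin: "AE \<xi> in \<sigma>. H \<xi> < \<infinity>"
    proof -
      have "(\<integral>\<^sup>+\<eta>. ennreal_powr (H \<eta>) p \<partial>\<sigma>) \<noteq> \<infinity>"
        using le_less_trans[OF Hp, of \<infinity>] by (auto simp: ennreal_mult[symmetric] ennreal_mult_less_top)
      then have "AE \<xi> in \<sigma>. ennreal_powr (H \<xi>) p \<noteq> \<infinity>"
        by (intro nn_integral_PInf_AE) (use Hm in measurable)
      then show ?thesis
      proof eventually_elim
        fix \<xi> assume "ennreal_powr (H \<xi>) p \<noteq> \<infinity>"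
        then show "H \<xi> < \<infinity>" by (cases "H \<xi>") auto
      qed
    qed
    have Glim: "AE \<xi> in \<sigma>. (\<lambda>J. \<Sum>j<J. g j \<xi>) \<longlonglongrightarrow> f \<xi>"
    proof -
      have "(\<integral>\<^sup>+\<xi>. (\<Sum>j. ennreal (\<bar>f \<xi> - G j \<xi>\<bar> powr p)) \<partial>\<sigma>) = (\<Sum>j. \<integral>\<^sup>+\<xi>. ennreal (\<bar>f \<xi> - G j \<xi>\<bar> powr p) \<partial>\<sigma>)"
        by (rule nn_integral_suminf) measurable
      also have "\<dots> \<le> (\<Sum>j. ennreal F * ennreal ((1 / 2) ^ j))"
      proof (intro suminf_le allI)
        fix j
        have "e j \<le> F * (1 / 2) ^ j"
        proof -
          have "4 powr - (p * real j) \<le> 2 powr - (p * real j)" using p by (intro powr_mono2') auto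
          also have "\<dots> \<le> 2 powr (- real j)" using p by (intro powr_mono) (auto simp: mult_le_cancel_right1)
          also have "\<dots> = (1 / 2) ^ j" by (simp add: powr_minus powr_realpow power_one_over inverse_eq_divide)
          finally show ?thesis unfolding e_def using F(1) by (intro mult_left_mono)
        qed
        then have "ennreal (e j) \<le> ennreal F * ennreal ((1 / 2) ^ j)"
          using F(1) by (subst ennreal_mult[symmetric]) (auto intro: ennreal_leI)
        then show "Lp_mass \<sigma> p (\<lambda>\<xi>. f \<xi> - G j \<xi>) \<le> ennreal F * ennreal ((1 / 2) ^ j)"
          using Ge[of j] by (rule order_trans[rotated])
      qed auto
      also have "\<dots> = ennreal F * (\<Sum>j. ennreal ((1 / 2) ^ j))" by simp
      also have "(\<Sum>j. ennreal ((1 / 2) ^ j)) = ennreal 2"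
      proof (rule suminf_ennreal_eq)
        show "(\<lambda>j. (1 / 2 :: real) ^ j) sums 2" using geometric_sums[of "1 / 2 :: real"] by simp
      qed simp
      also have "ennreal F * ennreal 2 < \<infinity>" by (simp add: ennreal_mult_less_top)
      finally have "AE \<xi> in \<sigma>. (\<Sum>j. ennreal (\<bar>f \<xi> - G j \<xi>\<bar> powr p)) \<noteq> \<infinity>"
        by (intro nn_integral_PInf_AE) auto
      then show ?thesis
      proof eventually_elim
        fix \<xi> assume "(\<Sum>j. ennreal (\<bar>f \<xi> - G j \<xi>\<bar> powr p)) \<noteq> \<infinity>"
        then have "summable (\<lambda>j. \<bar>f \<xi> - G j \<xi>\<bar> powr p)" by (intro summable_suminf_not_top) auto
        then have "(\<lambda>j. \<bar>f \<xi> - G j \<xi>\<bar> powr p) \<longlonglongrightarrow> 0" by (rule summable_LIMSEQ_zero)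
        then have "(\<lambda>j. (\<bar>f \<xi> - G j \<xi>\<bar> powr p) powr (1 / p)) \<longlonglongrightarrow> 0 powr (1 / p)"
          using p by (intro tendsto_powr') auto
        then have "(\<lambda>j. \<bar>f \<xi> - G j \<xi>\<bar>) \<longlonglongrightarrow> 0" using p by (simp add: powr_powr)
        then have "(\<lambda>j. f \<xi> - G j \<xi>) \<longlonglongrightarrow> 0" by (simp add: tendsto_rabs_zero_iff)
        then have "(\<lambda>j. f \<xi> - (f \<xi> - G j \<xi>)) \<longlonglongrightarrow> f \<xi> - 0" by (intro tendsto_diff tendsto_const)
        moreover have "G 0 \<xi> = 0" by (simp add: G_def)
        then have "(\<Sum>j<J. g j \<xi>) = G J \<xi>" for J
          using sum_lessThan_telescope[of "\<lambda>j. G j \<xi>" J] by (simp add: g_def)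
        ultimately show "(\<lambda>J. \<Sum>j<J. g j \<xi>) \<longlonglongrightarrow> f \<xi>" by simp
      qed
    qed
    show thesis
    proof (rule that[of H v])
      show "AE \<xi> in \<sigma>. \<forall>X. (\<forall>k. dist (X k) \<xi> < A * bd (X k)) \<longrightarrow> X \<longlonglongrightarrow> \<xi> \<longrightarrow> (\<lambda>k. v (X k)) \<longlonglongrightarrow> f \<xi>"
        using Hfin Glim AE_space
      proof eventually_elim
        fix \<xi> assume \<xi>: "H \<xi> < \<infinity>" "(\<lambda>J. \<Sum>j<J. g j \<xi>) \<longlonglongrightarrow> f \<xi>" "\<xi> \<in> space \<sigma>"
        show "\<forall>X. (\<forall>k. dist (X k) \<xi> < A * bd (X k)) \<longrightarrow> X \<longlonglongrightarrow> \<xi> \<longrightarrow> (\<lambda>k. v (X k)) \<longlonglongrightarrow> f \<xi>"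
        proof (intro allI impI)
          fix X assume "\<forall>k. dist (X k) \<xi> < A * bd (X k)" "X \<longlonglongrightarrow> \<xi>"
          then show "(\<lambda>k. v (X k)) \<longlonglongrightarrow> f \<xi>" by (intro series(5)[OF \<xi>(3,1,2)]) auto
        qed
      qed
    qed (use Hm Hp F(2) series in auto)
  qed
qed

end

section \<open>Norm bounds and boundary convergence\<close>

lemma Lp_enorm_null:
  assumes "emeasure M (space M) = 0"
  shows "Lp_enorm p M g = 0"
proof -
  have "(\<integral>\<^sup>+x. ennreal_powr (g x) p \<partial>M) = (\<integral>\<^sup>+x. 0 \<partial>M)"
    by (rule nn_integral_cong_AE) (rule AE_I[of _ _ "space M"], use assms in auto)
  then show ?thesis by (simp add: Lp_enorm_def)
qed

text \<open>
  In the application \<open>g\<close> is a maximal function of the extension and \<open>k\<close> a measurable majorant built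
  from the approximation errors.
\<close>

lemma Lp_enorm_le:
  assumes p: "0 < p" and a: "0 < a" and b: "0 < b"
    and g: "\<And>x. x \<in> space M \<Longrightarrow> g x \<le> ennreal a * k x"
    and k [measurable]: "k \<in> borel_measurable M"
    and le: "(\<integral>\<^sup>+x. ennreal_powr (k x) p \<partial>M) \<le> ennreal b * Lp_mass M p f"
  shows "Lp_enorm p M g \<le> ennreal (a * b powr (1 / p)) * Lp_norm p M f"
proof -
  have "(\<integral>\<^sup>+x. ennreal_powr (g x) p \<partial>M) \<le> (\<integral>\<^sup>+x. ennreal (a powr p) * ennreal_powr (k x) p \<partial>M)"
  proof (rule nn_integral_mono)
    fix x assume "x \<in> space M"
    then have "ennreal_powr (g x) p \<le> ennreal_powr (ennreal a * k x) p"
      using p by (intro ennreal_powr_mono g) auto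
    then show "ennreal_powr (g x) p \<le> ennreal (a powr p) * ennreal_powr (k x) p"
      using a by (simp add: ennreal_powr_cmult)
  qed
  also have "\<dots> = ennreal (a powr p) * (\<integral>\<^sup>+x. ennreal_powr (k x) p \<partial>M)"
    by (rule nn_integral_cmult) measurable
  also have "\<dots> \<le> ennreal (a powr p) * (ennreal b * Lp_mass M p f)"
    by (intro mult_left_mono le) simp
  also have "\<dots> = ennreal (a powr p * b) * Lp_mass M p f"
    using b by (simp add: ennreal_mult mult.assoc)
  finally have "Lp_enorm p M g \<le> ennreal_powr (ennreal (a powr p * b) * Lp_mass M p f) (1 / p)"
    unfolding Lp_enorm_def using p by (intro ennreal_powr_mono) auto
  also have "\<dots> = ennreal ((a powr p * b) powr (1 / p)) * ennreal_powr (Lp_mass M p f) (1 / p)"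
    using a b by (intro ennreal_powr_cmult) simp
  also have "(a powr p * b) powr (1 / p) = a * b powr (1 / p)"
    using a b p by (simp add: powr_mult powr_powr)
  also have "ennreal_powr (Lp_mass M p f) (1 / p) = Lp_norm p M f"
    by (simp add: Lp_enorm_def ennreal_powr_ennreal)
  finally show ?thesis .
qed

lemma Lp_spaceD:
  assumes "f \<in> Lp_space p M" "0 < p"
  shows "f \<in> borel_measurable M" "Lp_mass M p f < \<infinity>"
proof -
  show "f \<in> borel_measurable M" using assms by (simp add: Lp_space_def)
  have "ennreal_powr (Lp_mass M p f) (1 / p) < \<infinity>"
    using assms(1) by (simp add: Lp_space_def Lp_enorm_def ennreal_powr_ennreal)
  then show "Lp_mass M p f < \<infinity>"
    by (cases "\<integral>\<^sup>+x. ennreal (\<bar>f x\<bar> powr p) \<partial>M") auto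
qed

lemma sets_surface_measure:
  "sets (surface_measure s \<Omega>) = (\<lambda>B. B \<inter> space (surface_measure s \<Omega>)) ` sets borel"
  by (simp add: surface_measure_def sets_restrict_space space_restrict_space Int_commute)

lemma set_average_bounds:
  fixes v :: "'a::euclidean_space \<Rightarrow> real"
  assumes r: "0 < r" and v: "continuous_on (cball x r) v"
    and lo: "\<And>y. y \<in> ball x r \<Longrightarrow> a \<le> v y" and hi: "\<And>y. y \<in> ball x r \<Longrightarrow> v y \<le> b"
  shows "a \<le> (LINT y : ball x r | lborel. v y) / measure lborel (ball x r)"
    and "(LINT y : ball x r | lborel. v y) / measure lborel (ball x r) \<le> b"
proof -
  have m: "0 < measure lborel (ball x r)" by (rule content_ball_pos[OF r])
  have "set_integrable lborel (cball x r) v"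
    unfolding set_integrable_def by (rule borel_integrable_compact[OF compact_cball v])
  then have vi: "set_integrable lborel (ball x r) v"
    by (rule set_integrable_subset) auto
  have ci: "set_integrable lborel (ball x r) (\<lambda>_. c)" for c :: real
    unfolding set_integrable_def using emeasure_lborel_ball_finite[of x r] by (simp add: less_top[symmetric])
  have c: "(LINT y : ball x r | lborel. c) = c * measure lborel (ball x r)" for c :: real
    by (simp add: set_lebesgue_integral_def mult.commute)
  have "(LINT y : ball x r | lborel. a) \<le> (LINT y : ball x r | lborel. v y)"
    by (rule set_integral_mono[OF ci vi lo])
  then show "a \<le> (LINT y : ball x r | lborel. v y) / measure lborel (ball x r)"
    using m by (simp add: c pos_le_divide_eq)
  have "(LINT y : ball x r | lborel. v y) \<le> (LINT y : ball x r | lborel. b)"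
    by (rule set_integral_mono[OF vi ci hi])
  then show "(LINT y : ball x r | lborel. v y) / measure lborel (ball x r) \<le> b"
    using m by (simp add: c pos_divide_le_eq)
qed

text \<open>
  A point of the Whitney ball of \<open>x\<close> is at distance at least \<open>bdist \<Omega> x / 2\<close> from the complement, so the
  Whitney balls of points in the cone with factor \<open>B\<close> lie in the cone with factor \<open>2 * B + 1\<close>.
\<close>

lemma whitney_average_limit:
  fixes \<Omega> :: "'a::euclidean_space set"
  assumes v: "continuous_on \<Omega> v" and \<xi>: "\<xi> \<notin> \<Omega>"
    and lim: "\<And>X. (\<And>k. dist (X k) \<xi> < (2 * B + 1) * bdist \<Omega> (X k)) \<Longrightarrow> X \<longlonglongrightarrow> \<xi> \<Longrightarrow> (\<lambda>k. v (X k)) \<longlonglongrightarrow> l"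
    and Y: "\<And>k. dist (Y k) \<xi> < B * bdist \<Omega> (Y k)" "Y \<longlonglongrightarrow> \<xi>" and B: "0 < B"
  shows "(\<lambda>k. whitney_average \<Omega> v (Y k)) \<longlonglongrightarrow> l"
proof (rule LIMSEQ_I)
  fix e :: real assume e: "0 < e"
  have "\<exists>\<rho>>0. \<forall>y. dist y \<xi> < (2 * B + 1) * bdist \<Omega> y \<and> dist y \<xi> < \<rho> \<longrightarrow> \<bar>v y - l\<bar> \<le> e / 2"
  proof (rule ccontr)
    assume neg: "\<not> ?thesis"
    have "\<exists>y. dist y \<xi> < (2 * B + 1) * bdist \<Omega> y \<and> dist y \<xi> < inverse (real (Suc k)) \<and> e / 2 < \<bar>v y - l\<bar>" for k
    proof -
      have "0 < inverse (real (Suc k))" by simp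
      then show ?thesis using neg by (meson not_le)
    qed
    then obtain X where X: "\<And>k. dist (X k) \<xi> < (2 * B + 1) * bdist \<Omega> (X k)"
      "\<And>k. dist (X k) \<xi> < inverse (real (Suc k))" "\<And>k. e / 2 < \<bar>v (X k) - l\<bar>" by metis
    have "(\<lambda>k. dist (X k) \<xi>) \<longlonglongrightarrow> 0"
      by (rule tendsto_sandwich[OF _ _ tendsto_const LIMSEQ_inverse_real_of_nat])
         (use X(2) in \<open>auto intro!: always_eventually less_imp_le\<close>)
    then have "X \<longlonglongrightarrow> \<xi>" by (rule tendsto_dist_iff[THEN iffD2])
    from LIMSEQ_D[OF lim[OF X(1) this], of "e / 2"] e
    obtain k where "\<bar>v (X k) - l\<bar> < e / 2" by auto
    then show False using X(3)[of k] by simp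
  qed
  then obtain \<rho> where \<rho>: "0 < \<rho>" "\<And>y. dist y \<xi> < (2 * B + 1) * bdist \<Omega> y \<Longrightarrow> dist y \<xi> < \<rho> \<Longrightarrow> \<bar>v y - l\<bar> \<le> e / 2"
    by blast
  have "\<forall>\<^sub>F k in sequentially. dist (Y k) \<xi> < \<rho> / 2"
    using \<rho>(1) by (intro tendstoD[OF Y(2)]) simp
  then obtain K where K: "\<And>k. K \<le> k \<Longrightarrow> dist (Y k) \<xi> < \<rho> / 2" by (auto simp: eventually_sequentially)
  have "norm (whitney_average \<Omega> v (Y k) - l) < e" if "K \<le> k" for k
  proof -
    let ?x = "Y k" let ?d = "bdist \<Omega> (Y k)"
    have d: "0 < ?d"
      using Y(1)[of k] B zero_le_dist[of ?x \<xi>] by (meson le_less_trans zero_less_mult_pos)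
    have near: "?d \<le> bdist \<Omega> y + dist ?x y" for y
      unfolding bdist_def by (rule infdist_triangle)
    have bound: "\<bar>v y - l\<bar> \<le> e / 2" if y: "y \<in> ball ?x (?d / 2)" for y
    proof (rule \<rho>(2))
      have half: "?d / 2 \<le> bdist \<Omega> y" using near[of y] y by simp
      have tri: "dist y \<xi> < ?d / 2 + dist ?x \<xi>"
        using y dist_triangle[of y \<xi> ?x] by (simp add: dist_commute)
      also have "\<dots> < (2 * B + 1) * (?d / 2)" using Y(1)[of k] by (simp add: algebra_simps)
      also have "\<dots> \<le> (2 * B + 1) * bdist \<Omega> y" using half B by (intro mult_left_mono) auto
      finally show "dist y \<xi> < (2 * B + 1) * bdist \<Omega> y" .
      have "?d \<le> dist ?x \<xi>" unfolding bdist_def using \<xi> by (intro infdist_le) simp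
      then show "dist y \<xi> < \<rho>" using tri K[OF \<open>K \<le> k\<close>] \<rho>(1) by linarith
    qed
    have "cball ?x (?d / 2) \<subseteq> \<Omega>"
    proof
      fix y assume y: "y \<in> cball ?x (?d / 2)"
      then have "bdist \<Omega> y \<noteq> 0" using near[of y] d by simp
      then show "y \<in> \<Omega>" unfolding bdist_def using infdist_zero[of y "- \<Omega>"] by blast
    qed
    then have c: "continuous_on (cball ?x (?d / 2)) v" by (rule continuous_on_subset[OF v])
    have lohi: "l - e / 2 \<le> v y" "v y \<le> l + e / 2" if "y \<in> ball ?x (?d / 2)" for y
      using bound[OF that] by linarith+
    have d2: "0 < ?d / 2" using d by simp
    have "l - e / 2 \<le> whitney_average \<Omega> v ?x"
      unfolding whitney_average_def
      by (rule set_average_bounds(1)[OF d2 c, where b = "l + e / 2"]) (fact lohi)+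
    moreover have "whitney_average \<Omega> v ?x \<le> l + e / 2"
      unfolding whitney_average_def
      by (rule set_average_bounds(2)[OF d2 c, where a = "l - e / 2"]) (fact lohi)+
    ultimately have "\<bar>whitney_average \<Omega> v ?x - l\<bar> \<le> e / 2" by linarith
    then show ?thesis using e by simp
  qed
  then show "\<exists>K. \<forall>k\<ge>K. norm (whitney_average \<Omega> v (Y k) - l) < e" by blast
qed

text \<open>
  Parametrisation by arclength gives \<open>dist (\<gamma> t) \<xi> \<le> t\<close>, which is less than \<open>bdist \<Omega> (\<gamma> t) / \<theta>\<close>.
\<close>

lemma good_curve_in_cone:
  assumes \<gamma>: "good_curve \<theta> \<Omega> \<xi> x l \<gamma>" and \<theta>: "0 < \<theta>" and z: "z \<in> \<gamma> ` {0..l} - {\<xi>}"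
  shows "z \<in> \<Omega>" "dist z \<xi> < 1 / \<theta> * bdist \<Omega> z"
proof -
  show "z \<in> \<Omega>" using \<gamma> z unfolding good_curve_def by blast
  obtain t where t: "t \<in> {0..l}" "z = \<gamma> t" using z by blast
  have g0: "\<gamma> 0 = \<xi>" using \<gamma> by (simp add: good_curve_def)
  then have t0: "0 < t" using t z by (cases "t = 0") auto
  have "ennreal (dist (\<gamma> 0) (\<gamma> t)) \<le> curve_length \<gamma> 0 t"
  proof -
    let ?t = "\<lambda>i::nat. if i = 0 then 0 else t"
    have "ennreal (dist (\<gamma> 0) (\<gamma> t)) = (\<Sum>i<1. ennreal (dist (\<gamma> (?t i)) (\<gamma> (?t (Suc i)))))" by simp
    also have "\<dots> \<le> curve_length \<gamma> 0 t"
      unfolding curve_length_def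
      by (rule SUP_upper2[of "(?t, 1)"]) (use t0 in \<open>auto simp: mono_def\<close>)
    finally show ?thesis .
  qed
  also have "\<dots> = ennreal t" using \<gamma> t t0 by (simp add: good_curve_def)
  finally have "dist z \<xi> \<le> t" using t0 t g0 by (simp add: dist_commute)
  moreover have "\<theta> * t < bdist \<Omega> z" using \<gamma> t t0 by (simp add: good_curve_def)
  then have "t < 1 / \<theta> * bdist \<Omega> z" using \<theta> by (simp add: field_simps)
  ultimately show "dist z \<xi> < 1 / \<theta> * bdist \<Omega> z" by simp
qed

text \<open>
  Over a boundary of measure zero every condition on the extension is void.
\<close>

lemma trivial_extension:
  assumes "emeasure (surface_measure s \<Omega>) (frontier \<Omega>) = 0"
  shows "smooth_on \<Omega> (\<lambda>_. 0)" "Lp_enorm p (surface_measure s \<Omega>) G = 0" "AE \<xi> in surface_measure s \<Omega>. Q \<xi>"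
proof -
  show "smooth_on \<Omega> (\<lambda>_. 0)" by (rule smooth_on_const)
  show "Lp_enorm p (surface_measure s \<Omega>) G = 0" by (rule Lp_enorm_null) (simp add: assms)
  show "AE \<xi> in surface_measure s \<Omega>. Q \<xi>"
    using sets.top[of "surface_measure s \<Omega>"]
    by (intro AE_I[of _ _ "frontier \<Omega>"]) (auto simp: assms)
qed

context ahlfors_measure
begin

definition maxfun_const :: "real \<Rightarrow> real" where
  "maxfun_const p = 2 * C1 * 5 powr s * p / (p - 1) * (2 * C1) powr (p - 1)"

lemma maxfun_const_pos: "1 < p \<Longrightarrow> 0 < maxfun_const p"
  using C1_pos by (simp add: maxfun_const_def)

lemma area_const_pos: "0 < area_const"
  by (simp add: area_const_def)

definition carleson_const :: "real \<Rightarrow> real" where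
  "carleson_const p = maxfun_const p * (area_const powr p * series_const p)"

lemma carleson_const_pos: "1 < p \<Longrightarrow> 0 < carleson_const p"
  using maxfun_const_pos[of p] area_const_pos series_const_pos[of p] by (simp add: carleson_const_def)

end

abbreviation bounded_extension ::
  "nat \<Rightarrow> real \<Rightarrow> 'a::euclidean_space set \<Rightarrow> real \<Rightarrow> real \<Rightarrow> real \<Rightarrow> ('a \<Rightarrow> real) \<Rightarrow> ('a \<Rightarrow> real) \<Rightarrow> bool" where
  "bounded_extension n s \<Omega> p \<alpha> C f u \<equiv> smooth_on \<Omega> u \<and>
     Lp_enorm p (surface_measure s \<Omega>) (nt_max \<alpha> \<Omega> u) +
       Lp_enorm p (surface_measure s \<Omega>) (nt_max \<alpha> \<Omega> (\<lambda>x. bdist \<Omega> x *\<^sub>R gradient u x))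
       \<le> ennreal C * Lp_norm p (surface_measure s \<Omega>) f \<and>
     (\<forall>c. 0 < c \<and> c \<le> 1 / 4 \<longrightarrow>
       Lp_enorm p (surface_measure s \<Omega>) (carleson n s c \<Omega> (gradient u))
         \<le> ennreal C * Lp_norm p (surface_measure s \<Omega>) f)"

text \<open>
  Convergence in a cone measured by the distance to the complement. It covers both cones of fixed aperture and
  good curves.
\<close>

abbreviation cone_limit ::
  "real \<Rightarrow> 'a::euclidean_space set \<Rightarrow> ('a \<Rightarrow> real) \<Rightarrow> 'a \<Rightarrow> real \<Rightarrow> bool" where
  "cone_limit B \<Omega> F \<xi> l \<equiv> \<forall>X. (\<forall>k. X k \<in> \<Omega> \<and> dist (X k) \<xi> < B * bdist \<Omega> (X k)) \<longrightarrow>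
     X \<longlonglongrightarrow> \<xi> \<longrightarrow> (\<lambda>k. F (X k)) \<longlonglongrightarrow> l"

text \<open>
  The aperture used in the construction must exceed the given \<open>\<alpha>\<close>, and \<open>2 * B + 1\<close> for the convergence of
  Whitney averages in the cone with factor \<open>B\<close>. For \<open>c \<le> 1/4\<close> the supremum in the Carleson functional is
  over a subset of the ball of radius \<open>bd x / 4\<close>.
\<close>

lemma domain_extension:
  fixes \<Omega> :: "'a::euclidean_space set"
  assumes m: "ahlfors_measure (surface_measure s \<Omega>) s C1 n C0 d0" and op: "open \<Omega>"
    and p: "1 < p" and \<alpha>: "0 < \<alpha>" and B: "2 \<le> B"
  shows "\<exists>C>0. \<forall>f \<in> Lp_space p (surface_measure s \<Omega>). \<exists>u.
      bounded_extension n s \<Omega> p \<alpha> C f u \<and>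
     
      (AE \<xi> in surface_measure s \<Omega>. cone_limit B \<Omega> (whitney_average \<Omega> u) \<xi> (f \<xi>))"
proof -
  interpret ahlfors_measure "surface_measure s \<Omega>" s C1 n C0 d0 by (rule m)
  let ?\<sigma> = "surface_measure s \<Omega>"
  define A where "A = max (2 * B + 1) (1 + \<alpha>)"
  have A: "3 \<le> A" "2 * B + 1 \<le> A" "1 + \<alpha> \<le> A" using B by (auto simp: A_def)
  have ne: "frontier \<Omega> \<noteq> {}" using space_ne by simp
  have disj: "x \<notin> frontier \<Omega>" if "x \<in> \<Omega>" for x using op that by (simp add: frontier_def interior_open)
  have bdist: "bdist \<Omega> x = infdist x (frontier \<Omega>)" if "x \<in> \<Omega>" for x
    by (rule bdist_eq_infdist_frontier[OF op that ne])
  have bdist0: "x \<in> \<Omega>" if "0 < bdist \<Omega> x" for x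
    by (rule ccontr) (use that infdist_zero[of x "- \<Omega>"] in \<open>simp add: bdist_def\<close>)
  define a where "a = series_const p powr (1 / p)"
  define b where "b = C0 * 3 powr s * carleson_const p powr (1 / p)"
  have ab: "0 < a" "0 < b"
    using series_const_pos[of p] carleson_const_pos[OF p] C0_pos by (simp_all add: a_def b_def)
  show ?thesis
  proof (intro exI[of _ "5 * a + b"] conjI ballI)
    show "0 < 5 * a + b" using ab by simp
    fix f assume "f \<in> Lp_space p ?\<sigma>"
    then have f: "f \<in> borel_measurable ?\<sigma>" "Lp_mass ?\<sigma> p f < \<infinity>"
      using p by (auto dest: Lp_spaceD)
    show "\<exists>u. bounded_extension n s \<Omega> p \<alpha> (5 * a + b) f u \<and>
     
      (AE \<xi> in ?\<sigma>. cone_limit B \<Omega> (whitney_average \<Omega> u) \<xi> (f \<xi>))"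
    proof (rule extension_exists[OF sets_surface_measure p A(1) f])
      fix v H
      assume H: "H \<in> borel_measurable ?\<sigma>" and smooth: "smooth_on (- space ?\<sigma>) v"
        and vH: "\<And>x \<eta>. \<eta> \<in> space ?\<sigma> \<Longrightarrow> dist x \<eta> < A * bd x \<Longrightarrow> ennreal \<bar>v x\<bar> \<le> H \<eta>"
        and dvH: "\<And>x \<eta>. \<eta> \<in> space ?\<sigma> \<Longrightarrow> dist x \<eta> < A * bd x \<Longrightarrow> ennreal (bd x * norm (gradient v x)) \<le> ennreal 4 * H \<eta>"
        and car: "\<And>\<xi> r. \<xi> \<in> space ?\<sigma> \<Longrightarrow> 0 < r \<Longrightarrow> ennreal (1 / r powr s) * (\<integral>\<^sup>+x\<in>ball \<xi> r.
          (SUP y\<in>ball x (bd x / 4). ennreal (norm (gradient v y))) * ennreal (bd x powr (s - real n)) \<partial>lborel)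
          \<le> ennreal (C0 * 3 powr s) * maxfun ?\<sigma> s (\<lambda>\<eta>. ennreal area_const * H \<eta>) \<xi>"
        and Hp: "(\<integral>\<^sup>+\<eta>. ennreal_powr (H \<eta>) p \<partial>?\<sigma>) \<le> ennreal (series_const p) * Lp_mass ?\<sigma> p f"
        and lim: "AE \<xi> in ?\<sigma>. \<forall>X. (\<forall>k. dist (X k) \<xi> < A * bd (X k)) \<longrightarrow> X \<longlonglongrightarrow> \<xi> \<longrightarrow> (\<lambda>k. v (X k)) \<longlonglongrightarrow> f \<xi>"
      have sm: "smooth_on \<Omega> v" by (rule smooth_on_subset[OF smooth]) (use disj in auto)
      have p0: "0 < p" using p by simp
      have in_cone: "dist x \<xi> < A * bd x" "bdist \<Omega> x = bd x" if "x \<in> cone \<alpha> \<Omega> \<xi>" for x \<xi>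
      proof -
        have "dist x \<xi> < (1 + \<alpha>) * bd x" using that by (simp add: cone_def dist_norm)
        also have "\<dots> \<le> A * bd x" using A(3) infdist_nonneg by (rule mult_right_mono)
        finally show "dist x \<xi> < A * bd x" .
        show "bdist \<Omega> x = bd x" using bdist that by (simp add: cone_def)
      qed
      have N1: "Lp_enorm p ?\<sigma> (nt_max \<alpha> \<Omega> v) \<le> ennreal (1 * series_const p powr (1 / p)) * Lp_norm p ?\<sigma> f"
      proof (rule Lp_enorm_le[OF p0 _ series_const_pos _ H Hp])
        show "nt_max \<alpha> \<Omega> v \<xi> \<le> ennreal 1 * H \<xi>" if "\<xi> \<in> space ?\<sigma>" for \<xi>
          unfolding nt_max_def using vH[OF that in_cone(1)] by (intro SUP_least) simp
      qed simp
      have N2: "Lp_enorm p ?\<sigma> (nt_max \<alpha> \<Omega> (\<lambda>x. bdist \<Omega> x *\<^sub>R gradient v x)) \<le> ennreal (4 * series_const p powr (1 / p)) * Lp_norm p ?\<sigma> f"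
      proof (rule Lp_enorm_le[OF p0 _ series_const_pos _ H Hp])
        show "nt_max \<alpha> \<Omega> (\<lambda>x. bdist \<Omega> x *\<^sub>R gradient v x) \<xi> \<le> ennreal 4 * H \<xi>" if "\<xi> \<in> space ?\<sigma>" for \<xi>
          unfolding nt_max_def
        proof (rule SUP_least)
          fix x assume x: "x \<in> cone \<alpha> \<Omega> \<xi>"
          have "norm (bdist \<Omega> x *\<^sub>R gradient v x) = bd x * norm (gradient v x)"
            using in_cone(2)[OF x] infdist_nonneg[of x "frontier \<Omega>"] by simp
          then show "ennreal (norm (bdist \<Omega> x *\<^sub>R gradient v x)) \<le> ennreal 4 * H \<xi>"
            using dvH[OF that in_cone(1)[OF x]] by (simp only:)
        qed
      qed simp
      have "Lp_enorm p ?\<sigma> (nt_max \<alpha> \<Omega> v) + Lp_enorm p ?\<sigma> (nt_max \<alpha> \<Omega> (\<lambda>x. bdist \<Omega> x *\<^sub>R gradient v x))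
          \<le> ennreal a * Lp_norm p ?\<sigma> f + ennreal (4 * a) * Lp_norm p ?\<sigma> f"
        using add_mono[OF N1 N2] by (simp add: a_def)
      also have "\<dots> = ennreal (5 * a) * Lp_norm p ?\<sigma> f"
      proof -
        have "ennreal (5 * a) = ennreal a + ennreal (4 * a)"
          using ab(1) by (subst ennreal_plus[symmetric]) auto
        then show ?thesis by (simp add: distrib_right)
      qed
      also have "\<dots> \<le> ennreal (5 * a + b) * Lp_norm p ?\<sigma> f"
        using ab by (intro mult_right_mono ennreal_leI) auto
      finally have N: "Lp_enorm p ?\<sigma> (nt_max \<alpha> \<Omega> v) + Lp_enorm p ?\<sigma> (nt_max \<alpha> \<Omega> (\<lambda>x. bdist \<Omega> x *\<^sub>R gradient v x))
          \<le> ennreal (5 * a + b) * Lp_norm p ?\<sigma> f" .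
      have C: "Lp_enorm p ?\<sigma> (carleson n s c \<Omega> (gradient v)) \<le> ennreal (5 * a + b) * Lp_norm p ?\<sigma> f"
        if c: "0 < c" "c \<le> 1 / 4" for c
      proof -
        let ?M = "maxfun ?\<sigma> s (\<lambda>\<eta>. ennreal area_const * H \<eta>)"
        have AH [measurable]: "(\<lambda>\<eta>. ennreal area_const * H \<eta>) \<in> borel_measurable ?\<sigma>" using H by measurable
        have "Lp_enorm p ?\<sigma> (carleson n s c \<Omega> (gradient v)) \<le>
            ennreal (C0 * 3 powr s * carleson_const p powr (1 / p)) * Lp_norm p ?\<sigma> f"
        proof (rule Lp_enorm_le[OF p0 _ carleson_const_pos[OF p]])
          show "0 < C0 * 3 powr s" using C0_pos by simp
          show "?M \<in> borel_measurable ?\<sigma>" by (rule borel_measurable_maxfun[OF AH])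
          show "carleson n s c \<Omega> (gradient v) \<xi> \<le> ennreal (C0 * 3 powr s) * ?M \<xi>" if \<xi>: "\<xi> \<in> space ?\<sigma>" for \<xi>
            unfolding carleson_def
          proof (rule SUP_least)
            fix r :: real assume "r \<in> {0<..}"
            then have r: "0 < r" by simp
            have "(\<integral>\<^sup>+ x \<in> ball \<xi> r \<inter> \<Omega>. (SUP y \<in> ball x (c * bdist \<Omega> x). ennreal (norm (gradient v y))) *
                ennreal (bdist \<Omega> x powr (s - real n)) \<partial>lborel)
              \<le> (\<integral>\<^sup>+x\<in>ball \<xi> r. (SUP y\<in>ball x (bd x / 4). ennreal (norm (gradient v y))) * ennreal (bd x powr (s - real n)) \<partial>lborel)"
            proof (rule nn_integral_mono)
              fix x
              show "(SUP y \<in> ball x (c * bdist \<Omega> x). ennreal (norm (gradient v y))) *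
                  ennreal (bdist \<Omega> x powr (s - real n)) * indicator (ball \<xi> r \<inter> \<Omega>) x
                \<le> (SUP y\<in>ball x (bd x / 4). ennreal (norm (gradient v y))) * ennreal (bd x powr (s - real n)) * indicator (ball \<xi> r) x"
              proof (cases "x \<in> ball \<xi> r \<inter> \<Omega>")
                case True
                have "c * bd x \<le> 1 / 4 * bd x" using c(2) infdist_nonneg by (rule mult_right_mono)
                then have "ball x (c * bd x) \<subseteq> ball x (bd x / 4)" by (intro subset_ball) simp
                then have "(SUP y \<in> ball x (c * bd x). ennreal (norm (gradient v y)))
                    \<le> (SUP y\<in>ball x (bd x / 4). ennreal (norm (gradient v y)))" by (intro SUP_subset_mono) auto
                then show ?thesis using True bdist[of x] by (simp add: mult_right_mono)
              qed simp
            qed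
            then have "ennreal (1 / r powr s) * (\<integral>\<^sup>+ x \<in> ball \<xi> r \<inter> \<Omega>. (SUP y \<in> ball x (c * bdist \<Omega> x). ennreal (norm (gradient v y))) *
                ennreal (bdist \<Omega> x powr (s - real n)) \<partial>lborel)
              \<le> ennreal (1 / r powr s) * (\<integral>\<^sup>+x\<in>ball \<xi> r. (SUP y\<in>ball x (bd x / 4). ennreal (norm (gradient v y))) * ennreal (bd x powr (s - real n)) \<partial>lborel)"
              by (rule mult_left_mono) simp
            also have "\<dots> \<le> ennreal (C0 * 3 powr s) * ?M \<xi>" by (rule car[OF \<xi> r])
            finally show "ennreal (1 / r powr s) * (\<integral>\<^sup>+ x \<in> ball \<xi> r \<inter> \<Omega>. (SUP y \<in> ball x (c * bdist \<Omega> x). ennreal (norm (gradient v y))) *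
                ennreal (bdist \<Omega> x powr (s - real n)) \<partial>lborel) \<le> ennreal (C0 * 3 powr s) * ?M \<xi>" .
          qed
          have "(\<integral>\<^sup>+x. ennreal_powr (?M x) p \<partial>?\<sigma>)
              \<le> ennreal (maxfun_const p) * (\<integral>\<^sup>+\<eta>. ennreal_powr (ennreal area_const * H \<eta>) p \<partial>?\<sigma>)"
            unfolding maxfun_const_def by (rule strong_type_maxfun[OF AH p])
          also have "(\<integral>\<^sup>+\<eta>. ennreal_powr (ennreal area_const * H \<eta>) p \<partial>?\<sigma>) = ennreal (area_const powr p) * (\<integral>\<^sup>+\<eta>. ennreal_powr (H \<eta>) p \<partial>?\<sigma>)"
            using H area_const_pos by (simp add: ennreal_powr_cmult nn_integral_cmult borel_measurable_ennreal_powr)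
          also have "ennreal (maxfun_const p) * \<dots> \<le> ennreal (maxfun_const p) * (ennreal (area_const powr p) * (ennreal (series_const p) * Lp_mass ?\<sigma> p f))"
            by (intro mult_left_mono Hp) auto
          also have "\<dots> = ennreal (carleson_const p) * Lp_mass ?\<sigma> p f"
          proof -
            have "ennreal (carleson_const p) = ennreal (maxfun_const p) * (ennreal (area_const powr p) * ennreal (series_const p))"
              unfolding carleson_const_def using maxfun_const_pos[OF p] series_const_pos[of p]
              by (subst ennreal_mult[symmetric], simp, simp)+ simp
            then show ?thesis by (simp only: mult.assoc)
          qed
          finally show "(\<integral>\<^sup>+x. ennreal_powr (?M x) p \<partial>?\<sigma>) \<le> ennreal (carleson_const p) * Lp_mass ?\<sigma> p f" .
        qed
        also have "\<dots> \<le> ennreal (5 * a + b) * Lp_norm p ?\<sigma> f"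
          using ab by (intro mult_right_mono ennreal_leI) (auto simp: b_def)
        finally show ?thesis .
      qed
      have L: "AE \<xi> in ?\<sigma>. cone_limit B \<Omega> (whitney_average \<Omega> v) \<xi> (f \<xi>)"
        using lim AE_space
      proof eventually_elim
        fix \<xi> assume l: "\<forall>X. (\<forall>k. dist (X k) \<xi> < A * bd (X k)) \<longrightarrow> X \<longlonglongrightarrow> \<xi> \<longrightarrow> (\<lambda>k. v (X k)) \<longlonglongrightarrow> f \<xi>"
          and \<xi>: "\<xi> \<in> space ?\<sigma>"
        show "cone_limit B \<Omega> (whitney_average \<Omega> v) \<xi> (f \<xi>)"
        proof (intro allI impI)
          fix Y assume Y: "\<forall>k. Y k \<in> \<Omega> \<and> dist (Y k) \<xi> < B * bdist \<Omega> (Y k)" "Y \<longlonglongrightarrow> \<xi>"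
          show "(\<lambda>k. whitney_average \<Omega> v (Y k)) \<longlonglongrightarrow> f \<xi>"
          proof (rule whitney_average_limit[where B = B and \<xi> = \<xi>])
            show "continuous_on \<Omega> v" by (rule smooth_on_imp_continuous[OF sm])
            show "\<xi> \<notin> \<Omega>" using \<xi> disj by auto
            show "(\<lambda>k. v (X k)) \<longlonglongrightarrow> f \<xi>" if X: "\<And>k. dist (X k) \<xi> < (2 * B + 1) * bdist \<Omega> (X k)" "X \<longlonglongrightarrow> \<xi>" for X
            proof -
              have "dist (X k) \<xi> < A * bd (X k)" for k
              proof -
                have "0 < (2 * B + 1) * bdist \<Omega> (X k)" using X(1)[of k] zero_le_dist le_less_trans by blast
                then have "0 < bdist \<Omega> (X k)" using B by (simp add: zero_less_mult_iff)
                then have "bdist \<Omega> (X k) = bd (X k)" using bdist[OF bdist0] by simp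
                then have "dist (X k) \<xi> < (2 * B + 1) * bd (X k)" using X(1)[of k] by simp
                also have "\<dots> \<le> A * bd (X k)" using A(2) infdist_nonneg by (rule mult_right_mono)
                finally show ?thesis .
              qed
              then show ?thesis using l X(2) by blast
            qed
          qed (use Y B in auto)
        qed
      qed
      show ?thesis using sm N C L by blast
    qed
  qed
qed

theorem theorem1p3:
  fixes n :: nat and s C0 cstar :: real
  assumes "n \<ge> 1" and "DIM('a::euclidean_space) = n + 1"
    and "0 < s" and "s \<le> real n"
    and "0 < C0" and "0 < cstar" and "cstar < 1/2"
  shows "\<exists>c0::real. 0 < c0 \<and> c0 \<le> 1/4 \<and>
    (\<forall>(\<Omega>::'a set) \<theta> p \<alpha>.
       AR_domain n s C0 cstar \<Omega> \<and> (s = real n \<longrightarrow> pointwise_john s \<theta> \<Omega>) \<and> 1 < p \<and> 0 < \<alpha> \<longrightarrow>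
       (\<exists>C::real. 0 < C \<and>
         (\<forall>f \<in> Lp_space p (surface_measure s \<Omega>). \<exists>u :: 'a \<Rightarrow> real.
            smooth_on \<Omega> u \<and>
            Lp_enorm p (surface_measure s \<Omega>) (nt_max \<alpha> \<Omega> u) +
              Lp_enorm p (surface_measure s \<Omega>) (nt_max \<alpha> \<Omega> (\<lambda>x. bdist \<Omega> x *\<^sub>R gradient u x))
              \<le> ennreal C * Lp_norm p (surface_measure s \<Omega>) f \<and>
            (\<forall>c. 0 < c \<and> c \<le> c0 \<longrightarrow>
               Lp_enorm p (surface_measure s \<Omega>) (carleson n s c \<Omega> (gradient u))
                 \<le> ennreal C * Lp_norm p (surface_measure s \<Omega>) f) \<and>
            (AE \<xi> in surface_measure s \<Omega>.
               if s = real n then quasi_nt_converges \<theta> \<Omega> (whitney_average \<Omega> u) f \<xi>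
               else nt_converges \<Omega> (whitney_average \<Omega> u) f \<xi>))))"
proof (rule exI[of _ "1 / 4"], intro conjI allI impI)
  fix \<Omega> :: "'a set" and \<theta> p \<alpha> :: real
  assume asm: "AR_domain n s C0 cstar \<Omega> \<and> (s = real n \<longrightarrow> pointwise_john s \<theta> \<Omega>) \<and> 1 < p \<and> 0 < \<alpha>"
  let ?\<sigma> = "surface_measure s \<Omega>"
  have op: "open \<Omega>" and reg: "ahlfors_regular s C0 (frontier \<Omega>)"
    using AR_domain_frontier[of n s C0 cstar \<Omega>] asm assms by auto
  let ?P = "\<lambda>C f u. smooth_on \<Omega> u \<and>
     Lp_enorm p ?\<sigma> (nt_max \<alpha> \<Omega> u) + Lp_enorm p ?\<sigma> (nt_max \<alpha> \<Omega> (\<lambda>x. bdist \<Omega> x *\<^sub>R gradient u x))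
       \<le> ennreal C * Lp_norm p ?\<sigma> f \<and>
     (\<forall>c. 0 < c \<and> c \<le> 1 / 4 \<longrightarrow> Lp_enorm p ?\<sigma> (carleson n s c \<Omega> (gradient u)) \<le> ennreal C * Lp_norm p ?\<sigma> f) \<and>
     
            (AE \<xi> in ?\<sigma>. if s = real n then quasi_nt_converges \<theta> \<Omega> (whitney_average \<Omega> u) f \<xi>
               else nt_converges \<Omega> (whitney_average \<Omega> u) f \<xi>)"
  show "\<exists>C>0. \<forall>f\<in>Lp_space p ?\<sigma>. \<exists>u. ?P C f u"
  proof (cases "ediam (frontier \<Omega>) = 0")
    case True
    note triv = trivial_extension[OF surface_measure_null[OF \<open>0 < s\<close> True]]
    have "?P 1 f (\<lambda>_. 0)" for f by (intro conjI allI impI triv) (simp_all add: triv)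
    then have "\<forall>f\<in>Lp_space p ?\<sigma>. \<exists>u. ?P 1 f u" by blast
    then show ?thesis using zero_less_one by blast
  next
    case False
    obtain C1 where up: "upper_regular_measure ?\<sigma> s C1"
      using surface_measure_upper_regular[OF \<open>0 < s\<close> reg False] by blast
    have "\<exists>d0>0. ennreal d0 < ediam (frontier \<Omega>)"
    proof (cases "ediam (frontier \<Omega>)")
      case (real D)
      then have "0 < D" using False by (cases "D = 0") auto
      then show ?thesis using real by (intro exI[of _ "D / 2"]) (auto intro!: ennreal_lessI)
    qed (auto intro: exI[of _ 1])
    then obtain d0 where d0: "0 < d0" "ennreal d0 < ediam (frontier \<Omega>)" by blast
    have "frontier \<Omega> \<noteq> {}" using False by (auto simp: ediam_def bot_ennreal)
    then have m: "ahlfors_measure ?\<sigma> s C1 n C0 d0"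
    proof (intro ahlfors_measure.intro[OF up] ahlfors_measure_axioms.intro)
      fix x r assume x: "x \<in> space ?\<sigma>" and r: "0 < r" "r \<le> d0"
      have "ennreal r < ediam (frontier \<Omega>)" using d0(2) ennreal_leI[OF r(2)] by (rule le_less_trans[rotated])
      then show "ennreal (r powr s / C0) \<le> emeasure ?\<sigma> (ball x r \<inter> space ?\<sigma>)"
        using reg x r by (simp add: ahlfors_regular_def emeasure_surface_measure)
    qed (use assms d0 in auto)
    \<comment> \<open>The cone of aperture \<open>1\<close> corresponds to the factor \<open>2\<close>, a good curve to \<open>1 / \<theta>\<close>.\<close>
    define B where "B = max 2 (1 / \<theta>)"
    have B: "2 \<le> B" "1 / \<theta> \<le> B" by (auto simp: B_def)
    from domain_extension[OF m op _ _ B(1), of p \<alpha>] asm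
    obtain C where C: "0 < C" and ext: "\<And>f. f \<in> Lp_space p ?\<sigma> \<Longrightarrow> \<exists>u. bounded_extension n s \<Omega> p \<alpha> C f u \<and>
     
      (AE \<xi> in ?\<sigma>. cone_limit B \<Omega> (whitney_average \<Omega> u) \<xi> (f \<xi>))"
      by blast
    show ?thesis
    proof (intro exI[of _ C] conjI ballI C)
      fix f assume "f \<in> Lp_space p ?\<sigma>"
      from ext[OF this] obtain u where u: "bounded_extension n s \<Omega> p \<alpha> C f u"
        and lim: "AE \<xi> in ?\<sigma>. cone_limit B \<Omega> (whitney_average \<Omega> u) \<xi> (f \<xi>)" by blast
      have "AE \<xi> in ?\<sigma>. if s = real n then quasi_nt_converges \<theta> \<Omega> (whitney_average \<Omega> u) f \<xi>
               else nt_converges \<Omega> (whitney_average \<Omega> u) f \<xi>"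
      proof (cases "s = real n")
        case True
        then have \<theta>: "0 < \<theta>" and john: "AE \<xi> in ?\<sigma>. \<exists>r>0. \<exists>x \<in> \<Omega> \<inter> ball \<xi> (2 * r). \<theta> * r \<le> bdist \<Omega> x \<and>
            (\<exists>l \<gamma>. good_curve \<theta> \<Omega> \<xi> x l \<gamma> \<and> \<gamma> ` {0..l} \<subseteq> ball \<xi> (2 * r) \<and> l \<le> r / \<theta>)"
          using asm by (auto simp: pointwise_john_def)
        have "AE \<xi> in ?\<sigma>. quasi_nt_converges \<theta> \<Omega> (whitney_average \<Omega> u) f \<xi>"
          using lim john
        proof eventually_elim
          case (elim \<xi>)
          then obtain r x l \<gamma> where g: "0 < r" "x \<in> \<Omega> \<inter> ball \<xi> (2 * r)" "\<theta> * r \<le> bdist \<Omega> x"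
            "good_curve \<theta> \<Omega> \<xi> x l \<gamma>" "\<gamma> ` {0..l} \<subseteq> ball \<xi> (2 * r)" by blast
          have "(\<lambda>k. whitney_average \<Omega> u (X k)) \<longlonglongrightarrow> f \<xi>"
            if X: "\<forall>k. X k \<in> \<gamma> ` {0..l} - {\<xi>}" "X \<longlonglongrightarrow> \<xi>" for X
          proof -
            have "X k \<in> \<Omega> \<and> dist (X k) \<xi> < B * bdist \<Omega> (X k)" for k
            proof -
              note c = good_curve_in_cone[OF g(4) \<theta> X(1)[rule_format, of k]]
              have "0 \<le> bdist \<Omega> (X k)" by (simp add: bdist_def infdist_nonneg)
              then have "1 / \<theta> * bdist \<Omega> (X k) \<le> B * bdist \<Omega> (X k)" using B(2) by (intro mult_right_mono)
              then show ?thesis using c by simp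
            qed
            then show ?thesis using elim(1) X(2) by blast
          qed
          then show ?case unfolding quasi_nt_converges_def using g by blast
        qed
        then show ?thesis using True by simp
      next
        case False
        have "AE \<xi> in ?\<sigma>. nt_converges \<Omega> (whitney_average \<Omega> u) f \<xi>"
          using lim
        proof eventually_elim
          case (elim \<xi>)
          have "(\<lambda>k. whitney_average \<Omega> u (X k)) \<longlonglongrightarrow> f \<xi>"
            if X: "\<forall>k. X k \<in> cone 1 \<Omega> \<xi>" "X \<longlonglongrightarrow> \<xi>" for X
          proof -
            have "X k \<in> \<Omega> \<and> dist (X k) \<xi> < B * bdist \<Omega> (X k)" for k
            proof -
              have k: "X k \<in> \<Omega>" "dist (X k) \<xi> < 2 * infdist (X k) (frontier \<Omega>)"
                using X(1) by (auto simp: cone_def dist_norm)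
              have "2 * infdist (X k) (frontier \<Omega>) \<le> B * infdist (X k) (frontier \<Omega>)"
                using B(1) infdist_nonneg by (rule mult_right_mono)
              then show ?thesis
                using k bdist_eq_infdist_frontier[OF op k(1) \<open>frontier \<Omega> \<noteq> {}\<close>] by simp
            qed
            then show ?thesis using elim X(2) by blast
          qed
          then show ?case unfolding nt_converges_def by (intro exI[of _ 1]) auto
        qed
        then show ?thesis using False by simp
      qed
      then show "\<exists>u. ?P C f u" using u by blast
    qed
  qed
qed simp_all

end
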